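(* Let $g$ be a continuous probability density on $\mathbb{R}^n$, and consider one of the three settings (1) one-sample, (2) two-sample, (3) $F$-statistic described in the context, with $T$, $K_g$ and $G$ as defined there; assume the corresponding integrability condition given there and that $K_g>0$. Let $t(u)=\mathbf{P}(T>u)$ computed when the data vector is distributed as $\mathrm{MVN}(\mathbf{0},\sigma^2\mathbf{1}_n)$ ($\sigma^2>0$; $\mathbf{1}_n$ the identity matrix). Put $(\alpha,m,k)=(2,1,n-1)$, $(2,1,n-2)$, $(1,n_1-1,n_2-1)$ in settings (1), (2), (3) respectively. If $G$ is twice differentiable in some neighborhood of zero, then, with $\mathbf{P}(T>u)$ computed under density $g$, $$\frac{\mathbf{P}(T>u)-K_g\,t(u)}{\mathbf{P}(T>u)}=\frac{C_3}{u^\alpha}\,(1+o(1))\qquad\text{as }u\to\infty,$$ where $$C_3=\frac{\alpha k\,B(m/2,k/2)}{2(k/m)^{k/2}}\cdot\frac{L_{G,\alpha}}{K_g},\qquad L_{G,\alpha}=C_1\frac{\mathrm{tr}(\mathrm{Hess}(G(\mathbf{0})))}{2(k+2)}-C_2\frac{K_{G,\alpha}}{\alpha},$$ $$K_{G,\alpha}=\frac{\alpha k\,B(m/2,k/2)}{2(k/m)^{k/2}}\,\mathrm{Vol}(B_k)\,G(\mathbf{0}),\qquad C_1=\mathrm{Vol}(B_k),\qquad C_2=\frac{k(k+m)}{m(k+2)}\cdot\frac{(k/m)^{k/2}}{B(m/2,k/2)}.$$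
   Context: $B_k$ is the unit ball of $\mathbb{R}^k$, $B(\cdot,\cdot)$ the Beta function, $\mathrm{Hess}(G(\mathbf{0}))$ the Hessian matrix of $G$ at $\mathbf{0}$, $\mathrm{tr}$ the trace; $\mathrm{MVN}$ denotes the multivariate normal distribution. Sample variances use the divisor (sample size minus one). Vectors $\mathbf{e}_i$ are standard basis vectors. (1) One-sample: $n\ge2$, $\mathbf{X}\in\mathbb{R}^n$ has density $g$, $T=\sqrt n\,\overline{\mathbf{X}}/S$ (sample mean, sample standard deviation). $\mathbf{I}=(1/\sqrt n,\dots,1/\sqrt n)$, $L=\mathrm{span}(\mathbf{I})$. Integrability condition: for some $\varepsilon>0$, $\int_0^\infty r^{n-1}\sup_{\|\boldsymbol\xi\|<\varepsilon,\boldsymbol\xi\in L^\perp}g(r(\mathbf{I}+\boldsymbol\xi))\,dr<\infty$. $K_g=\frac{2\pi^{n/2}}{\Gamma(n/2)}\int_0^\infty r^{n-1}g(r\mathbf{I})\,dr$. For $\mathbf{t}\in\mathbb{R}^{n-1}$, $$G(\mathbf{t})=(n-1)^{(n-1)/2}\int_0^\infty r^{n-1}g\big(r(\mathbf{I}+A\mathbf{v}(\mathbf{t}))\big)\,dr,\quad \mathbf{v}(\mathbf{t})=(n-1)^{1/2}(t_1,\dots,t_{n-1},0),$$ with $A$ an orthogonal linear operator on $\mathbb{R}^n$ such that $A\mathbf{e}_n=\mathbf{I}$. (2) Student two-sample: $n_1,n_2\ge2$, $n=n_1+n_2$, $a=\frac{n_1-1}{n-2}(\frac1{n_1}+\frac1{n_2})$,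 $b=\frac{n_2-1}{n-2}(\frac1{n_1}+\frac1{n_2})$, $\mathbf{X}\in\mathbb{R}^n$ has density $g$, $T=\big(\frac1{n_1}\sum_{i\le n_1}X_i-\frac1{n_2}\sum_{i>n_1}X_i\big)/\sqrt{aS_1^2+bS_2^2}$, with $S_1^2,S_2^2$ the sample variances of the first $n_1$ and the last $n_2$ coordinates. $\mathbf{I}_1$ has first $n_1$ coordinates $1/\sqrt{n_1}$, others $0$; $\mathbf{I}_2$ has last $n_2$ coordinates $1/\sqrt{n_2}$, others $0$; $L=\mathrm{span}(\mathbf{I}_1,\mathbf{I}_2)$; $\omega_0=\arccos\sqrt{n_2/n}$; $\mathbf{w}(\omega)=\cos(\omega-\omega_0)\mathbf{I}_1+\sin(\omega-\omega_0)\mathbf{I}_2$. Integrability condition: for some $\varepsilon>0$, $\int_{-\pi/2}^{\pi/2}\cos(\omega)^{n-2}\int_0^\infty r^{n-1}\sup_{\|\boldsymbol\xi\|<\varepsilon,\boldsymbol\xi\in L^\perp}g(r(\mathbf{w}(\omega)+\boldsymbol\xi))\,dr\,d\omega<\infty$. With $M=\left(\frac{n_1-1}{a}\right)^{(n_1-1)/2}\left(\frac{n_2-1}{b}\right)^{(n_2-1)/2}\left(\frac1{n_1}+\frac1{n_2}\right)^{(n-2)/2}$, $$K_g=\frac{2\pi^{(n-1)/2}M}{\Gamma(\frac{n-1}2)(n-2)^{(n-2)/2}}\int_{-\pi/2}^{\pi/2}\cos(\omega)^{n-2}\int_0^\infty r^{n-1}g(r\mathbf{w}(\omega))\,dr\,d\omega.$$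 For $\mathbf{t}\in\mathbb{R}^{n-2}$, $$G(\mathbf{t})=M\int_{-\pi/2}^{\pi/2}\cos(\omega)^{n-2}\int_0^\infty r^{n-1}g\big(r(\mathbf{w}(\omega)+A\mathbf{v}(\mathbf{t},\omega-\omega_0))\big)\,dr\,d\omega,$$ $\mathbf{v}(\mathbf{t},\omega)=(c_1(\omega)t_1,\dots,c_1(\omega)t_{n_1-1},0,c_2(\omega)t_{n_1},\dots,c_2(\omega)t_{n-2},0)$, $c_1(\omega)=\sqrt{\frac1{n_1}+\frac1{n_2}}\sqrt{\frac{n_1-1}{a}}\cos\omega$, $c_2(\omega)=\sqrt{\frac1{n_1}+\frac1{n_2}}\sqrt{\frac{n_2-1}{b}}\cos\omega$, with $A$ an orthogonal linear operator on $\mathbb{R}^n$ such that $A\mathbf{e}_{n_1}=\mathbf{I}_1$ and $A\mathbf{e}_n=\mathbf{I}_2$. (3) $F$-statistic: $n_1,n_2\ge2$, $n=n_1+n_2$, $(\mathbf{X},\mathbf{Y})\in\mathbb{R}^{n_1}\times\mathbb{R}^{n_2}$ has density $g(\mathbf{x},\mathbf{y})$, $T=S_1^2/S_2^2$ is the ratio of the sample variances of $\mathbf{X}$ and $\mathbf{Y}$. $s_1(\mathbf{x})$ is the sample standard deviation of $\mathbf{x}\in\mathbb{R}^{n_1}$, $\mathbf{J}=(1/\sqrt{n_2},\dots,1/\sqrt{n_2})\in\mathbb{R}^{n_2}$, $L=\mathrm{span}(\mathbf{J})$. Integrability condition: for some $\varepsilon>0$, $\int_{\mathbb{R}^{n_1}}s_1(\mathbf{x})^{n_2-1}\int_{-\infty}^\infty\sup_{\|\boldsymbol\xi\|<\varepsilon,\boldsymbol\xi\in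 L^\perp}g(\mathbf{x},r\mathbf{J}+s_1(\mathbf{x})\boldsymbol\xi)\,dr\,d\mathbf{x}<\infty$. $$K_g=\frac{\Gamma(\frac{n_1-1}2)(\pi(n_1-1))^{(n_2-1)/2}}{\Gamma(\frac{n-2}2)}\int_{\mathbb{R}^{n_1}}s_1(\mathbf{x})^{n_2-1}\int_{-\infty}^\infty g(\mathbf{x},r\mathbf{J})\,dr\,d\mathbf{x}.$$ For $\mathbf{t}\in\mathbb{R}^{n_2-1}$, $$G(\mathbf{t})=(n_2-1)^{(n_2-1)/2}\int_{\mathbb{R}^{n_1}}s_1(\mathbf{x})^{n_2-1}\int_{-\infty}^\infty g\big(\mathbf{x},\,r\mathbf{J}+\sqrt{n_2-1}\,s_1(\mathbf{x})\,A(t_1,\dots,t_{n_2-1},0)\big)\,dr\,d\mathbf{x},$$ with $A$ an orthogonal linear operator on $\mathbb{R}^{n_2}$ such that $A\mathbf{e}_{n_2}=\mathbf{J}$.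
   Formalization: Two formulas are corrected, as the claim fails for normal g: L_{G,α} has + (not −) before C_2 K_{G,α}/α, and the two-sample G uses v(t,ω) instead of v(t,ω−ω_0). If C_3=0, the expansion is read as o(u^{-α}). *)

theory Defs
  imports "HOL-Analysis.Analysis"
begin

text \<open>
  Conventions. \<open>\<real>\<close>-vectors of length \<open>n\<close> are functions on a finite index type with \<open>n\<close> elements.
  Where the last coordinate of a sample plays a special role (as the target of \<open>(t, 0)\<close> and as the
  basis vector \<open>e\<^sub>n\<close>) the index type is \<open>'k option\<close>, and \<^const>\<open>None\<close> is that last index; so
  \<open>CARD('k option) = CARD('k) + 1 \<ge> 2\<close>, and every \<open>n \<ge> 2\<close> occurs.  A pooled two-sample vector has
  index type \<open>'m + 'n\<close>, with \<^const>\<open>Inl\<close> for the first sample and \<^const>\<open>Inr\<close> for the second.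

  Two misprints of the source are corrected; both corrections are marked below.
\<close>

section \<open>Densities and tail probabilities\<close>

definition continuous_pdf :: "('a::euclidean_space \<Rightarrow> real) \<Rightarrow> bool" where
  "continuous_pdf g \<longleftrightarrow>
     continuous_on UNIV g \<and> (\<forall>x. 0 \<le> g x) \<and> (\<integral>\<^sup>+ x. ennreal (g x) \<partial>lborel) = 1"

text \<open>The probability of \<open>T(X) > u\<close> when \<open>X\<close> has density \<open>g\<close>.\<close>
definition tail_prob :: "('a::euclidean_space \<Rightarrow> real) \<Rightarrow> ('a \<Rightarrow> real) \<Rightarrow> real \<Rightarrow> real" where
  "tail_prob g T u = measure (density lborel (\<lambda>x. ennreal (g x))) {x. T x > u}"

text \<open>Density of the multivariate normal distribution with mean \<open>0\<close> and covariance \<open>\<sigma>\<^sup>2\<close> times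
  the identity.\<close>
definition mvn_pdf :: "real \<Rightarrow> 'a::euclidean_space \<Rightarrow> real" where
  "mvn_pdf \<sigma> x = exp (- (norm x)\<^sup>2 / (2 * \<sigma>\<^sup>2)) / (2 * pi * \<sigma>\<^sup>2) powr (real DIM('a) / 2)"

section \<open>Twice differentiable functions\<close>

definition gradient :: "(real^'k \<Rightarrow> real) \<Rightarrow> real^'k \<Rightarrow> real^'k" where
  "gradient G x = (\<chi> i. frechet_derivative G (at x) (axis i 1))"

definition hessian :: "(real^'k \<Rightarrow> real) \<Rightarrow> real^'k \<Rightarrow> real^'k^'k" where
  "hessian G x = jacobian (gradient G) (at x)"

definition twice_differentiable_near :: "(real^'k \<Rightarrow> real) \<Rightarrow> real^'k \<Rightarrow> bool" where
  "twice_differentiable_near G x0 \<longleftrightarrow>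
     (\<exists>U. open U \<and> x0 \<in> U \<and>
        (\<forall>x\<in>U. G differentiable (at x) \<and> gradient G differentiable (at x)))"

section \<open>The constants and the asymptotic expansion\<close>

definition tail_factor :: "nat \<Rightarrow> nat \<Rightarrow> nat \<Rightarrow> real" where
  "tail_factor \<alpha> m k =
     real \<alpha> * real k * Beta (real m / 2) (real k / 2) / (2 * (real k / real m) powr (real k / 2))"

definition const_C1 :: "nat \<Rightarrow> real" where
  "const_C1 k = unit_ball_vol (real k)"

definition const_C2 :: "nat \<Rightarrow> nat \<Rightarrow> real" where
  "const_C2 m k =
     real k * (real k + real m) / (real m * (real k + 2)) *
     ((real k / real m) powr (real k / 2) / Beta (real m / 2) (real k / 2))"

definition const_KG :: "nat \<Rightarrow> nat \<Rightarrow> nat \<Rightarrow> (real^'k \<Rightarrow> real) \<Rightarrow> real" where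
  "const_KG \<alpha> m k G = tail_factor \<alpha> m k * unit_ball_vol (real k) * G 0"

text \<open>Correction: the source has a minus sign in front of the second summand.  The null tail is
  \<open>t(u) = u powr (- k\<alpha>/2) * (1 / tail_factor \<alpha> m k - (C\<^sub>2/\<alpha>) u powr (-\<alpha>) + \<dots>)\<close>, so that subtracting
  \<open>K\<^sub>g t(u)\<close> adds \<open>C\<^sub>2 K\<^sub>g / \<alpha>\<close>.  With the minus sign the claim fails for \<open>g = mvn_pdf \<sigma>\<close>: there \<open>K\<^sub>g = 1\<close> and the
  left-hand side of the expansion vanishes identically, while the trace of the Hessian is negative
  and \<open>C\<^sub>1, C\<^sub>2, K\<^sub>G\<close> are positive.\<close>
definition const_LG :: "nat \<Rightarrow> nat \<Rightarrow> nat \<Rightarrow> (real^'k \<Rightarrow> real) \<Rightarrow> real" where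
  "const_LG \<alpha> m k G =
     const_C1 k * (trace (hessian G 0) / (2 * (real k + 2))) +
     const_C2 m k * (const_KG \<alpha> m k G / real \<alpha>)"

definition const_C3 :: "nat \<Rightarrow> nat \<Rightarrow> nat \<Rightarrow> real \<Rightarrow> (real^'k \<Rightarrow> real) \<Rightarrow> real" where
  "const_C3 \<alpha> m k K G = tail_factor \<alpha> m k * (const_LG \<alpha> m k G / K)"

text \<open>The relation \<open>rel(u) = C/u\<^sup>\<alpha> (1 + o(1))\<close>.  It is \<open>rel(u) = C/u\<^sup>\<alpha> + o(1/u\<^sup>\<alpha>)\<close>, which also
  gives it the intended meaning if \<open>C = 0\<close> (where the product form would say that \<open>rel\<close> vanishes
  for all large \<open>u\<close>).\<close>
definition leading_term :: "(real \<Rightarrow> real) \<Rightarrow> real \<Rightarrow> nat \<Rightarrow> bool" where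
  "leading_term rel C \<alpha> \<longleftrightarrow>
     (\<lambda>u. rel u - C / u ^ \<alpha>) \<in> o[at_top](\<lambda>u. 1 / u ^ \<alpha>) \<and>
     (C \<noteq> 0 \<longrightarrow> rel \<sim>[at_top] (\<lambda>u. C / u ^ \<alpha>))"

definition relative_error ::
  "('a::euclidean_space \<Rightarrow> real) \<Rightarrow> ('a \<Rightarrow> real) \<Rightarrow> ('a \<Rightarrow> real) \<Rightarrow> real \<Rightarrow> real \<Rightarrow> real" where
  "relative_error g g0 T K u = (tail_prob g T u - K * tail_prob g0 T u) / tail_prob g T u"

section \<open>Sample statistics\<close>

definition sample_mean :: "real^'n \<Rightarrow> real" where
  "sample_mean x = (\<Sum>i\<in>UNIV. x $ i) / real CARD('n)"

definition sample_var :: "real^'n \<Rightarrow> real" where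
  "sample_var x = (\<Sum>i\<in>UNIV. (x $ i - sample_mean x)\<^sup>2) / (real CARD('n) - 1)"

definition sample_sd :: "real^'n \<Rightarrow> real" where
  "sample_sd x = sqrt (sample_var x)"

definition diag_vec :: "real^'n" where
  "diag_vec = (\<chi> i. 1 / sqrt (real CARD('n)))"

text \<open>\<open>(t\<^sub>1, \<dots>, t\<^sub>n\<^sub>-\<^sub>1, 0)\<close>\<close>
definition pad :: "real^'k \<Rightarrow> real^('k::finite option)" where
  "pad t = (\<chi> i. case i of None \<Rightarrow> 0 | Some j \<Rightarrow> t $ j)"

section \<open>One-sample statistic\<close>

definition one_T :: "real^'n \<Rightarrow> real" where
  "one_T x = sqrt (real CARD('n)) * sample_mean x / sample_sd x"

definition one_integrability :: "(real^'n \<Rightarrow> real) \<Rightarrow> bool" where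
  "one_integrability g \<longleftrightarrow>
     (\<exists>\<epsilon>>0. (\<integral>\<^sup>+ r\<in>{0..}. ennreal (r ^ (CARD('n) - 1)) *
        (SUP \<xi>\<in>{\<xi>. norm \<xi> < \<epsilon> \<and> \<xi> \<in> (span {diag_vec})\<^sup>\<bottom>}. ennreal (g (r *\<^sub>R (diag_vec + \<xi>))))
        \<partial>lborel) < \<infinity>)"

definition one_K :: "(real^'n \<Rightarrow> real) \<Rightarrow> real" where
  "one_K g = 2 * pi powr (real CARD('n) / 2) / Gamma (real CARD('n) / 2) *
     (LINT r:{0..}|lborel. r ^ (CARD('n) - 1) * g (r *\<^sub>R diag_vec))"

definition one_G ::
  "(real^('k::finite option) \<Rightarrow> real^('k::finite option)) \<Rightarrow> (real^('k::finite option) \<Rightarrow> real) \<Rightarrow> real^'k \<Rightarrow> real" where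
  "one_G A g t =
     (let n = CARD('k option); v = sqrt (real n - 1) *\<^sub>R pad t in
      (real n - 1) powr ((real n - 1) / 2) *
      (LINT r:{0..}|lborel. r ^ (n - 1) * g (r *\<^sub>R (diag_vec + A v))))"

section \<open>Student two-sample statistic\<close>

definition two_a :: "nat \<Rightarrow> nat \<Rightarrow> real" where
  "two_a n1 n2 = (real n1 - 1) / (real n1 + real n2 - 2) * (1 / real n1 + 1 / real n2)"

definition two_b :: "nat \<Rightarrow> nat \<Rightarrow> real" where
  "two_b n1 n2 = (real n2 - 1) / (real n1 + real n2 - 2) * (1 / real n1 + 1 / real n2)"

definition first_sample :: "real^('m::finite + 'n::finite) \<Rightarrow> real^'m" where
  "first_sample x = (\<chi> i. x $ Inl i)"

definition second_sample :: "real^('m::finite + 'n::finite) \<Rightarrow> real^'n" where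
  "second_sample x = (\<chi> j. x $ Inr j)"

definition two_T :: "real^('m::finite + 'n::finite) \<Rightarrow> real" where
  "two_T x =
     (sample_mean (first_sample x) - sample_mean (second_sample x)) /
     sqrt (two_a CARD('m) CARD('n) * sample_var (first_sample x) +
           two_b CARD('m) CARD('n) * sample_var (second_sample x))"

definition two_I1 :: "real^('m::finite + 'n::finite)" where
  "two_I1 = (\<chi> i. case i of Inl _ \<Rightarrow> 1 / sqrt (real CARD('m)) | Inr _ \<Rightarrow> 0)"

definition two_I2 :: "real^('m::finite + 'n::finite)" where
  "two_I2 = (\<chi> i. case i of Inl _ \<Rightarrow> 0 | Inr _ \<Rightarrow> 1 / sqrt (real CARD('n)))"

definition two_w :: "real \<Rightarrow> real^('m::finite + 'n::finite)" where
  "two_w \<omega> =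
     (let \<omega>0 = arccos (sqrt (real CARD('n) / real (CARD('m) + CARD('n)))) in
      cos (\<omega> - \<omega>0) *\<^sub>R two_I1 + sin (\<omega> - \<omega>0) *\<^sub>R two_I2)"

definition two_integrability :: "(real^('m::finite + 'n::finite) \<Rightarrow> real) \<Rightarrow> bool" where
  "two_integrability g \<longleftrightarrow>
     (let n = CARD('m) + CARD('n) in
      \<exists>\<epsilon>>0. (\<integral>\<^sup>+ \<omega>\<in>{-pi/2..pi/2}. ennreal (cos \<omega> ^ (n - 2)) *
        (\<integral>\<^sup>+ r\<in>{0..}. ennreal (r ^ (n - 1)) *
          (SUP \<xi>\<in>{\<xi>. norm \<xi> < \<epsilon> \<and> \<xi> \<in> (span {two_I1, two_I2})\<^sup>\<bottom>}.
             ennreal (g (r *\<^sub>R (two_w \<omega> + \<xi>))))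
          \<partial>lborel)
        \<partial>lborel) < \<infinity>)"

definition two_M :: "nat \<Rightarrow> nat \<Rightarrow> real" where
  "two_M n1 n2 =
     ((real n1 - 1) / two_a n1 n2) powr ((real n1 - 1) / 2) *
     ((real n2 - 1) / two_b n1 n2) powr ((real n2 - 1) / 2) *
     (1 / real n1 + 1 / real n2) powr ((real n1 + real n2 - 2) / 2)"

definition two_K :: "(real^('m::finite + 'n::finite) \<Rightarrow> real) \<Rightarrow> real" where
  "two_K g =
     (let n = CARD('m) + CARD('n) in
      2 * pi powr ((real n - 1) / 2) * two_M CARD('m) CARD('n) /
        (Gamma ((real n - 1) / 2) * (real n - 2) powr ((real n - 2) / 2)) *
      (LINT \<omega>:{-pi/2..pi/2}|lborel. cos \<omega> ^ (n - 2) *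
        (LINT r:{0..}|lborel. r ^ (n - 1) * g (r *\<^sub>R two_w \<omega>))))"

definition two_c1 :: "nat \<Rightarrow> nat \<Rightarrow> real \<Rightarrow> real" where
  "two_c1 n1 n2 \<omega> =
     sqrt (1 / real n1 + 1 / real n2) * sqrt ((real n1 - 1) / two_a n1 n2) * cos \<omega>"

definition two_c2 :: "nat \<Rightarrow> nat \<Rightarrow> real \<Rightarrow> real" where
  "two_c2 n1 n2 \<omega> =
     sqrt (1 / real n1 + 1 / real n2) * sqrt ((real n2 - 1) / two_b n1 n2) * cos \<omega>"

definition two_v :: "real^('a::finite + 'b::finite) \<Rightarrow> real \<Rightarrow> real^('a::finite option + 'b::finite option)" where
  "two_v t \<omega> =
     (let n1 = CARD('a option); n2 = CARD('b option) in
      \<chi> i. case i of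
             Inl p \<Rightarrow> two_c1 n1 n2 \<omega> * pad (first_sample t) $ p
           | Inr q \<Rightarrow> two_c2 n1 n2 \<omega> * pad (second_sample t) $ q)"

text \<open>Correction: the source has \<open>v(t, \<omega> - \<omega>\<^sub>0)\<close>.  The numerator of \<open>T\<close> at \<open>r (w(\<omega>) + A v)\<close> is
  \<open>r sqrt(1/n\<^sub>1 + 1/n\<^sub>2) cos \<omega>\<close>, so the substitution behind \<open>G\<close>, in which \<open>T = 1/\<parallel>t\<parallel>\<close> and the
  Jacobian is \<open>M * r ^ (n - 1) * cos \<omega> ^ (n - 2)\<close>, has \<open>v(t, \<omega>)\<close>.  With \<open>\<omega> - \<omega>\<^sub>0\<close> the Hessian is wrong and the
  claim fails for \<open>g = mvn_pdf \<sigma>\<close>, whichever sign is taken in \<open>const_LG\<close>.\<close>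
definition two_G ::
  "(real^('a::finite option + 'b::finite option) \<Rightarrow> real^('a::finite option + 'b::finite option)) \<Rightarrow>
   (real^('a::finite option + 'b::finite option) \<Rightarrow> real) \<Rightarrow> real^('a::finite + 'b::finite) \<Rightarrow> real" where
  "two_G A g t =
     (let n1 = CARD('a option); n2 = CARD('b option); n = n1 + n2 in
      two_M n1 n2 *
      (LINT \<omega>:{-pi/2..pi/2}|lborel. cos \<omega> ^ (n - 2) *
        (LINT r:{0..}|lborel. r ^ (n - 1) * g (r *\<^sub>R (two_w \<omega> + A (two_v t \<omega>))))))"

section \<open>F-statistic\<close>

definition F_T :: "(real^'m) \<times> (real^'n) \<Rightarrow> real" where
  "F_T z = sample_var (fst z) / sample_var (snd z)"

definition F_integrability :: "((real^'m) \<times> (real^'n) \<Rightarrow> real) \<Rightarrow> bool" where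
  "F_integrability g \<longleftrightarrow>
     (\<exists>\<epsilon>>0. (\<integral>\<^sup>+ x. ennreal (sample_sd x ^ (CARD('n) - 1)) *
        (\<integral>\<^sup>+ r. (SUP \<xi>\<in>{\<xi>. norm \<xi> < \<epsilon> \<and> \<xi> \<in> (span {diag_vec})\<^sup>\<bottom>}.
             ennreal (g (x, r *\<^sub>R diag_vec + sample_sd x *\<^sub>R \<xi>)))
          \<partial>lborel)
        \<partial>lborel) < \<infinity>)"

definition F_K :: "((real^'m) \<times> (real^'n) \<Rightarrow> real) \<Rightarrow> real" where
  "F_K g =
     (let n1 = CARD('m); n2 = CARD('n); n = n1 + n2 in
      Gamma ((real n1 - 1) / 2) * (pi * (real n1 - 1)) powr ((real n2 - 1) / 2) /
        Gamma ((real n - 2) / 2) *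
      (LINT x|lborel. sample_sd x ^ (n2 - 1) *
        (LINT r|lborel. g (x, r *\<^sub>R diag_vec))))"

definition F_G ::
  "(real^('k::finite option) \<Rightarrow> real^('k::finite option)) \<Rightarrow> ((real^'m) \<times> (real^('k::finite option)) \<Rightarrow> real) \<Rightarrow>
   real^'k \<Rightarrow> real" where
  "F_G A g t =
     (let n2 = CARD('k option) in
      (real n2 - 1) powr ((real n2 - 1) / 2) *
      (LINT x|lborel. sample_sd x ^ (n2 - 1) *
        (LINT r|lborel.
          g (x, r *\<^sub>R diag_vec + (sqrt (real n2 - 1) * sample_sd x) *\<^sub>R A (pad t)))))"

end

theory Submission
  imports Defs "HOL-Probability.Distributions"
begin

text \<open>
  Split the data isometrically into a parameter \<open>z\<close> (the component in \<open>L\<close>, and for the F-statistic also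
  the first sample) and a vector \<open>y\<close> in \<open>k\<close>-space.  The event \<open>T > u\<close> reads \<open>norm y < r * rad z\<close> with
  \<open>r = u powr (- \<alpha> / 2)\<close>, so the substitution \<open>y = rad z * t\<close> turns \<open>P(T > u)\<close> into the integral of \<open>G\<close>
  over the ball of radius \<open>r\<close>.  For the normal density \<open>G\<close> is the Student-type function
  \<open>C * (1 + (k/m) * (norm t)\<^sup>2) powr (- (k + m) / 2)\<close>, where \<open>C\<close> is found from the total mass \<open>1/\<alpha>\<close>, and
  \<open>K\<^sub>g\<close> is the quotient of \<open>G(0)\<close> and \<open>C\<close>.  Hence the numerator of the relative error integrates a function
  that vanishes at \<open>0\<close> over a small ball; its linear part has integral \<open>0\<close>, and its quadratic part
  contributes a trace.
\<close>

section \<open>Isometries and Gaussian integrals\<close>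

text \<open>No limit is taken under an integral sign. Smoothness of \<open>G\<close> is a
  hypothesis, so what has to be shown is an exact identity: for large \<open>u\<close> the tail
  probability is the integral of \<open>G\<close> over a ball. Its proof works with extended
  nonnegative integrals, where Tonelli and substitutions hold without integrability. The
  integrability condition enters at the end: it makes the value finite for small \<open>t\<close>,
  so that it agrees with the Bochner integral defining \<open>G\<close>, which would be 0 for a
  non-integrable function. The power of \<open>u\<close> reflects how \<open>T\<close> depends on
  \<open>norm y\<close>: inversely for the t-statistics, as an inverse square for F. In all cases
  \<open>r\<^sup>2 = 1 / u ^ \<alpha>\<close>, so a second-order effect in \<open>r\<close> shows up
  at that order. The Student shape comes from spherical symmetry: stretching the \<open>m\<close>
  directions that determine \<open>rad z\<close> compensates for \<open>norm t\<close> in the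
  Gaussian exponent. Since the constant follows from one total-mass argument, each setting only has
  to compare prefactors.\<close>

lemma borel_measurable_linear:
  fixes f :: "'a::euclidean_space \<Rightarrow> 'b::euclidean_space"
  shows "linear f \<Longrightarrow> f \<in> borel_measurable borel"
  by (simp add: borel_measurable_continuous_onI linear_continuous_on linear_linear)

text \<open>Source and target are different types (a product and a coordinate space), so
  \<open>f\<close> has no determinant, and translation invariance is used instead. Equal dimensions
  give surjectivity and equal volumes of the unit balls.\<close>

lemma lborel_distr_isometry:
  fixes f :: "'a::euclidean_space \<Rightarrow> 'b::euclidean_space"
  assumes lin: "linear f" and iso: "\<And>x. norm (f x) = norm x" and dim: "DIM('a) = DIM('b)"
  shows "distr lborel borel f = lborel"
proof -
  have inj: "inj f"
    using iso lin by (metis linear_injective_0 norm_eq_zero)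
  have surj: "surj f"
    using linear_injective_imp_surjective[OF lin inj] dim by simp
  have [measurable]: "f \<in> borel_measurable borel"
    using lin by (rule borel_measurable_linear)
  define \<mu> where "\<mu> = distr lborel borel f"
  have sets_\<mu> [measurable_cong]: "sets \<mu> = sets borel"
    by (simp add: \<mu>_def)
  have \<mu>_nn: "(\<integral>\<^sup>+x. h x \<partial>\<mu>) = (\<integral>\<^sup>+x. h (f x) \<partial>lborel)" if [measurable]: "h \<in> borel_measurable borel" for h
    unfolding \<mu>_def by (subst nn_integral_distr) auto
  have trans: "(\<integral>\<^sup>+x. h (x + y) \<partial>\<mu>) = (\<integral>\<^sup>+x. h x \<partial>\<mu>)" if [measurable]: "h \<in> borel_measurable borel" for h y
  proof -
    obtain z where z: "y = f z" using surj by blast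
    have "(\<integral>\<^sup>+x. h (x + y) \<partial>\<mu>) = (\<integral>\<^sup>+x. h (f (z + x)) \<partial>lborel)"
      by (subst \<mu>_nn) (simp_all add: z linear_add[OF lin] add.commute)
    also have "\<dots> = (\<integral>\<^sup>+x. h (f x) \<partial>distr lborel borel ((+) z))"
      by (subst nn_integral_distr) auto
    finally show ?thesis by (simp add: \<mu>_nn lborel_distr_plus)
  qed
  have trans': "(\<integral>\<^sup>+x. h (y + x) \<partial>lborel) = (\<integral>\<^sup>+x. h x \<partial>lborel)"
    if [measurable]: "h \<in> borel_measurable borel" for h and y :: 'b
  proof -
    have "(\<integral>\<^sup>+x. h (y + x) \<partial>lborel) = (\<integral>\<^sup>+x. h x \<partial>distr lborel borel ((+) y))"
      by (subst nn_integral_distr) auto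
    then show ?thesis by (simp add: lborel_distr_plus)
  qed
  define B where "B = ball (0::'b) 1"
  have [measurable]: "B \<in> sets borel" by (simp add: B_def)
  have B_minus: "- x \<in> B \<longleftrightarrow> x \<in> B" for x by (auto simp: B_def)
  have preim: "f -` B = ball 0 1"
    by (auto simp: B_def iso)
  have \<mu>B: "emeasure \<mu> B = emeasure lborel B"
    unfolding \<mu>_def by (subst emeasure_distr) (auto simp: preim, simp add: B_def emeasure_ball dim)
  have fin: "emeasure lborel B \<noteq> \<infinity>" "emeasure lborel B \<noteq> 0"
    using less_imp_neq[OF unit_ball_vol_pos[of "real DIM('b)"]] by (auto simp: B_def emeasure_ball)
  \<comment> \<open>Needed to exchange integrals over \<open>\<mu>\<close> and
    \<open>lborel\<close>. Balls around 0 have finite \<open>\<mu>\<close>-measure because their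
    preimages are balls.\<close>
  interpret \<mu>: sigma_finite_measure \<mu>
  proof
    let ?A = "range (\<lambda>n::nat. ball (0::'b) (real n))"
    have "emeasure \<mu> (ball 0 r) \<noteq> \<infinity>" for r
    proof -
      have "f -` ball 0 r = ball 0 r" by (auto simp: iso)
      then show ?thesis
        unfolding \<mu>_def by (subst emeasure_distr) (use emeasure_bounded_finite[of "ball (0::'a) r"] in auto)
    qed
    then show "\<exists>A. countable A \<and> A \<subseteq> sets \<mu> \<and> \<Union> A = space \<mu> \<and> (\<forall>a\<in>A. emeasure \<mu> a \<noteq> \<infinity>)"
      by (intro exI[of _ ?A]) (auto simp: \<mu>_def intro: reals_Archimedean2)
  qed
  interpret P: pair_sigma_finite \<mu> "lborel :: 'b measure" ..
  \<comment> \<open>Uniqueness of Haar measure: exchanging the translations of the two measures inside a double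
    integral gives \<open>\<mu>(A) \<lambda>(B) = \<lambda>(A) \<mu>(-B)\<close>; both measures agree on the ball \<open>B = -B\<close>.\<close>
  have eq: "emeasure \<mu> A = emeasure lborel A" if [measurable]: "A \<in> sets borel" for A
  proof -
    have "emeasure \<mu> A * emeasure lborel B
      = (\<integral>\<^sup>+y. indicator B y * (\<integral>\<^sup>+x. indicator A x \<partial>\<mu>) \<partial>lborel)"
      by (subst nn_integral_multc) (auto simp: mult.commute)
    also have "\<dots> = (\<integral>\<^sup>+y. indicator B y * (\<integral>\<^sup>+x. indicator A (x + y) \<partial>\<mu>) \<partial>lborel)"
      by (subst trans) auto
    also have "\<dots> = (\<integral>\<^sup>+y. (\<integral>\<^sup>+x. indicator B y * indicator A (x + y) \<partial>\<mu>) \<partial>lborel)"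
      by (subst nn_integral_cmult) auto
    also have "\<dots> = (\<integral>\<^sup>+x. (\<integral>\<^sup>+y. indicator B y * indicator A (x + y) \<partial>lborel) \<partial>\<mu>)"
      by (subst P.Fubini') (auto simp: split_beta')
    also have "\<dots> = (\<integral>\<^sup>+x. (\<integral>\<^sup>+y. indicator B (y - x) * indicator A y \<partial>lborel) \<partial>\<mu>)"
    proof (rule nn_integral_cong)
      fix x
      show "(\<integral>\<^sup>+y. indicator B y * indicator A (x + y) \<partial>lborel)
          = (\<integral>\<^sup>+y. indicator B (y - x) * (indicator A y::ennreal) \<partial>lborel)"
        using trans'[of "\<lambda>y. indicator B (y - x) * (indicator A y::ennreal)" x] by simp
    qed
    also have "\<dots> = (\<integral>\<^sup>+y. (\<integral>\<^sup>+x. indicator B (y - x) * indicator A y \<partial>\<mu>) \<partial>lborel)"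
      by (subst P.Fubini') (auto simp: split_beta')
    also have "\<dots> = (\<integral>\<^sup>+y. (\<integral>\<^sup>+x. indicator B x * indicator A y \<partial>\<mu>) \<partial>lborel)"
    proof (rule nn_integral_cong)
      fix y
      have "indicator B (y - x) = (indicator B (x + - y) :: ennreal)" for x
        using B_minus[of "y - x"] by (simp add: indicator_def)
      then show "(\<integral>\<^sup>+x. indicator B (y - x) * indicator A y \<partial>\<mu>)
          = (\<integral>\<^sup>+x. indicator B x * (indicator A y::ennreal) \<partial>\<mu>)"
        using trans[of "\<lambda>x. indicator B x * (indicator A y::ennreal)" "-y"] by simp
    qed
    also have "\<dots> = emeasure \<mu> B * emeasure lborel A"
      by (simp add: nn_integral_multc nn_integral_cmult)
    finally show ?thesis
      using fin unfolding \<mu>B by (auto simp: mult.commute[of _ "emeasure lborel B"] ennreal_mult_cancel_left)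
  qed
  show ?thesis
    by (rule measure_eqI) (use eq in \<open>auto simp: \<mu>_def\<close>)
qed

lemma nn_integral_isometry:
  fixes f :: "'a::euclidean_space \<Rightarrow> 'b::euclidean_space"
  assumes "linear f" "\<And>x. norm (f x) = norm x" "DIM('a) = DIM('b)"
    and [measurable]: "h \<in> borel_measurable borel"
  shows "(\<integral>\<^sup>+x. h (f x) \<partial>lborel) = (\<integral>\<^sup>+x. h x \<partial>lborel)"
proof -
  have [measurable]: "f \<in> borel_measurable borel"
    using assms(1) by (rule borel_measurable_linear)
  show ?thesis
    by (subst lborel_distr_isometry[OF assms(1-3), symmetric], subst nn_integral_distr) auto
qed

section \<open>Gaussian, Gamma and Student-type integrals; second moment of a ball\<close>

lemma nn_integral_gaussian:
  assumes "a > 0"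
  shows "(\<integral>\<^sup>+(x::'a::euclidean_space). ennreal (exp (- a * (norm x)\<^sup>2)) \<partial>lborel)
    = ennreal ((pi / a) powr (real DIM('a) / 2))"
proof -
  have one: "(\<integral>\<^sup>+x. ennreal (exp (- a * x\<^sup>2)) \<partial>lborel) = ennreal (sqrt (pi / a))"
  proof -
    \<comment> \<open>The standard deviation for which the normal density has exponent
      \<open>- a * x\<^sup>2\<close>.\<close>
    define s where "s = sqrt (1 / (2 * a))"
    have s: "s > 0" "s\<^sup>2 = 1 / (2 * a)" using assms by (auto simp: s_def)
    have e: "exp (- a * x\<^sup>2) = sqrt (pi / a) * normal_density 0 s x" for x
    proof -
      have "2 * pi * s\<^sup>2 = pi / a" "x\<^sup>2 / (2 * s\<^sup>2) = a * x\<^sup>2"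
        using assms by (auto simp: s(2))
      then show ?thesis using assms by (simp add: normal_density_def)
    qed
    show ?thesis
      unfolding e using assms prob_space.emeasure_space_1[OF prob_space_normal_density[OF s(1), of 0]]
      by (simp add: ennreal_mult nn_integral_cmult emeasure_density)
  qed
  have "(\<integral>\<^sup>+(x::'a). ennreal (exp (- a * (norm x)\<^sup>2)) \<partial>lborel)
      = (\<integral>\<^sup>+(x::'a). (\<Prod>b\<in>Basis. ennreal (exp (- a * (x \<bullet> b)\<^sup>2))) \<partial>lborel)"
  proof (intro nn_integral_cong)
    fix x :: 'a
    have "(norm x)\<^sup>2 = (\<Sum>b\<in>Basis. (x \<bullet> b)\<^sup>2)"
      unfolding power2_norm_eq_inner by (subst euclidean_inner) (simp add: power2_eq_square)
    then show "ennreal (exp (- a * (norm x)\<^sup>2)) = (\<Prod>b\<in>Basis. ennreal (exp (- a * (x \<bullet> b)\<^sup>2)))"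
      by (simp add: prod_ennreal exp_sum[symmetric] sum_distrib_left)
  qed
  also have "\<dots> = ennreal (sqrt (pi / a)) ^ DIM('a)"
    by (subst nn_integral_lborel_prod) (simp_all add: one[simplified])
  also have "\<dots> = ennreal ((pi / a) powr (real DIM('a) / 2))"
    using assms by (simp add: ennreal_power powr_half_sqrt[symmetric] powr_realpow[symmetric] powr_powr)
  finally show ?thesis .
qed

lemma nn_integral_mvn_pdf:
  assumes "\<sigma> > 0"
  shows "(\<integral>\<^sup>+(x::'a::euclidean_space). ennreal (mvn_pdf \<sigma> x) \<partial>lborel) = 1"
proof -
  define N where "N = (2 * pi * \<sigma>\<^sup>2) powr (real DIM('a) / 2)"
  have N: "N > 0" using assms by (auto simp: N_def)
  have "(\<integral>\<^sup>+(x::'a). ennreal (mvn_pdf \<sigma> x) \<partial>lborel)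
    = (\<integral>\<^sup>+(x::'a). ennreal (1 / N) * ennreal (exp (- (1 / (2 * \<sigma>\<^sup>2)) * (norm x)\<^sup>2)) \<partial>lborel)"
    using N by (intro nn_integral_cong) (simp add: mvn_pdf_def N_def ennreal_mult'[symmetric])
  also have "\<dots> = ennreal (1 / N) * ennreal N"
    by (subst nn_integral_cmult, simp, subst nn_integral_gaussian)
      (use assms in \<open>auto simp: N_def field_simps\<close>)
  also have "\<dots> = 1"
    using N by (simp add: ennreal_mult'[symmetric])
  finally show ?thesis .
qed

lemma nn_integral_scaleR:
  fixes f :: "'a::euclidean_space \<Rightarrow> ennreal"
  assumes [measurable]: "f \<in> borel_measurable borel" and "s > 0"
  shows "(\<integral>\<^sup>+x. f x \<partial>lborel) = ennreal (s ^ DIM('a)) * (\<integral>\<^sup>+x. f (s *\<^sub>R x) \<partial>lborel)"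
  by (subst lborel_affine[of s 0])
    (use assms in \<open>auto simp: nn_integral_density nn_integral_distr nn_integral_cmult\<close>)

text \<open>Euler's integral under \<open>t = c * l\<close>. Read backwards, it writes a negative
  power of \<open>c\<close> as a superposition of exponentials in \<open>c\<close>.\<close>

lemma nn_integral_Gamma_scaled:
  assumes "q > 0" "c > 0"
  shows "(\<integral>\<^sup>+l. ennreal (indicator {0..} l * l powr (q - 1) * exp (- (c * l))) \<partial>lborel)
    = ennreal (Gamma q / c powr q)"
proof -
  have "ennreal (Gamma q) = (\<integral>\<^sup>+t. ennreal (indicator {0..} t * t powr (q - 1) / exp t) \<partial>lborel)"
    using Gamma_conv_nn_integral_real[OF assms(1)] .
  also have "\<dots> = ennreal c * (\<integral>\<^sup>+t. ennreal (indicator {0..} (c * t) * (c * t) powr (q - 1) / exp (c * t)) \<partial>lborel)"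
    using assms by (subst nn_integral_real_affine[where c = c and t = 0]) auto
  also have "\<dots> = ennreal c * (\<integral>\<^sup>+t. ennreal (c powr (q - 1)) * ennreal (indicator {0..} t * t powr (q - 1) * exp (- (c * t))) \<partial>lborel)"
    using assms
    by (intro arg_cong2[where f = "(*)"] refl nn_integral_cong)
      (auto simp: ennreal_mult'[symmetric] powr_mult indicator_def zero_le_mult_iff exp_minus field_simps)
  also have "\<dots> = ennreal (c powr q) * (\<integral>\<^sup>+t. ennreal (indicator {0..} t * t powr (q - 1) * exp (- (c * t))) \<partial>lborel)"
    using assms by (subst nn_integral_cmult) (auto simp: mult.assoc[symmetric] ennreal_mult'[symmetric] powr_mult_base)
  finally have eq: "ennreal (Gamma q) = ennreal (c powr q) *
    (\<integral>\<^sup>+t. ennreal (indicator {0..} t * t powr (q - 1) * exp (- (c * t))) \<partial>lborel)" (is "_ = _ * ?I") .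
  have "ennreal (1 / c powr q) * ennreal (Gamma q) = (ennreal (1 / c powr q) * ennreal (c powr q)) * ?I"
    unfolding eq by (simp add: mult.assoc)
  also have "ennreal (1 / c powr q) * ennreal (c powr q) = 1"
    using assms by (simp add: ennreal_mult'[symmetric])
  finally show ?thesis
    using assms by (simp add: ennreal_mult'[symmetric])
qed

text \<open>The integrand is a Gamma mixture of Gaussians.\<close>
lemma nn_integral_student:
  assumes q: "q > real DIM('a) / 2" and c: "c > 0"
  shows "(\<integral>\<^sup>+(t::'a::euclidean_space). ennreal ((1 + c * (norm t)\<^sup>2) powr (- q)) \<partial>lborel)
    = ennreal ((pi / c) powr (real DIM('a) / 2) * Gamma (q - real DIM('a) / 2) / Gamma q)"
proof -
  let ?k = "real DIM('a) / 2"
  have q0: "q > 0" using q by (smt (verit) divide_nonneg_nonneg of_nat_0_le_iff)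
  then have Gq: "Gamma q > 0" by (rule Gamma_real_pos)
  have "(\<integral>\<^sup>+(t::'a). ennreal (Gamma q) * ennreal ((1 + c * (norm t)\<^sup>2) powr (- q)) \<partial>lborel)
     = (\<integral>\<^sup>+(t::'a). (\<integral>\<^sup>+l. ennreal (indicator {0..} l * l powr (q - 1) * exp (- ((1 + c * (norm t)\<^sup>2) * l))) \<partial>lborel) \<partial>lborel)"
  proof (intro nn_integral_cong)
    fix t :: 'a
    have p: "1 + c * (norm t)\<^sup>2 > 0" using c by (simp add: add_pos_nonneg)
    show "ennreal (Gamma q) * ennreal ((1 + c * (norm t)\<^sup>2) powr (- q))
      = (\<integral>\<^sup>+l. ennreal (indicator {0..} l * l powr (q - 1) * exp (- ((1 + c * (norm t)\<^sup>2) * l))) \<partial>lborel)"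
      by (subst nn_integral_Gamma_scaled[OF q0 p])
        (use Gq in \<open>simp add: ennreal_mult'[symmetric] powr_minus field_simps\<close>)
  qed
  also have "\<dots> = (\<integral>\<^sup>+l. (\<integral>\<^sup>+(t::'a). ennreal (indicator {0..} l * l powr (q - 1) * exp (- ((1 + c * (norm t)\<^sup>2) * l))) \<partial>lborel) \<partial>lborel)"
    by (rule lborel_pair.Fubini') measurable
  \<comment> \<open>For \<open>l > 0\<close> the inner integral is Gaussian with parameter
    \<open>c * l\<close>. It contributes \<open>l powr (- ?k)\<close>, which lowers the Gamma
    exponent from \<open>q\<close> to \<open>q - ?k\<close>; the hypothesis on \<open>q\<close>
    keeps this positive.\<close>
  also have "\<dots> = (\<integral>\<^sup>+l. ennreal ((pi / c) powr ?k) * ennreal (indicator {0..} l * l powr (q - ?k - 1) * exp (- (1 * l))) \<partial>lborel)"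
  proof (rule nn_integral_cong_AE, rule AE_mp[OF AE_lborel_singleton[of 0]], rule AE_I2, intro impI)
    fix l :: real assume "l \<noteq> 0"
    consider "l < 0" | "l > 0" using \<open>l \<noteq> 0\<close> by linarith
    then show "(\<integral>\<^sup>+(t::'a). ennreal (indicator {0..} l * l powr (q - 1) * exp (- ((1 + c * (norm t)\<^sup>2) * l))) \<partial>lborel)
      = ennreal ((pi / c) powr ?k) * ennreal (indicator {0..} l * l powr (q - ?k - 1) * exp (- (1 * l)))"
    proof cases
      case 2
      have "(\<integral>\<^sup>+(t::'a). ennreal (indicator {0..} l * l powr (q - 1) * exp (- ((1 + c * (norm t)\<^sup>2) * l))) \<partial>lborel)
        = (\<integral>\<^sup>+(t::'a). ennreal (l powr (q - 1) * exp (- l)) * ennreal (exp (- (c * l) * (norm t)\<^sup>2)) \<partial>lborel)"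
        using 2 by (intro nn_integral_cong) (auto simp: ennreal_mult'[symmetric] mult.assoc exp_add[symmetric] algebra_simps)
      also have "\<dots> = ennreal (l powr (q - 1) * exp (- l)) * ennreal ((pi / (c * l)) powr ?k)"
        by (subst nn_integral_cmult, simp, subst nn_integral_gaussian) (use 2 c in auto)
      also have "(pi / (c * l)) powr ?k = (pi / c) powr ?k * l powr (- ?k)"
        using 2 c by (simp add: powr_divide powr_mult powr_minus field_simps)
      also have "ennreal (l powr (q - 1) * exp (- l)) * ennreal ((pi / c) powr ?k * l powr (- ?k))
        = ennreal ((pi / c) powr ?k) * ennreal (indicator {0..} l * l powr (q - ?k - 1) * exp (- (1 * l)))"
      proof -
        have "l powr (q - 1) * l powr (- ?k) = l powr (q - ?k - 1)"
          by (simp add: powr_add[symmetric] algebra_simps)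
        then show ?thesis using 2 by (simp add: ennreal_mult'[symmetric] mult_ac)
      qed
      finally show ?thesis .
    qed auto
  qed
  also have "\<dots> = ennreal ((pi / c) powr ?k) * ennreal (Gamma (q - ?k))"
    by (subst nn_integral_cmult, simp, subst nn_integral_Gamma_scaled) (use q in auto)
  finally have eq: "ennreal (Gamma q) * (\<integral>\<^sup>+(t::'a). ennreal ((1 + c * (norm t)\<^sup>2) powr (- q)) \<partial>lborel)
     = ennreal ((pi / c) powr ?k * Gamma (q - ?k))" (is "_ * ?I = _")
    using q by (subst (asm) nn_integral_cmult) (auto simp: ennreal_mult'[symmetric])
  have "ennreal (1 / Gamma q) * ennreal (Gamma q) * ?I = ennreal (1 / Gamma q) * ennreal ((pi / c) powr ?k * Gamma (q - ?k))"
    unfolding mult.assoc eq ..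
  then show ?thesis
    using Gq q by (simp add: ennreal_mult'[symmetric])
qed

text \<open>This integrand is taken rather than \<open>(norm t)\<^sup>2\<close> because its
  superlevel sets are balls, whose volumes are known; the second moment follows by subtraction from
  a constant.\<close>

lemma nn_integral_ball_norm_sq:
  assumes "r \<ge> 0"
  shows "(\<integral>\<^sup>+(t::'a::euclidean_space). ennreal (indicator (ball 0 r) t * (r\<^sup>2 - (norm t)\<^sup>2)) \<partial>lborel)
    = ennreal (2 * unit_ball_vol (real DIM('a)) * r ^ (DIM('a) + 2) / (real DIM('a) + 2))"
proof -
  let ?V = "unit_ball_vol (real DIM('a))"
  \<comment> \<open>layer cake: \<open>r\<^sup>2 - \<bar>t\<bar>\<^sup>2\<close> is the integral of \<open>2 s\<close> over those \<open>s \<le> r\<close> whose ball contains \<open>t\<close>\<close>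
  have der: "((\<lambda>s. 2 * ?V * s ^ (DIM('a) + 2) / (real DIM('a) + 2)) has_real_derivative
      2 * ?V * s ^ (DIM('a) + 1)) (at s)" for s
  proof -
    have "((\<lambda>s. (2 * ?V / (real DIM('a) + 2)) * s ^ (DIM('a) + 2)) has_real_derivative
      (2 * ?V / (real DIM('a) + 2)) * (real (DIM('a) + 2) * s ^ (DIM('a) + 2 - Suc 0))) (at s)"
      by (rule DERIV_cmult, rule DERIV_pow)
    moreover have "(2 * ?V / (real DIM('a) + 2)) * (real (DIM('a) + 2) * s ^ (DIM('a) + 2 - Suc 0))
      = 2 * ?V * s ^ (DIM('a) + 1)"
    proof -
      have "x / (d + 2) * ((d + 2) * y) = x * y" if "d \<ge> 0" for x y d :: real
        using that by simp
      note * = this[of "real DIM('a)" "2 * ?V" "s ^ (DIM('a) + 1)", OF of_nat_0_le_iff]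
      have "real (DIM('a) + 2) = real DIM('a) + 2" "DIM('a) + 2 - Suc 0 = DIM('a) + 1"
        by simp_all
      then show ?thesis using * by (simp only:)
    qed
    ultimately show ?thesis by simp
  qed
  have "(\<integral>\<^sup>+(t::'a). ennreal (indicator (ball 0 r) t * (r\<^sup>2 - (norm t)\<^sup>2)) \<partial>lborel)
     = (\<integral>\<^sup>+(t::'a). (\<integral>\<^sup>+s. ennreal (2 * s) * indicator {0..r} s * indicator (ball 0 s) t \<partial>lborel) \<partial>lborel)"
  proof (intro nn_integral_cong)
    fix t :: 'a
    \<comment> \<open>The ball is open, so \<open>s = norm t\<close> is missing on the left; one
      point does not matter.\<close>
    have "(\<integral>\<^sup>+s. ennreal (2 * s) * indicator {0..r} s * indicator (ball 0 s) t \<partial>lborel)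
      = (\<integral>\<^sup>+s. ennreal (2 * s) * indicator {norm t..r} s \<partial>lborel)"
      by (rule nn_integral_cong_AE, rule AE_mp[OF AE_lborel_singleton[of "norm t"]], rule AE_I2)
        (auto simp: indicator_def intro: order_trans[OF norm_ge_zero])
    also have "\<dots> = ennreal (indicator (ball 0 r) t * (r\<^sup>2 - (norm t)\<^sup>2))"
    proof (cases "norm t < r")
      case True
      have "(\<integral>\<^sup>+s. ennreal (2 * s) * indicator {norm t..r} s \<partial>lborel) = ennreal (r\<^sup>2 - (norm t)\<^sup>2)"
        by (rule nn_integral_FTC_Icc)
          (use True in \<open>auto intro!: derivative_eq_intros intro: order_trans[OF norm_ge_zero]\<close>)
      then show ?thesis using True by simp
    next
      case False
      have "(\<integral>\<^sup>+s. ennreal (2 * s) * indicator {norm t..r} s \<partial>lborel) = (\<integral>\<^sup>+(s::real). 0 \<partial>lborel)"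
        by (rule nn_integral_cong_AE, rule AE_mp[OF AE_lborel_singleton[of r]], rule AE_I2)
          (use False in \<open>auto simp: indicator_def\<close>)
      then show ?thesis using False by simp
    qed
    finally show "ennreal (indicator (ball 0 r) t * (r\<^sup>2 - (norm t)\<^sup>2))
      = (\<integral>\<^sup>+s. ennreal (2 * s) * indicator {0..r} s * indicator (ball 0 s) t \<partial>lborel)" ..
  qed
  also have "\<dots> = (\<integral>\<^sup>+s. (\<integral>\<^sup>+(t::'a). ennreal (2 * s) * indicator {0..r} s * indicator (ball 0 s) t \<partial>lborel) \<partial>lborel)"
  proof (rule lborel_pair.Fubini')
    have "(\<lambda>(s, t). ennreal (2 * s) * indicator {0..r} s * indicator (ball (0::'a) s) t)
        = (\<lambda>p. ennreal (2 * fst p) * indicator {0..r} (fst p) * (if norm (snd p) < fst p then 1 else 0))"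
      by (auto simp: fun_eq_iff indicator_def)
    moreover have "\<dots> \<in> borel_measurable (lborel \<Otimes>\<^sub>M lborel)"
      by measurable
    ultimately show "(\<lambda>(s, t). ennreal (2 * s) * indicator {0..r} s * indicator (ball (0::'a) s) t)
        \<in> borel_measurable (lborel \<Otimes>\<^sub>M lborel)"
      by metis
  qed
  also have "\<dots> = (\<integral>\<^sup>+s. ennreal (2 * ?V * s ^ (DIM('a) + 1)) * indicator {0..r} s \<partial>lborel)"
    by (intro nn_integral_cong, subst nn_integral_cmult)
      (auto intro: borel_measurable_indicator simp: emeasure_ball indicator_def[of "{0..r}"] ennreal_mult'[symmetric] mult_ac)
  also have "\<dots> = ennreal (2 * ?V * r ^ (DIM('a) + 2) / (real DIM('a) + 2) - 2 * ?V * 0 ^ (DIM('a) + 2) / (real DIM('a) + 2))"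
    by (rule nn_integral_FTC_Icc, simp, rule der)
      (use assms unit_ball_vol_nonneg[of "real DIM('a)"] in auto)
  finally show ?thesis by simp
qed

section \<open>Integrals over small balls\<close>

lemma integral_isometry:
  fixes f :: "'a::euclidean_space \<Rightarrow> 'b::euclidean_space" and h :: "'b \<Rightarrow> real"
  assumes "linear f" "\<And>x. norm (f x) = norm x" "DIM('a) = DIM('b)"
    and [measurable]: "h \<in> borel_measurable borel"
  shows "(LINT x|lborel. h (f x)) = (LINT x|lborel. h x)"
proof -
  have [measurable]: "f \<in> borel_measurable borel"
    using assms(1) by (rule borel_measurable_linear)
  show ?thesis
    by (subst lborel_distr_isometry[OF assms(1-3), symmetric], subst integral_distr) auto
qed

lemma set_integrable_ball:
  fixes f :: "'a::euclidean_space \<Rightarrow> real"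
  assumes "continuous_on (cball 0 r) f"
  shows "set_integrable lborel (ball 0 r) f"
proof -
  have "set_integrable lborel (cball 0 r) f"
    using borel_integrable_compact[OF compact_cball assms] by (simp add: set_integrable_def)
  then show ?thesis by (rule set_integrable_subset) auto
qed

lemma set_integral_sum:
  fixes f :: "'i \<Rightarrow> 'a \<Rightarrow> real"
  assumes "\<And>i. i \<in> I \<Longrightarrow> set_integrable M A (f i)"
  shows "(LINT x:A|M. (\<Sum>i\<in>I. f i x)) = (\<Sum>i\<in>I. LINT x:A|M. f i x)"
    and "set_integrable M A (\<lambda>x. \<Sum>i\<in>I. f i x)"
  using assms unfolding set_lebesgue_integral_def set_integrable_def
  by (simp_all add: sum_distrib_left Bochner_Integration.integral_sum Bochner_Integration.integrable_sum)

lemma ball_integral_norm_sq: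
  assumes "r \<ge> 0"
  shows "(LINT t:ball (0::'a::euclidean_space) r|lborel. (norm t)\<^sup>2)
    = unit_ball_vol (real DIM('a)) * r ^ (DIM('a) + 2) * real DIM('a) / (real DIM('a) + 2)"
proof -
  let ?V = "unit_ball_vol (real DIM('a))"
  have i1: "set_integrable lborel (ball (0::'a) r) (\<lambda>t. r\<^sup>2)"
    and i2: "set_integrable lborel (ball (0::'a) r) (\<lambda>t. (norm t)\<^sup>2)"
    by (auto intro!: set_integrable_ball continuous_intros)
  have "(LINT t:ball (0::'a) r|lborel. r\<^sup>2 - (norm t)\<^sup>2) = 2 * ?V * r ^ (DIM('a) + 2) / (real DIM('a) + 2)"
    unfolding set_lebesgue_integral_def
    by (subst integral_eq_nn_integral)
      (use assms nn_integral_ball_norm_sq[OF assms, where 'a = 'a] in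
        \<open>auto simp: indicator_def intro!: AE_I2 power_mono\<close>)
  moreover have "(LINT t:ball (0::'a) r|lborel. r\<^sup>2) = r\<^sup>2 * (?V * r ^ DIM('a))"
    by (subst set_integral_const) (use emeasure_bounded_finite[of "ball (0::'a) r"] in \<open>auto simp: content_ball assms\<close>)
  ultimately have "(LINT t:ball (0::'a) r|lborel. (norm t)\<^sup>2)
      = r\<^sup>2 * (?V * r ^ DIM('a)) - 2 * ?V * r ^ (DIM('a) + 2) / (real DIM('a) + 2)"
    using set_integral_diff(2)[OF i1 i2] by linarith
  also have "\<dots> = ?V * r ^ (DIM('a) + 2) * real DIM('a) / (real DIM('a) + 2)"
    by (simp add: field_simps power2_eq_square)
  finally show ?thesis .
qed

text \<open>Mixed second moments vanish under the reflection of one coordinate, and pure ones agree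
  under transposition of two coordinates; their sum is the integral of
  \<open>(norm t)\<^sup>2\<close>. Hence only the trace of \<open>M\<close> matters.\<close>

lemma ball_integral_quadratic_form:
  fixes M :: "real^'k^'k"
  assumes "r \<ge> 0"
  shows "(LINT t:ball 0 r|lborel. t \<bullet> (M *v t))
    = unit_ball_vol (real CARD('k)) * r ^ (CARD('k) + 2) / (real CARD('k) + 2) * trace M"
proof -
  define I where "I i j = (LINT t:ball (0::real^'k) r|lborel. t $ i * t $ j)" for i j
  have int: "set_integrable lborel (ball (0::real^'k) r) (\<lambda>t. t $ i * t $ j)" for i j
    by (intro set_integrable_ball continuous_intros)
  have inv: "(LINT t:ball (0::real^'k) r|lborel. h (f t)) = (LINT t:ball (0::real^'k) r|lborel. h t)"
    if f: "linear f" "\<And>x. norm (f x) = norm x" and h: "h \<in> borel_measurable borel"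
    for f :: "real^'k \<Rightarrow> real^'k" and h :: "real^'k \<Rightarrow> real"
  proof -
    have "indicator (ball 0 r) (f t) = (indicator (ball 0 r) t :: real)" for t
      by (simp add: indicator_def f)
    moreover have "(\<lambda>t. indicator (ball 0 r) t * h t) \<in> borel_measurable borel"
      by (intro borel_measurable_times borel_measurable_indicator h) simp
    ultimately show ?thesis
      using integral_isometry[OF f, of "\<lambda>t. indicator (ball 0 r) t * h t"]
      by (simp add: set_lebesgue_integral_def)
  qed
  have offdiag: "I i j = 0" if "i \<noteq> j" for i j
  proof -
    let ?f = "\<lambda>t::real^'k. \<chi> l. if l = i then - t $ l else t $ l"
    have "norm (?f x) = norm x" for x
      by (auto simp: norm_vec_def L2_set_def intro!: arg_cong[where f = sqrt] sum.cong)
    moreover have "linear ?f"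
      by (rule linearI) (auto simp: vec_eq_iff algebra_simps)
    ultimately have "(LINT t:ball (0::real^'k) r|lborel. (?f t) $ i * (?f t) $ j) = I i j"
      unfolding I_def by (intro inv[where h = "\<lambda>t. t $ i * t $ j"]) auto
    then have "(LINT t:ball (0::real^'k) r|lborel. - (t $ i * t $ j)) = I i j"
      using that by simp
    then show ?thesis by (simp add: I_def set_lebesgue_integral_def)
  qed
  have diag: "I i i = I j j" for i j
  proof -
    let ?f = "\<lambda>t::real^'k. \<chi> l. t $ (Transposition.transpose i j l)"
    have "norm (?f x) = norm x" for x
      unfolding norm_vec_def L2_set_def
      by (rule arg_cong[where f = sqrt], rule sum.reindex_bij_witness[of _ "Transposition.transpose i j" "Transposition.transpose i j"]) auto
    moreover have "linear ?f"
      by (rule linearI) (auto simp: vec_eq_iff)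
    ultimately have "(LINT t:ball (0::real^'k) r|lborel. (?f t) $ i * (?f t) $ i) = I i i"
      unfolding I_def by (intro inv[where h = "\<lambda>t. t $ i * t $ i"]) auto
    then show ?thesis by (simp add: I_def)
  qed
  have all: "real CARD('k) * I i i = unit_ball_vol (real CARD('k)) * r ^ (CARD('k) + 2) * real CARD('k) / (real CARD('k) + 2)" for i
  proof -
    have "real CARD('k) * I i i = (\<Sum>j\<in>UNIV. I j j)"
      by (subst sum.cong[OF refl diag[of _ i]]) auto
    also have "\<dots> = (LINT t:ball (0::real^'k) r|lborel. (\<Sum>j\<in>UNIV. t $ j * t $ j))"
      unfolding I_def by (subst set_integral_sum(1)) (auto intro: int)
    also have "\<dots> = (LINT t:ball (0::real^'k) r|lborel. (norm t)\<^sup>2)"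
      by (simp add: power2_norm_eq_inner inner_vec_def)
    also have "\<dots> = unit_ball_vol (real CARD('k)) * r ^ (CARD('k) + 2) * real CARD('k) / (real CARD('k) + 2)"
      using ball_integral_norm_sq[OF assms, where 'a = "real^'k"] by simp
    finally show ?thesis .
  qed
  then have Iii: "I i i = unit_ball_vol (real CARD('k)) * r ^ (CARD('k) + 2) / (real CARD('k) + 2)" for i
  proof -
    have "real CARD('k) * I i i = real CARD('k) * (unit_ball_vol (real CARD('k)) * r ^ (CARD('k) + 2) / (real CARD('k) + 2))"
      using all[of i] by simp
    then show ?thesis by (simp only: mult_cancel_left) simp
  qed
  have Iij: "I i j = (if i = j then unit_ball_vol (real CARD('k)) * r ^ (CARD('k) + 2) / (real CARD('k) + 2) else 0)" for i j
    using Iii offdiag by auto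
  have "(LINT t:ball 0 r|lborel. t \<bullet> (M *v t))
     = (LINT t:ball 0 r|lborel. (\<Sum>i\<in>UNIV. \<Sum>j\<in>UNIV. M $ i $ j * (t $ i * t $ j)))"
    by (simp add: inner_vec_def matrix_vector_mult_def sum_distrib_left mult_ac)
  also have "\<dots> = (\<Sum>i\<in>UNIV. \<Sum>j\<in>UNIV. M $ i $ j * I i j)"
    unfolding I_def
    by (subst set_integral_sum(1), intro set_integral_sum(2) set_integrable_mult_right int,
        subst set_integral_sum(1), intro set_integrable_mult_right int, simp)
  also have "\<dots> = unit_ball_vol (real CARD('k)) * r ^ (CARD('k) + 2) / (real CARD('k) + 2) * trace M"
    by (simp add: Iij if_distrib sum.delta trace_def sum_distrib_left cong: if_cong) (simp add: mult_ac)
  finally show ?thesis .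
qed

text \<open>The integrand is odd and the ball symmetric.\<close>

lemma ball_integral_linear:
  fixes a :: "'a::euclidean_space"
  shows "(LINT t:ball 0 r|lborel. a \<bullet> t) = 0"
proof -
  have "(LINT t|lborel. indicator (ball 0 r) (- t) * (a \<bullet> - t)) = (LINT t:ball 0 r|lborel. a \<bullet> t)"
    unfolding set_lebesgue_integral_def
    by (subst integral_isometry[of uminus "\<lambda>t. indicator (ball 0 r) t * (a \<bullet> t)"])
      (auto simp: linear_uminus intro!: borel_measurable_times borel_measurable_indicator)
  moreover have "indicator (ball 0 r) (- t) = (indicator (ball 0 r) t :: real)" for t :: 'a
    by (simp add: indicator_def)
  ultimately show ?thesis by (simp add: set_lebesgue_integral_def)
qed

text \<open>The expansion has no constant term, its linear term integrates to 0, and its remainder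
  is at most \<open>\<epsilon>\<close> times the second moment of the ball, which is of order
  \<open>r ^ (CARD('k) + 2)\<close>.\<close>

lemma ball_integral_asymp:
  fixes f :: "real^'k \<Rightarrow> real" and M :: "real^'k^'k"
  assumes \<delta>: "\<delta> > 0" and cont: "continuous_on (cball 0 \<delta>) f"
    and exp: "\<And>\<epsilon>. \<epsilon> > 0 \<Longrightarrow> eventually (\<lambda>t. \<bar>f t - a \<bullet> t - t \<bullet> (M *v t)\<bar> \<le> \<epsilon> * (norm t)\<^sup>2) (nhds 0)"
  shows "((\<lambda>r. (LINT t:ball 0 r|lborel. f t) / r ^ (CARD('k) + 2)) \<longlongrightarrow>
    unit_ball_vol (real CARD('k)) / (real CARD('k) + 2) * trace M) (at_right 0)"
proof (rule tendstoI)
  fix e :: real assume e: "e > 0"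
  let ?k = "CARD('k)"
  let ?V = "unit_ball_vol (real ?k)"
  have V: "?V > 0" by simp
  \<comment> \<open>The remainder then contributes at most \<open>e / 2\<close>, which leaves room
    for the strict inequality.\<close>
  define \<epsilon> where "\<epsilon> = e / (2 * ?V)"
  have \<epsilon>: "\<epsilon> > 0" using e V by (simp add: \<epsilon>_def)
  obtain d where d: "d > 0" "\<And>t. norm t < d \<Longrightarrow> \<bar>f t - a \<bullet> t - t \<bullet> (M *v t)\<bar> \<le> \<epsilon> * (norm t)\<^sup>2"
    using exp[OF \<epsilon>] by (auto simp: eventually_nhds_metric dist_norm)
  have "dist ((LINT t:ball 0 r|lborel. f t) / r ^ (?k + 2)) (?V / (real ?k + 2) * trace M) < e"
    if r: "0 < r" "r < min d \<delta>" for r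
  proof -
    have i1: "set_integrable lborel (ball 0 r) f"
      using r by (intro set_integrable_ball continuous_on_subset[OF cont]) auto
    have i2: "set_integrable lborel (ball 0 r) (\<lambda>t. a \<bullet> t)"
      by (intro set_integrable_ball continuous_intros)
    have i3: "set_integrable lborel (ball 0 r) (\<lambda>t. t \<bullet> (M *v t))"
      by (intro set_integrable_ball continuous_intros matrix_vector_mult_linear_continuous_on)
    have i4: "set_integrable lborel (ball (0::real^'k) r) (\<lambda>t. \<epsilon> * (norm t)\<^sup>2)"
      by (intro set_integrable_ball continuous_intros)
    note i12 = set_integral_diff[OF i1 i2]
    note i123 = set_integral_diff[OF i12(1) i3]
    have "\<bar>(LINT t:ball 0 r|lborel. f t) - (LINT t:ball 0 r|lborel. t \<bullet> (M *v t))\<bar>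
       = \<bar>LINT t:ball 0 r|lborel. f t - a \<bullet> t - t \<bullet> (M *v t)\<bar>"
      using i123(2) i12(2) ball_integral_linear[of r a] by simp
    also have "\<dots> \<le> (LINT t:ball (0::real^'k) r|lborel. \<bar>f t - a \<bullet> t - t \<bullet> (M *v t)\<bar>)"
      using set_integral_norm_bound[OF i123(1)] by simp
    also have "\<dots> \<le> (LINT t:ball (0::real^'k) r|lborel. \<epsilon> * (norm t)\<^sup>2)"
      using r by (intro set_integral_mono set_integrable_abs i123(1) i4 d(2)) auto
    also have "\<dots> = \<epsilon> * (?V * r ^ (?k + 2) * (real ?k / (real ?k + 2)))"
      using ball_integral_norm_sq[of r, where 'a = "real^'k"] r by simp
    also have "\<dots> \<le> \<epsilon> * (?V * r ^ (?k + 2) * 1)"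
      using \<epsilon> V r by (intro mult_left_mono) auto
    also have "\<dots> < e * r ^ (?k + 2)"
      using e r V by (simp add: \<epsilon>_def)
    finally have "\<bar>(LINT t:ball 0 r|lborel. f t) - (LINT t:ball 0 r|lborel. t \<bullet> (M *v t))\<bar> / r ^ (?k + 2) < e"
      using r by (simp add: divide_less_eq)
    moreover have "(LINT t:ball 0 r|lborel. t \<bullet> (M *v t)) / r ^ (?k + 2) = ?V / (real ?k + 2) * trace M"
      using ball_integral_quadratic_form[of r M] r by simp
    moreover have "\<bar>x - y\<bar> / r ^ (?k + 2) = \<bar>x / r ^ (?k + 2) - y / r ^ (?k + 2)\<bar>" for x y :: real
      using r by (simp add: diff_divide_distrib[symmetric])
    ultimately show ?thesis
      by (simp add: dist_real_def)
  qed
  then show "\<forall>\<^sub>F r in at_right 0. dist ((LINT t:ball 0 r|lborel. f t) / r ^ (?k + 2)) (?V / (real ?k + 2) * trace M) < e"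
    using d(1) \<delta> by (auto simp: eventually_at_right_field intro!: exI[of _ "min d \<delta>"])
qed

text \<open>For the denominator of the relative error, the tail probability itself.\<close>

lemma ball_integral_asymp_0:
  fixes f :: "real^'k \<Rightarrow> real"
  assumes \<delta>: "\<delta> > 0" and cont: "continuous_on (cball 0 \<delta>) f"
  shows "((\<lambda>r. (LINT t:ball 0 r|lborel. f t) / r ^ CARD('k)) \<longlongrightarrow>
    unit_ball_vol (real CARD('k)) * f 0) (at_right 0)"
proof (rule tendstoI)
  fix e :: real assume e: "e > 0"
  let ?k = "CARD('k)"
  let ?V = "unit_ball_vol (real ?k)"
  have V: "?V > 0" by simp
  define \<epsilon> where "\<epsilon> = e / (2 * ?V)"
  have \<epsilon>: "\<epsilon> > 0" using e V by (simp add: \<epsilon>_def)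
  obtain d where d: "d > 0" "\<And>t. t \<in> cball 0 \<delta> \<Longrightarrow> norm t < d \<Longrightarrow> \<bar>f t - f 0\<bar> < \<epsilon>"
    using cont[unfolded continuous_on_iff, rule_format, of 0 \<epsilon>] \<epsilon> \<delta> by (auto simp: dist_norm)
  have "dist ((LINT t:ball 0 r|lborel. f t) / r ^ ?k) (?V * f 0) < e"
    if r: "0 < r" "r < min d \<delta>" for r
  proof -
    have i1: "set_integrable lborel (ball 0 r) f"
      using r by (intro set_integrable_ball continuous_on_subset[OF cont]) auto
    have i2: "set_integrable lborel (ball (0::real^'k) r) (\<lambda>t. c)" for c :: real
      by (intro set_integrable_ball continuous_intros)
    note i12 = set_integral_diff[OF i1 i2[of "f 0"]]
    have const: "(LINT t:ball (0::real^'k) r|lborel. c) = c * (?V * r ^ ?k)" for c :: real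
      by (subst set_integral_const)
        (use r content_ball[of r "0::real^'k"] emeasure_bounded_finite[of "ball (0::real^'k) r"] in auto)
    have "\<bar>(LINT t:ball 0 r|lborel. f t) - f 0 * (?V * r ^ ?k)\<bar> = \<bar>LINT t:ball 0 r|lborel. f t - f 0\<bar>"
      using i12(2) const by simp
    also have "\<dots> \<le> (LINT t:ball (0::real^'k) r|lborel. \<bar>f t - f 0\<bar>)"
      using set_integral_norm_bound[OF i12(1)] by simp
    also have "\<dots> \<le> (LINT t:ball (0::real^'k) r|lborel. \<epsilon>)"
      using r by (intro set_integral_mono set_integrable_abs i12(1) i2 less_imp_le[OF d(2)]) auto
    also have "\<dots> < e * r ^ ?k"
      using e r V by (simp add: \<epsilon>_def const)
    finally have "\<bar>(LINT t:ball 0 r|lborel. f t) - f 0 * (?V * r ^ ?k)\<bar> / r ^ ?k < e"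
      using r by (simp add: divide_less_eq)
    also have "\<bar>(LINT t:ball 0 r|lborel. f t) - f 0 * (?V * r ^ ?k)\<bar> / r ^ ?k
       = \<bar>((LINT t:ball 0 r|lborel. f t) - f 0 * (?V * r ^ ?k)) / r ^ ?k\<bar>"
      using r by simp
    also have "\<dots> = \<bar>(LINT t:ball 0 r|lborel. f t) / r ^ ?k - ?V * f 0\<bar>"
      using r by (simp add: diff_divide_distrib mult.commute)
    finally show ?thesis by (simp add: dist_real_def)
  qed
  then show "\<forall>\<^sub>F r in at_right 0. dist ((LINT t:ball 0 r|lborel. f t) / r ^ ?k) (?V * f 0) < e"
    using d(1) \<delta> by (auto simp: eventually_at_right_field intro!: exI[of _ "min d \<delta>"])
qed

section \<open>Second-order expansions\<close>

text \<open>Second derivatives are only known to exist, so the remainder is of Peano type. The mean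
  value theorem along the segment from 0 to \<open>t\<close> reduces it to the first-order expansion
  of the gradient at 0.\<close>

lemma taylor_second_order:
  fixes G :: "real^'k \<Rightarrow> real"
  assumes "twice_differentiable_near G 0" "\<epsilon> > 0"
  shows "\<forall>\<^sub>F t in nhds 0. \<bar>G t - G 0 - gradient G 0 \<bullet> t - t \<bullet> (((1/2) *\<^sub>R hessian G 0) *v t)\<bar> \<le> \<epsilon> * (norm t)\<^sup>2"
proof -
  define H where "H = hessian G 0"
  obtain U where U: "open U" "0 \<in> U" "\<And>x. x \<in> U \<Longrightarrow> G differentiable (at x)"
    "\<And>x. x \<in> U \<Longrightarrow> gradient G differentiable (at x)"
    using assms(1) by (auto simp: twice_differentiable_near_def)
  have dG: "(G has_derivative (\<lambda>h. gradient G x \<bullet> h)) (at x)" if "x \<in> U" for x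
  proof -
    let ?D = "frechet_derivative G (at x)"
    have D: "(G has_derivative ?D) (at x)"
      using U(3)[OF that] frechet_derivative_works by blast
    interpret linear ?D using has_derivative_linear[OF D] .
    have "?D h = gradient G x \<bullet> h" for h
    proof -
      have "?D h = ?D (\<Sum>i\<in>UNIV. h $ i *\<^sub>R axis i 1)"
        using basis_expansion[of h] by (simp add: scalar_mult_eq_scaleR)
      also have "\<dots> = gradient G x \<bullet> h"
        by (simp add: sum scaleR gradient_def inner_vec_def mult.commute)
      finally show ?thesis .
    qed
    then have "?D = (\<lambda>h. gradient G x \<bullet> h)" by (rule ext)
    then show ?thesis using D by simp
  qed
  have "(gradient G has_derivative (\<lambda>h. H *v h)) (at 0)"
    unfolding H_def hessian_def using U(2,4) by (metis jacobian_works)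
  then obtain d where d: "d > 0"
    "\<And>x. norm x < d \<Longrightarrow> norm (gradient G x - gradient G 0 - H *v x) \<le> \<epsilon> * norm x"
    using assms(2) unfolding has_derivative_at_alt by (metis diff_zero)
  obtain d' where d': "d' > 0" "ball 0 d' \<subseteq> U"
    using U(1,2) openE by blast
  have "\<bar>G t - G 0 - gradient G 0 \<bullet> t - t \<bullet> (((1/2) *\<^sub>R H) *v t)\<bar> \<le> \<epsilon> * (norm t)\<^sup>2"
    if t: "norm t < min d d'" for t
  proof -
    \<comment> \<open>\<open>G\<close> minus the linear and quadratic Taylor terms along the
      segment, so that \<open>p 1 - p 0\<close> is the remainder to be bounded.\<close>
    define p where "p s = G (s *\<^sub>R t) - s * (gradient G 0 \<bullet> t) - s\<^sup>2 / 2 * (t \<bullet> (H *v t))" for s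
    define p' where "p' s = (gradient G (s *\<^sub>R t) - gradient G 0 - H *v (s *\<^sub>R t)) \<bullet> t" for s
    have small: "norm (s *\<^sub>R t) < min d d'" "norm (s *\<^sub>R t) \<le> norm t" if "0 \<le> s" "s \<le> 1" for s
    proof -
      show "norm (s *\<^sub>R t) \<le> norm t" using that by (simp add: mult_left_le_one_le)
      then show "norm (s *\<^sub>R t) < min d d'" using t by linarith
    qed
    have der: "(p has_real_derivative p' s) (at s)" if s: "0 \<le> s" "s \<le> 1" for s
    proof -
      have "s *\<^sub>R t \<in> U" using small[OF s] d' by auto
      then have dG: "((\<lambda>s. G (s *\<^sub>R t)) has_derivative (\<lambda>h. gradient G (s *\<^sub>R t) \<bullet> (h *\<^sub>R t))) (at s)"
        by (intro has_derivative_compose[of "\<lambda>s. s *\<^sub>R t" "\<lambda>h. h *\<^sub>R t" s UNIV G] dG)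
          (auto intro!: derivative_eq_intros)
      have "((\<lambda>s. G (s *\<^sub>R t)) has_real_derivative (gradient G (s *\<^sub>R t) \<bullet> t)) (at s)"
        unfolding has_field_derivative_def
        by (rule has_derivative_eq_rhs[OF dG]) (auto simp: fun_eq_iff)
      then show ?thesis
        unfolding p_def p'_def
        by (auto intro!: derivative_eq_intros simp: matrix_vector_mult_scaleR inner_diff_left inner_diff_right inner_commute)
    qed
    obtain s where s: "0 < s" "s < 1" "p 1 - p 0 = (1 - 0) * p' s"
      using MVT2[of 0 1 p p'] der by force
    \<comment> \<open>One factor \<open>norm t\<close> comes from the differentiability of the
      gradient at 0, the other from differentiating in the direction \<open>t\<close>.\<close>
    have "\<bar>p' s\<bar> \<le> norm (gradient G (s *\<^sub>R t) - gradient G 0 - H *v (s *\<^sub>R t)) * norm t"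
      unfolding p'_def by (rule Cauchy_Schwarz_ineq2)
    also have "\<dots> \<le> (\<epsilon> * norm (s *\<^sub>R t)) * norm t"
      using small[of s] s by (intro mult_right_mono d(2)) auto
    also have "\<dots> \<le> (\<epsilon> * norm t) * norm t"
      using small(2)[of s] s assms(2) by (intro mult_right_mono mult_left_mono) auto
    finally have "\<bar>p 1 - p 0\<bar> \<le> \<epsilon> * (norm t)\<^sup>2"
      using s(3) by (simp add: power2_eq_square)
    moreover have "p 1 - p 0 = G t - G 0 - gradient G 0 \<bullet> t - t \<bullet> (((1/2) *\<^sub>R H) *v t)"
      by (simp add: p_def scaleR_matrix_vector_assoc[symmetric])
    ultimately show ?thesis by simp
  qed
  then show ?thesis
    using d(1) d'(1) unfolding H_def eventually_nhds_metric
    by (intro exI[of _ "min d d'"]) (simp add: dist_norm)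
qed

text \<open>The function depends on \<open>t\<close> through \<open>(norm t)\<^sup>2\<close> only,
  so a first-order expansion in that single variable is already of second order in
  \<open>t\<close>.\<close>

lemma student_density_expansion:
  fixes c q :: real
  assumes "c > 0" "\<epsilon> > 0"
  shows "\<forall>\<^sub>F t in nhds (0::'a::real_normed_vector).
    \<bar>(1 + c * (norm t)\<^sup>2) powr (- q) - 1 + q * c * (norm t)\<^sup>2\<bar> \<le> \<epsilon> * (norm t)\<^sup>2"
proof -
  have "((\<lambda>x. (1 + c * x) powr (- q)) has_real_derivative (- q * c)) (at 0)"
    by (auto intro!: derivative_eq_intros)
  then have "((\<lambda>x. (1 + c * x) powr (- q)) has_derivative (*) (- q * c)) (at 0)"
    by (simp only: has_field_derivative_def)
  then obtain d where d': "d > 0"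
    "\<And>x. norm (x - 0) < d \<Longrightarrow> norm ((1 + c * x) powr (- q) - (1 + c * 0) powr (- q) - - q * c * (x - 0)) \<le> \<epsilon> * norm (x - 0)"
    using assms(2) unfolding has_derivative_at_alt by blast
  have d: "d > 0"
    "\<And>x. \<bar>x\<bar> < d \<Longrightarrow> \<bar>(1 + c * x) powr (- q) - 1 + q * c * x\<bar> \<le> \<epsilon> * \<bar>x\<bar>"
    using d' by simp_all
  have "((\<lambda>t::'a. (norm t)\<^sup>2) \<longlongrightarrow> (norm (0::'a))\<^sup>2) (nhds 0)"
    by (intro tendsto_intros filterlim_ident)
  then have "\<forall>\<^sub>F t in nhds (0::'a). (norm t)\<^sup>2 < d"
    by (rule order_tendstoD(2)) (use d(1) in simp)
  then show ?thesis
  proof eventually_elim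
    case (elim t)
    then show ?case using d(2)[of "(norm t)\<^sup>2"] by simp
  qed
qed

text \<open>The condition on \<open>G 0\<close> makes the integrand of the numerator vanish at 0, so
  the numerator is of order \<open>r ^ (CARD('k) + 2)\<close> against \<open>r ^ CARD('k)\<close>
  for \<open>P r\<close>.\<close>

lemma relative_ball_integral_asymp:
  fixes G :: "real^'k \<Rightarrow> real"
  assumes G: "twice_differentiable_near G 0" and c: "c > 0" and K: "K > 0" and C0: "C0 > 0" and G0: "G 0 = K * C0"
    and \<delta>: "\<delta> > 0"
    and P: "\<And>r. 0 < r \<Longrightarrow> r < \<delta> \<Longrightarrow> P r = (LINT t:ball 0 r|lborel. G t)"
    and P0: "\<And>r. 0 < r \<Longrightarrow> r < \<delta> \<Longrightarrow> P0 r = (LINT t:ball (0::real^'k) r|lborel. C0 * (1 + c * (norm t)\<^sup>2) powr (- q))"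
  shows "((\<lambda>r. (P r - K * P0 r) / P r / r\<^sup>2) \<longlongrightarrow>
      (trace (hessian G 0) / (2 * (real CARD('k) + 2)) + K * C0 * q * c * real CARD('k) / (real CARD('k) + 2)) / (K * C0)) (at_right 0)"
proof -
  let ?k = "CARD('k)"
  let ?V = "unit_ball_vol (real ?k)"
  define f0 where "f0 t = C0 * (1 + c * (norm t)\<^sup>2) powr (- q)" for t :: "real^'k"
  define f where "f t = G t - K * f0 t" for t
  \<comment> \<open>Half the Hessian from \<open>G\<close>; the quadratic part of
    \<open>- K * f0\<close> is \<open>K * C0 * q * c * (norm t)\<^sup>2\<close>, a multiple of the
    identity form.\<close>
  define M where "M = (1/2) *\<^sub>R hessian G 0 + (K * C0 * q * c) *\<^sub>R mat 1"
  have trM: "trace M = trace (hessian G 0) / 2 + K * C0 * q * c * real ?k"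
    by (simp add: M_def trace_def mat_def sum.distrib sum_distrib_left sum_divide_distrib)
  obtain U where U: "open U" "0 \<in> U" "\<And>x. x \<in> U \<Longrightarrow> G differentiable (at x)"
    using G by (auto simp: twice_differentiable_near_def)
  obtain d where d: "d > 0" "cball 0 d \<subseteq> U"
    using U(1,2) open_contains_cball by blast
  have contG: "continuous_on (cball 0 d) G"
    by (rule differentiable_imp_continuous_on)
      (use d(2) U(3) in \<open>auto simp: differentiable_on_def intro: differentiable_at_withinI\<close>)
  have p: "1 + c * (norm t)\<^sup>2 \<noteq> 0" for t :: "real^'k"
    using c by (smt (verit) mult_nonneg_nonneg zero_le_power2)
  have contf0: "continuous_on S f0" for S
    unfolding f0_def by (intro continuous_intros) (use p in auto)
  have contf: "continuous_on (cball 0 d) f"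
    unfolding f_def by (intro continuous_intros contG contf0)
  have lim2: "((\<lambda>r. (LINT t:ball 0 r|lborel. f t) / r ^ (?k + 2)) \<longlongrightarrow> ?V / (real ?k + 2) * trace M) (at_right 0)"
  proof (rule ball_integral_asymp[OF d(1) contf])
    fix \<epsilon> :: real assume \<epsilon>: "\<epsilon> > 0"
    \<comment> \<open>Each of the two expansions gets half of \<open>\<epsilon>\<close>; the second
      enters \<open>f\<close> with the factor \<open>K * C0\<close>.\<close>
    define \<epsilon>' where "\<epsilon>' = \<epsilon> / (2 * (K * C0))"
    have \<epsilon>': "\<epsilon>' > 0" using \<epsilon> K C0 by (simp add: \<epsilon>'_def)
    have "\<forall>\<^sub>F t in nhds 0. \<bar>G t - G 0 - gradient G 0 \<bullet> t - t \<bullet> (((1/2) *\<^sub>R hessian G 0) *v t)\<bar> \<le> (\<epsilon> / 2) * (norm t)\<^sup>2"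
      using taylor_second_order[OF G, of "\<epsilon> / 2"] \<epsilon> by simp
    moreover have "\<forall>\<^sub>F t in nhds (0::real^'k). \<bar>(1 + c * (norm t)\<^sup>2) powr (- q) - 1 + q * c * (norm t)\<^sup>2\<bar> \<le> \<epsilon>' * (norm t)\<^sup>2"
      by (rule student_density_expansion[OF c \<epsilon>'])
    ultimately show "\<forall>\<^sub>F t in nhds 0. \<bar>f t - gradient G 0 \<bullet> t - t \<bullet> (M *v t)\<bar> \<le> \<epsilon> * (norm t)\<^sup>2"
    proof eventually_elim
      case (elim t)
      let ?A = "G t - G 0 - gradient G 0 \<bullet> t - t \<bullet> (((1/2) *\<^sub>R hessian G 0) *v t)"
      let ?B = "(1 + c * (norm t)\<^sup>2) powr (- q) - 1 + q * c * (norm t)\<^sup>2"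
      have "t \<bullet> (M *v t) = t \<bullet> (((1/2) *\<^sub>R hessian G 0) *v t) + K * C0 * q * c * (norm t)\<^sup>2"
        by (simp add: M_def matrix_vector_mult_add_rdistrib scaleR_matrix_vector_assoc[symmetric]
            inner_add_right power2_norm_eq_inner)
      then have "f t - gradient G 0 \<bullet> t - t \<bullet> (M *v t) = ?A - K * C0 * ?B"
        by (simp add: f_def f0_def G0 algebra_simps)
      also have "\<bar>\<dots>\<bar> \<le> \<bar>?A\<bar> + \<bar>K * C0 * ?B\<bar>" by linarith
      also have "\<bar>K * C0 * ?B\<bar> = K * C0 * \<bar>?B\<bar>" using K C0 by (simp add: abs_mult)
      also have "\<dots> \<le> K * C0 * (\<epsilon>' * (norm t)\<^sup>2)"
        using K C0 elim(2) by (intro mult_left_mono) auto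
      also have "\<dots> = \<epsilon> / 2 * (norm t)\<^sup>2" using K C0 by (simp add: \<epsilon>'_def)
      finally show ?case using elim(1) by linarith
    qed
  qed
  have lim0: "((\<lambda>r. (LINT t:ball 0 r|lborel. G t) / r ^ ?k) \<longlongrightarrow> ?V * (K * C0)) (at_right 0)"
    using ball_integral_asymp_0[OF d(1) contG] by (simp add: G0)
  have V: "?V > 0" by simp
  have lim: "((\<lambda>r. ((LINT t:ball 0 r|lborel. f t) / r ^ (?k + 2)) / ((LINT t:ball 0 r|lborel. G t) / r ^ ?k))
      \<longlongrightarrow> (?V / (real ?k + 2) * trace M) / (?V * (K * C0))) (at_right 0)"
    using V[THEN less_imp_neq] K C0 by (intro tendsto_divide lim2 lim0) auto
  have const: "(?V / (real ?k + 2) * trace M) / (?V * (K * C0)) =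
     (trace (hessian G 0) / (2 * (real ?k + 2)) + K * C0 * q * c * real ?k / (real ?k + 2)) / (K * C0)"
  proof -
    have "(?V / (real ?k + 2) * trace M) / (?V * (K * C0)) = (trace M / (real ?k + 2)) / (K * C0)"
      using less_imp_neq[OF V] by simp
    also have "trace M / (real ?k + 2) = trace (hessian G 0) / (2 * (real ?k + 2)) + K * C0 * q * c * real ?k / (real ?k + 2)"
      unfolding trM by (simp add: add_divide_distrib)
    finally show ?thesis .
  qed
  have ev: "\<forall>\<^sub>F r in at_right 0. ((LINT t:ball 0 r|lborel. f t) / r ^ (?k + 2)) / ((LINT t:ball 0 r|lborel. G t) / r ^ ?k)
     = (P r - K * P0 r) / P r / r\<^sup>2"
  proof -
    have "((LINT t:ball 0 r|lborel. f t) / r ^ (?k + 2)) / ((LINT t:ball 0 r|lborel. G t) / r ^ ?k)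
       = (P r - K * P0 r) / P r / r\<^sup>2" if r: "0 < r" "r < min d \<delta>" for r
    proof -
      have "set_integrable lborel (ball 0 r) G"
        using r by (intro set_integrable_ball continuous_on_subset[OF contG]) auto
      moreover have "set_integrable lborel (ball 0 r) (\<lambda>t. K * f0 t)"
        by (intro set_integrable_ball continuous_intros contf0)
      ultimately have "(LINT t:ball 0 r|lborel. f t) = P r - K * P0 r"
        unfolding f_def using r by (simp add: set_integral_diff P P0 f0_def)
      moreover have "P r = (LINT t:ball 0 r|lborel. G t)" using r by (simp add: P)
      ultimately show ?thesis using r by (simp add: power_add power2_eq_square)
    qed
    then show ?thesis
      using d(1) \<delta> by (auto simp: eventually_at_right_field intro!: exI[of _ "min d \<delta>"])
  qed
  show ?thesis
    using lim unfolding const tendsto_cong[OF ev] .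
qed

section \<open>From a limit to the leading term, and the constant in it\<close>

lemma leading_termI:
  assumes "((\<lambda>u. rel u * u ^ \<alpha>) \<longlongrightarrow> C) at_top"
  shows "leading_term rel C \<alpha>"
  unfolding leading_term_def
proof (intro conjI impI)
  have pos: "\<forall>\<^sub>F u::real in at_top. u > 0" by (rule eventually_gt_at_top)
  have "((\<lambda>u. rel u * u ^ \<alpha> - C) \<longlongrightarrow> C - C) at_top"
    by (intro tendsto_intros assms)
  moreover have "\<forall>\<^sub>F u in at_top. (rel u - C / u ^ \<alpha>) / (1 / u ^ \<alpha>) = rel u * u ^ \<alpha> - C"
    using pos by eventually_elim (simp add: field_simps)
  ultimately have "((\<lambda>u. (rel u - C / u ^ \<alpha>) / (1 / u ^ \<alpha>)) \<longlongrightarrow> 0) at_top"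
    by (subst tendsto_cong) auto
  then show "(\<lambda>u. rel u - C / u ^ \<alpha>) \<in> o(\<lambda>u. 1 / u ^ \<alpha>)"
    by (rule smalloI_tendsto) (use pos in \<open>eventually_elim, simp\<close>)
  assume C: "C \<noteq> 0"
  have "((\<lambda>u. rel u * u ^ \<alpha> / C) \<longlongrightarrow> C / C) at_top"
    by (intro tendsto_intros assms C)
  then show "rel \<sim>[at_top] (\<lambda>u. C / u ^ \<alpha>)"
    using C by (intro asymp_equivI') simp
qed

text \<open>The hypothesis on \<open>C0\<close> says that the Student-type function with value
  \<open>C0\<close> at 0 has total integral \<open>1 / \<alpha>\<close>. It forces
  \<open>tail_factor * unit_ball_vol * C0 = 1\<close>, hence \<open>const_KG\<close> equals
  \<open>K\<close>, and \<open>const_C3\<close> becomes the limit found for the ball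
  integrals.\<close>

lemma student_constants:
  assumes k: "k > 0" and m: "m > 0" and \<alpha>: "\<alpha> > 0" and K: "K > 0"
    and C0: "real \<alpha> * C0 * ((pi / (real k / real m)) powr (real k / 2) * Gamma (real m / 2) / Gamma ((real k + real m) / 2)) = 1"
    and G0: "G 0 = K * C0"
  shows "const_C3 \<alpha> m k K G = (trace (hessian G 0) / (2 * (real k + 2)) +
      K * C0 * ((real k + real m) / 2) * (real k / real m) * real k / (real k + 2)) / (K * C0)"
proof -
  let ?V = "unit_ball_vol (real k)"
  let ?x = "(real k / real m) powr (real k / 2)"
  let ?p = "pi powr (real k / 2)"
  let ?B = "Beta (real m / 2) (real k / 2)"
  have g: "Gamma (real m / 2) > 0" "Gamma (real k / 2) > 0" "Gamma ((real k + real m) / 2) > 0"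
    using k m by (auto intro!: Gamma_real_pos)
  have x: "?x > 0" "?p > 0" using k m by auto
  have V: "?V * (real k / 2 * Gamma (real k / 2)) = ?p"
  proof -
    have "real k / 2 \<notin> \<int>\<^sub>\<le>\<^sub>0" using k by (auto elim!: nonpos_Ints_cases)
    from Gamma_plus1[OF this] show ?thesis
      using k less_imp_neq[OF g(2)] by (simp add: unit_ball_vol_def)
  qed
  have B: "?B * Gamma ((real k + real m) / 2) = Gamma (real m / 2) * Gamma (real k / 2)"
    using g by (simp add: Beta_def add_divide_distrib add.commute)
  have "?B * Gamma ((real k + real m) / 2) > 0" unfolding B using g by simp
  then have Bpos: "?B > 0" using g(3) by (rule zero_less_mult_pos2)
  have p: "(pi / (real k / real m)) powr (real k / 2) = ?p / ?x"
    by (rule powr_divide)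
  \<comment> \<open>\<open>Beta\<close> and the ball volume are expressed by Gamma values.
    \<open>Gamma ((k + m) / 2)\<close>, \<open>Gamma (k / 2)\<close> and the power of
    \<open>k / m\<close> are multiplied in to clear denominators and cancelled at the end.\<close>
  have tfV: "tail_factor \<alpha> m k * ?V * C0 = 1"
  proof -
    have C0': "real \<alpha> * C0 * ?p * Gamma (real m / 2) = ?x * Gamma ((real k + real m) / 2)"
      using C0 g x unfolding p by (simp add: field_simps)
    have "(tail_factor \<alpha> m k * ?V * C0) * (?x * Gamma ((real k + real m) / 2) * Gamma (real k / 2))
      = (?B * Gamma ((real k + real m) / 2)) * (?V * (real k / 2 * Gamma (real k / 2))) * (real \<alpha> * C0)"
      using x by (simp add: tail_factor_def)
    also have "\<dots> = Gamma (real k / 2) * (real \<alpha> * C0 * ?p * Gamma (real m / 2))"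
      unfolding V B by (simp add: mult_ac)
    also have "\<dots> = 1 * (?x * Gamma ((real k + real m) / 2) * Gamma (real k / 2))"
      unfolding C0' by (simp add: mult_ac)
    finally show ?thesis using g x by (simp only: mult_cancel_right; simp)
  qed
  then have C0n: "C0 \<noteq> 0" by auto
  then have tf: "tail_factor \<alpha> m k * ?V = 1 / C0" using tfV by (simp add: field_simps)
  \<comment> \<open>\<open>Beta\<close> and the power of \<open>k / m\<close> occur inverted in
    \<open>const_C2\<close>, so a rational expression remains.\<close>
  have c2: "tail_factor \<alpha> m k * const_C2 m k = real \<alpha> * (real k * (real k + real m) / (real m * (real k + 2)) * (real k / 2))"
    using Bpos x by (simp add: tail_factor_def const_C2_def mult_ac)
  have "const_C3 \<alpha> m k K G
    = ((tail_factor \<alpha> m k * ?V) * (trace (hessian G 0) / (2 * (real k + 2)))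
       + (tail_factor \<alpha> m k * const_C2 m k) * ((tail_factor \<alpha> m k * ?V) * G 0) / real \<alpha>) / K"
  proof -
    have "t * ((v * a + c * (t * v * g / \<alpha>')) / K) = ((t * v) * a + (t * c) * ((t * v) * g) / \<alpha>') / K"
      for t v a c g \<alpha>' :: real
      by (simp add: distrib_left mult_ac)
    then show ?thesis
      unfolding const_C3_def const_LG_def const_KG_def const_C1_def .
  qed
  also have "\<dots> = (trace (hessian G 0) / (2 * (real k + 2)) +
      K * C0 * ((real k + real m) / 2) * (real k / real m) * real k / (real k + 2)) / (K * C0)"
  proof -
    have "(1 / C0 * T + real \<alpha> * (k1 * k2 / (m1 * k3) * (k1 / 2)) * (1 / C0 * (K * C0)) / real \<alpha>) / K
      = (T + K * C0 * (k2 / 2) * (k1 / m1) * k1 / k3) / (K * C0)" for T k1 k2 k3 m1 :: real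
    proof -
      have "real \<alpha> * (k1 * k2 / (m1 * k3) * (k1 / 2)) * (1 / C0 * (K * C0)) / real \<alpha> = K * (k1 * k2 / (m1 * k3) * (k1 / 2))"
        using \<alpha> C0n by (simp add: mult_ac)
      also have "\<dots> = 1 / C0 * (K * C0 * (k2 / 2) * (k1 / m1) * k1 / k3)"
        using C0n by (simp add: mult_ac)
      finally have *: "real \<alpha> * (k1 * k2 / (m1 * k3) * (k1 / 2)) * (1 / C0 * (K * C0)) / real \<alpha> = \<dots>" .
      have "(1 / C0 * T + 1 / C0 * W) / K = (T + W) / (K * C0)" for W
        using K C0n by (simp add: field_simps)
      then show ?thesis unfolding * .
    qed
    then show ?thesis unfolding tf c2 G0 .
  qed
  finally show ?thesis .
qed

section \<open>Tail probabilities by orthogonal splitting\<close>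

text \<open>The value at \<open>0\<close> of the function \<open>G\<close> that belongs to the normal density; it equals
  \<open>1 / (tail_factor \<alpha> m k * unit_ball_vol k)\<close>.\<close>
definition slice_const :: "nat \<Rightarrow> nat \<Rightarrow> nat \<Rightarrow> real" where
  "slice_const \<alpha> m k = 1 / (real \<alpha> * ((pi / (real k / real m)) powr (real k / 2) * Gamma (real m / 2) / Gamma ((real k + real m) / 2)))"

lemma slice_const_pos:
  assumes "\<alpha> > 0" "m > 0" "k > 0"
  shows "slice_const \<alpha> m k > 0"
  using assms by (auto simp: slice_const_def intro!: mult_pos_pos divide_pos_pos Gamma_real_pos)

text \<open>The maps \<open>S l\<close> stretch the \<open>m\<close> directions on which \<open>rad\<close> depends; they evaluate the Gaussian
  integrals by scaling.  The assumption \<open>rad_sym\<close> says that \<open>T\<close> is either positive (\<open>\<alpha> = 1\<close>) or odd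
  (\<open>\<alpha> = 2\<close>), so that it exceeds \<open>0\<close> with probability \<open>1/\<alpha>\<close> under a normal distribution.\<close>
locale slice =
  fixes \<Phi> :: "'z::euclidean_space \<times> (real^'k) \<Rightarrow> 'd::euclidean_space"
    and rad :: "'z \<Rightarrow> real" and T :: "'d \<Rightarrow> real" and m \<alpha> :: nat and S :: "real \<Rightarrow> 'z \<Rightarrow> 'z"
  assumes lin: "linear \<Phi>" and iso: "\<And>p. norm (\<Phi> p) = norm p"
    and dim: "DIM('z) + CARD('k) = DIM('d)"
    and rad_meas [measurable]: "rad \<in> borel_measurable borel" and rad_nonneg: "\<And>z. 0 \<le> rad z"
    and T_meas [measurable]: "T \<in> borel_measurable borel"
    and T_iff: "\<And>u z y. u > 0 \<Longrightarrow> y \<noteq> 0 \<Longrightarrow>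
      T (\<Phi> (z, y)) > u \<longleftrightarrow> norm y < rad z * u powr (- (real \<alpha> / 2))"
    and m: "m > 0" and \<alpha>: "\<alpha> > 0"
    and rad_sym: "AE z in lborel. (if rad z > 0 then 1 else 0) + (if rad (- z) > 0 then 1 else 0 :: real) = 2 / real \<alpha>"
    and S_meas [measurable]: "\<And>l. l > 0 \<Longrightarrow> S l \<in> borel_measurable borel"
    and S_rad: "\<And>l z. l > 0 \<Longrightarrow> rad (S l z) = l * rad z"
    and S_norm: "\<And>l z. l > 0 \<Longrightarrow> rad z > 0 \<Longrightarrow> (norm (S l z))\<^sup>2 = (norm z)\<^sup>2 + real m / real CARD('k) * (l\<^sup>2 - 1) * (rad z)\<^sup>2"
    and S_int: "\<And>l f. l > 0 \<Longrightarrow> f \<in> borel_measurable borel \<Longrightarrow>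
      (\<integral>\<^sup>+z. f z \<partial>lborel) = ennreal (l ^ m) * (\<integral>\<^sup>+z. f (S l z) \<partial>lborel)"
begin

text \<open>The common form of \<open>one_G\<close>, \<open>two_G\<close> and \<open>F_G\<close>, as
  an extended nonnegative integral so that it has a meaning before finiteness is known. The power of
  \<open>rad z\<close> is the Jacobian of \<open>y = rad z *\<^sub>R t\<close>.\<close>

definition slice_int :: "('d \<Rightarrow> real) \<Rightarrow> real^'k \<Rightarrow> ennreal" where
  "slice_int g t = (\<integral>\<^sup>+z. ennreal (rad z ^ CARD('k) * g (\<Phi> (z, rad z *\<^sub>R t))) \<partial>lborel)"

lemma \<Phi>_measurable [measurable]: "\<Phi> \<in> borel_measurable borel"
  using lin by (rule borel_measurable_linear)

lemma \<Phi>_measurableurable_pair [measurable]: "\<Phi> \<in> lborel \<Otimes>\<^sub>M lborel \<rightarrow>\<^sub>M borel"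
  using \<Phi>_measurable by (simp add: lborel_prod)

lemma \<Phi>_measurableurable_borel_pair [measurable]: "\<Phi> \<in> borel \<Otimes>\<^sub>M borel \<rightarrow>\<^sub>M borel"
  using \<Phi>_measurable by (simp add: borel_prod)

lemma rad_cases: "rad z > 0 \<or> rad z = 0"
  using rad_nonneg[of z] by linarith

lemma slice_int_measurable [measurable]:
  assumes [measurable]: "g \<in> borel_measurable borel"
  shows "slice_int g \<in> borel_measurable borel"
  unfolding slice_int_def by measurable

text \<open>Tonelli, then \<open>y = rad z *\<^sub>R t\<close> for fixed \<open>z\<close>. Where
  \<open>rad z = 0\<close> the Jacobian vanishes, the dimension being positive; this accounts for
  the \<open>else 0\<close>.\<close>

lemma nn_integral_slice_int:
  assumes [measurable]: "g \<in> borel_measurable borel" "f \<in> borel_measurable borel"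
  shows "(\<integral>\<^sup>+t. f t * slice_int g t \<partial>lborel)
    = (\<integral>\<^sup>+z. (\<integral>\<^sup>+y. (if rad z > 0 then f (y /\<^sub>R rad z) * ennreal (g (\<Phi> (z, y))) else 0) \<partial>lborel) \<partial>lborel)"
proof -
  have "(\<integral>\<^sup>+t. f t * slice_int g t \<partial>lborel)
    = (\<integral>\<^sup>+t. (\<integral>\<^sup>+z. f t * ennreal (rad z ^ CARD('k) * g (\<Phi> (z, rad z *\<^sub>R t))) \<partial>lborel) \<partial>lborel)"
    unfolding slice_int_def by (intro nn_integral_cong nn_integral_cmult[symmetric]) measurable
  also have "\<dots> = (\<integral>\<^sup>+z. (\<integral>\<^sup>+t. f t * ennreal (rad z ^ CARD('k) * g (\<Phi> (z, rad z *\<^sub>R t))) \<partial>lborel) \<partial>lborel)"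
    by (rule lborel_pair.Fubini') measurable
  also have "\<dots> = (\<integral>\<^sup>+z. (\<integral>\<^sup>+y. (if rad z > 0 then f (y /\<^sub>R rad z) * ennreal (g (\<Phi> (z, y))) else 0) \<partial>lborel) \<partial>lborel)"
  proof (rule nn_integral_cong)
    fix z
    consider "rad z > 0" | "rad z = 0" using rad_cases by blast
    then show "(\<integral>\<^sup>+t. f t * ennreal (rad z ^ CARD('k) * g (\<Phi> (z, rad z *\<^sub>R t))) \<partial>lborel)
      = (\<integral>\<^sup>+y. (if rad z > 0 then f (y /\<^sub>R rad z) * ennreal (g (\<Phi> (z, y))) else 0) \<partial>lborel)"
    proof cases
      case 1
      have "(\<integral>\<^sup>+y. f (y /\<^sub>R rad z) * ennreal (g (\<Phi> (z, y))) \<partial>lborel)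
        = ennreal (rad z ^ CARD('k)) * (\<integral>\<^sup>+t. f t * ennreal (g (\<Phi> (z, rad z *\<^sub>R t))) \<partial>lborel)"
        by (subst nn_integral_scaleR[OF _ 1]) (use 1 in auto)
      also have "\<dots> = (\<integral>\<^sup>+t. f t * ennreal (rad z ^ CARD('k) * g (\<Phi> (z, rad z *\<^sub>R t))) \<partial>lborel)"
        by (subst nn_integral_cmult[symmetric])
          (use 1 in \<open>auto simp: ennreal_mult' mult_ac simp del: zero_less_power\<close>)
      finally show ?thesis using 1 by simp
    qed (simp add: zero_power)
  qed
  finally show ?thesis .
qed

lemma nn_integral_split:
  assumes [measurable]: "f \<in> borel_measurable borel"
  shows "(\<integral>\<^sup>+x. f x \<partial>lborel) = (\<integral>\<^sup>+z. (\<integral>\<^sup>+y. f (\<Phi> (z, y)) \<partial>lborel) \<partial>lborel)"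
proof -
  have "(\<integral>\<^sup>+x. f x \<partial>lborel) = (\<integral>\<^sup>+p. f (\<Phi> p) \<partial>(lborel \<Otimes>\<^sub>M lborel))"
    unfolding lborel_prod by (rule nn_integral_isometry[symmetric]) (use lin iso dim in auto)
  also have "\<dots> = (\<integral>\<^sup>+z. (\<integral>\<^sup>+y. f (\<Phi> (z, y)) \<partial>lborel) \<partial>lborel)"
    by (subst lborel.nn_integral_fst[symmetric]) auto
  finally show ?thesis .
qed

lemma emeasure_tail:
  assumes [measurable]: "g \<in> borel_measurable borel" and u: "u > 0"
  shows "emeasure (density lborel (\<lambda>x. ennreal (g x))) {x. T x > u}
    = (\<integral>\<^sup>+t. indicator (ball 0 (u powr (- (real \<alpha> / 2)))) t * slice_int g t \<partial>lborel)"
proof -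
  let ?r = "u powr (- (real \<alpha> / 2))"
  have [measurable]: "(\<lambda>t::real^'k. indicator (ball 0 ?r) t :: ennreal) \<in> borel_measurable borel"
    by (rule borel_measurable_indicator) simp
  have "emeasure (density lborel (\<lambda>x. ennreal (g x))) {x. T x > u}
    = (\<integral>\<^sup>+x. ennreal (g x) * indicator {x. T x > u} x \<partial>lborel)"
    by (subst emeasure_density) auto
  also have "\<dots> = (\<integral>\<^sup>+z. (\<integral>\<^sup>+y. ennreal (g (\<Phi> (z, y))) * indicator {x. T x > u} (\<Phi> (z, y)) \<partial>lborel) \<partial>lborel)"
    by (rule nn_integral_split) measurable
  also have "\<dots> = (\<integral>\<^sup>+z. (\<integral>\<^sup>+y. (if rad z > 0 then indicator (ball 0 ?r) (y /\<^sub>R rad z) * ennreal (g (\<Phi> (z, y))) else 0) \<partial>lborel) \<partial>lborel)"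
  proof (rule nn_integral_cong)
    fix z
    show "(\<integral>\<^sup>+y. ennreal (g (\<Phi> (z, y))) * indicator {x. T x > u} (\<Phi> (z, y)) \<partial>lborel)
      = (\<integral>\<^sup>+y. (if rad z > 0 then indicator (ball 0 ?r) (y /\<^sub>R rad z) * ennreal (g (\<Phi> (z, y))) else 0) \<partial>lborel)"
    \<comment> \<open>\<open>T_iff\<close> is silent about \<open>y = 0\<close>, where the
      statistics divide by zero; a point is a null set since \<open>y\<close> has at least one
      coordinate.\<close>
    proof (rule nn_integral_cong_AE, rule AE_mp[OF AE_lborel_singleton[of 0]], rule AE_I2, intro impI)
      fix y :: "real^'k" assume y: "y \<noteq> 0"
      show "ennreal (g (\<Phi> (z, y))) * indicator {x. T x > u} (\<Phi> (z, y))
        = (if rad z > 0 then indicator (ball 0 ?r) (y /\<^sub>R rad z) * ennreal (g (\<Phi> (z, y))) else 0)"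
      proof (cases "rad z > 0")
        case True
        have "norm (y /\<^sub>R rad z) = norm y / rad z"
          using True by (simp add: divide_inverse mult.commute abs_mult)
        then have "norm (y /\<^sub>R rad z) < ?r \<longleftrightarrow> norm y < rad z * ?r"
          using True by (simp only: pos_divide_less_eq mult.commute)
        then have "indicator {x. T x > u} (\<Phi> (z, y)) = (indicator (ball 0 ?r) (y /\<^sub>R rad z) :: ennreal)"
          using T_iff[OF u y, of z] by (simp only: indicator_def mem_ball dist_0_norm mem_Collect_eq)
        then show ?thesis using True by (simp add: mult.commute)
      next
        case False
        \<comment> \<open>Here the criterion reads \<open>norm y < 0\<close>, so the event is
          empty.\<close>
        then have "rad z = 0" using rad_cases by blast
        then show ?thesis using T_iff[OF u y, of z] by simp
      qed
    qed
  qed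
  also have "\<dots> = (\<integral>\<^sup>+t. indicator (ball 0 ?r) t * slice_int g t \<partial>lborel)"
    by (rule nn_integral_slice_int[symmetric]) measurable
  finally show ?thesis .
qed

lemma mvn_pdf_measurable [measurable]: "mvn_pdf \<sigma> \<in> borel_measurable borel"
  unfolding mvn_pdf_def by measurable

text \<open>A stretch of \<open>z\<close> undoes the displacement \<open>rad z *\<^sub>R t\<close>
  inside the norm, so \<open>t\<close> survives only in the Jacobian. The value at 0 is not computed
  but read off from the total mass, which does not involve \<open>\<sigma>\<close>.\<close>

lemma slice_int_mvn:
  assumes \<sigma>: "\<sigma> > 0"
  shows "slice_int (mvn_pdf \<sigma>) t = ennreal (slice_const \<alpha> m CARD('k) *
    (1 + real CARD('k) / real m * (norm t)\<^sup>2) powr (- ((real CARD('k) + real m) / 2)))"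
proof -
  let ?k = "CARD('k)"
  let ?q = "(real ?k + real m) / 2"
  let ?c = "real ?k / real m"
  have c: "?c > 0" using m by simp
  define N where "N = (2 * pi * \<sigma>\<^sup>2) powr (real DIM('d) / 2)"
  have N: "N > 0" using \<sigma> by (auto simp: N_def)
  have pyth: "(norm (\<Phi> (z, y)))\<^sup>2 = (norm z)\<^sup>2 + (norm y)\<^sup>2" for z y
    by (simp add: iso norm_Pair)
  define \<Psi> where "\<Psi> = slice_int (mvn_pdf \<sigma>) 0"
  have scal: "slice_int (mvn_pdf \<sigma>) t = ennreal ((1 + ?c * (norm t)\<^sup>2) powr (- ?q)) * \<Psi>" for t
  proof -
    let ?\<mu> = "1 + ?c * (norm t)\<^sup>2"
    have \<mu>: "?\<mu> > 0" using c by (simp add: add_pos_nonneg)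
    \<comment> \<open>With this factor the change of the squared norm,
      \<open>m / k * (rad z)\<^sup>2 * (l\<^sup>2 * ?\<mu> - 1)\<close>, is 0. The factors
      \<open>l ^ m\<close> from the stretch and \<open>l ^ ?k\<close> from \<open>rad\<close> then
      combine to the Student power.\<close>
    define l where "l = ?\<mu> powr (- (1/2))"
    have l: "l > 0" using \<mu> by (simp add: l_def)
    have l2: "l\<^sup>2 * ?\<mu> = 1"
    proof -
      have "l\<^sup>2 = ?\<mu> powr (-1)"
        using \<mu> by (simp add: l_def powr_realpow[symmetric] powr_powr powr_power)
      then show ?thesis using \<mu> by (simp add: powr_minus)
    qed
    have lkm: "l ^ (m + ?k) = ?\<mu> powr (- ?q)"
      using \<mu> by (simp add: l_def powr_power powr_powr add_divide_distrib algebra_simps)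
    have "slice_int (mvn_pdf \<sigma>) t = ennreal (l ^ m) *
       (\<integral>\<^sup>+z. ennreal (rad (S l z) ^ ?k * mvn_pdf \<sigma> (\<Phi> (S l z, rad (S l z) *\<^sub>R t))) \<partial>lborel)"
      unfolding slice_int_def by (rule S_int[OF l]) measurable
    also have "\<dots> = ennreal (l ^ m) *
       (\<integral>\<^sup>+z. ennreal (l ^ ?k) * ennreal (rad z ^ ?k * mvn_pdf \<sigma> (\<Phi> (z, rad z *\<^sub>R 0))) \<partial>lborel)"
    proof (intro arg_cong2[where f = "(*)"] refl nn_integral_cong)
      fix z
      consider "rad z > 0" | "rad z = 0" using rad_cases by blast
      then show "ennreal (rad (S l z) ^ ?k * mvn_pdf \<sigma> (\<Phi> (S l z, rad (S l z) *\<^sub>R t)))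
        = ennreal (l ^ ?k) * ennreal (rad z ^ ?k * mvn_pdf \<sigma> (\<Phi> (z, rad z *\<^sub>R 0)))"
      proof cases
        case 1
        have "(norm (\<Phi> (S l z, rad (S l z) *\<^sub>R t)))\<^sup>2
           = (norm z)\<^sup>2 + real m / real ?k * (l\<^sup>2 - 1) * (rad z)\<^sup>2 + (l * rad z)\<^sup>2 * (norm t)\<^sup>2"
          unfolding pyth S_norm[OF l 1] S_rad[OF l] by (simp add: power_mult_distrib)
        also have "\<dots> = (norm z)\<^sup>2 + real m / real ?k * (rad z)\<^sup>2 * (l\<^sup>2 * ?\<mu> - 1)"
          using m by (simp add: algebra_simps power_mult_distrib)
        also have "\<dots> = (norm (\<Phi> (z, rad z *\<^sub>R 0)))\<^sup>2"
          unfolding l2 pyth by simp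
        finally have "mvn_pdf \<sigma> (\<Phi> (S l z, rad (S l z) *\<^sub>R t)) = mvn_pdf \<sigma> (\<Phi> (z, rad z *\<^sub>R 0))"
          by (simp only: mvn_pdf_def)
        then show ?thesis
          using l by (simp add: S_rad ennreal_mult'[symmetric] power_mult_distrib mult_ac)
      qed (simp add: S_rad l zero_power)
    qed
    also have "\<dots> = ennreal (l ^ m) * (ennreal (l ^ ?k) * \<Psi>)"
      unfolding \<Psi>_def slice_int_def by (subst nn_integral_cmult) auto
    also have "\<dots> = ennreal ((1 + ?c * (norm t)\<^sup>2) powr (- ?q)) * \<Psi>"
      unfolding lkm[symmetric] using l by (simp add: power_add ennreal_mult' mult.assoc)
    finally show ?thesis .
  qed
  \<comment> \<open>The marginal density of \<open>z\<close>. It is even and has total mass 1, so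
    \<open>rad_sym\<close> and a reflection give the mass of \<open>rad z > 0\<close>.\<close>
  define w where "w z = (\<integral>\<^sup>+y. ennreal (mvn_pdf \<sigma> (\<Phi> (z, y))) \<partial>lborel)" for z
  have [measurable]: "w \<in> borel_measurable borel"
    unfolding w_def by measurable
  have w_sym: "w (- z) = w z" for z
  proof -
    have "w (- z) = (\<integral>\<^sup>+y. ennreal (mvn_pdf \<sigma> (\<Phi> (- z, - y))) \<partial>lborel)"
      unfolding w_def
      by (rule nn_integral_isometry[of uminus "\<lambda>y. ennreal (mvn_pdf \<sigma> (\<Phi> (- z, y)))", symmetric])
        (auto simp: linear_uminus)
    also have "\<dots> = w z"
      unfolding w_def by (intro nn_integral_cong) (simp add: mvn_pdf_def pyth)
    finally show ?thesis .
  qed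
  have w_total: "(\<integral>\<^sup>+z. w z \<partial>lborel) = 1"
    unfolding w_def using nn_integral_split[of "\<lambda>x. ennreal (mvn_pdf \<sigma> x)"] nn_integral_mvn_pdf[OF \<sigma>, where 'a = 'd] by simp
  define I where "I = (\<integral>\<^sup>+z. (if rad z > 0 then w z else 0) \<partial>lborel)"
  have I_int: "(\<integral>\<^sup>+t. slice_int (mvn_pdf \<sigma>) t \<partial>lborel) = I"
  proof -
    have "(\<integral>\<^sup>+t. 1 * slice_int (mvn_pdf \<sigma>) t \<partial>lborel)
      = (\<integral>\<^sup>+z. (\<integral>\<^sup>+y. (if rad z > 0 then 1 * ennreal (mvn_pdf \<sigma> (\<Phi> (z, y))) else 0) \<partial>lborel) \<partial>lborel)"
      by (rule nn_integral_slice_int) measurable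
    also have "\<dots> = I"
      unfolding I_def w_def by (rule nn_integral_cong) simp
    finally show ?thesis by simp
  qed
  have I: "I = ennreal (1 / real \<alpha>)"
  proof -
    have "(\<integral>\<^sup>+z. (if rad (- z) > 0 then w z else 0) \<partial>lborel) = (\<integral>\<^sup>+z. (if rad (- z) > 0 then w (- z) else 0) \<partial>lborel)"
      unfolding w_sym ..
    also have "\<dots> = I"
      unfolding I_def by (rule nn_integral_isometry[of uminus "\<lambda>z. if rad z > 0 then w z else 0"])
        (auto simp: linear_uminus)
    finally have "2 * I = (\<integral>\<^sup>+z. (if rad z > 0 then w z else 0) + (if rad (- z) > 0 then w z else 0) \<partial>lborel)"
      by (subst nn_integral_add) (auto simp: I_def mult_2)
    also have "\<dots> = (\<integral>\<^sup>+z. ennreal (2 / real \<alpha>) * w z \<partial>lborel)"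
    proof (rule nn_integral_cong_AE, rule AE_mp[OF rad_sym], rule AE_I2, intro impI)
      fix z assume "(if rad z > 0 then 1 else 0) + (if rad (- z) > 0 then 1 else 0 :: real) = 2 / real \<alpha>"
      then show "(if rad z > 0 then w z else 0) + (if rad (- z) > 0 then w z else 0) = ennreal (2 / real \<alpha>) * w z"
        by (auto simp: mult_2[symmetric] split: if_splits)
    qed
    also have "\<dots> = ennreal (2 / real \<alpha>)"
      by (subst nn_integral_cmult) (auto simp: w_total)
    also have "\<dots> = 2 * ennreal (1 / real \<alpha>)"
      by (simp add: ennreal_mult''[of _ 2, symmetric] ennreal_numeral[symmetric] ennreal_mult'[symmetric] del: ennreal_numeral)
    finally show ?thesis
      by (simp add: ennreal_mult_cancel_left)
  qed
  \<comment> \<open>The integral of the Student-type function over all \<open>t\<close>; comparison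
    with the total mass \<open>1 / \<alpha>\<close> yields \<open>\<Psi>\<close>.\<close>
  define X where "X = (pi / ?c) powr (real ?k / 2) * Gamma (real m / 2) / Gamma ?q"
  have X: "X > 0"
    using m by (auto simp: X_def intro!: mult_pos_pos divide_pos_pos Gamma_real_pos)
  have "ennreal (1 / real \<alpha>) = (\<integral>\<^sup>+(t::real^'k). ennreal ((1 + ?c * (norm t)\<^sup>2) powr (- ?q)) * \<Psi> \<partial>lborel)"
    unfolding I[symmetric] I_int[symmetric] by (rule nn_integral_cong) (rule scal)
  also have "\<dots> = (\<integral>\<^sup>+(t::real^'k). ennreal ((1 + ?c * (norm t)\<^sup>2) powr (- ?q)) \<partial>lborel) * \<Psi>"
    by (subst nn_integral_multc) auto
  also have "(\<integral>\<^sup>+(t::real^'k). ennreal ((1 + ?c * (norm t)\<^sup>2) powr (- ?q)) \<partial>lborel) = ennreal X"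
    by (subst nn_integral_student[OF _ c]) (use m in \<open>auto simp: X_def add_divide_distrib\<close>)
  finally have eq: "ennreal X * \<Psi> = ennreal (1 / real \<alpha>)" by simp
  have "\<Psi> = ennreal (1 / X) * ennreal X * \<Psi>"
    using X by (simp add: ennreal_mult'[symmetric])
  also have "\<dots> = ennreal (slice_const \<alpha> m ?k)"
    unfolding mult.assoc eq using X by (simp add: ennreal_mult'[symmetric] slice_const_def X_def mult_ac)
  finally have "\<Psi> = ennreal (slice_const \<alpha> m ?k)" .
  moreover have "slice_const \<alpha> m ?k > 0"
    using m \<alpha> by (intro slice_const_pos) auto
  ultimately show ?thesis
    by (simp add: scal ennreal_mult'[symmetric] mult.commute)
qed

lemma tail_prob_eq:
  assumes [measurable]: "g \<in> borel_measurable borel" and u: "u > 0"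
    and G: "\<And>t. norm t < u powr (- (real \<alpha> / 2)) \<Longrightarrow> slice_int g t = ennreal (G t) \<and> 0 \<le> G t"
  shows "tail_prob g T u = (LINT t:ball 0 (u powr (- (real \<alpha> / 2)))|lborel. G t)"
proof -
  let ?B = "ball (0::real^'k) (u powr (- (real \<alpha> / 2)))"
  have [measurable]: "(\<lambda>t. indicator ?B t :: ennreal) \<in> borel_measurable borel"
    by (rule borel_measurable_indicator) simp
  have eq: "indicator ?B t * slice_int g t = ennreal (indicator ?B t * G t)" for t
    using G[of t] by (auto simp: indicator_def)
  \<comment> \<open>Measurability is inherited from \<open>slice_int g\<close>, which agrees with
    \<open>G\<close> on the ball; outside the indicator gives 0.\<close>
  have meas: "(\<lambda>t. indicator ?B t * G t) \<in> borel_measurable borel"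
  proof -
    have "(\<lambda>t. enn2real (indicator ?B t * slice_int g t)) \<in> borel_measurable borel"
      by measurable
    moreover have "enn2real (indicator ?B t * slice_int g t) = indicator ?B t * G t" for t
      unfolding eq using G[of t] by (auto simp: indicator_def)
    ultimately show ?thesis by simp
  qed
  have nonneg: "0 \<le> indicator ?B t * G t" for t
    using G[of t] by (cases "t \<in> ?B") auto
  have "(LINT t:?B|lborel. G t) = enn2real (\<integral>\<^sup>+t. ennreal (indicator ?B t * G t) \<partial>lborel)"
    unfolding set_lebesgue_integral_def real_scaleR_def
    by (rule integral_eq_nn_integral) (use meas nonneg in auto)
  then show ?thesis
    unfolding tail_prob_def measure_def emeasure_tail[OF assms(1) u] eq by simp
qed

text \<open>Both tails are integrals over the same ball: of \<open>G\<close>, and of the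
  Student-type function with value \<open>slice_const\<close> at 0. The hypothesis on
  \<open>G 0\<close> is what each setting has to verify about its \<open>K\<close>; it makes the
  leading orders cancel.\<close>

lemma leading_term_slice:
  fixes G :: "real^'k \<Rightarrow> real"
  assumes \<sigma>: "\<sigma> > 0" and g: "g \<in> borel_measurable borel" and K: "K > 0"
    and \<delta>: "\<delta> > 0" and G: "\<And>t. norm t < \<delta> \<Longrightarrow> slice_int g t = ennreal (G t) \<and> 0 \<le> G t"
    and G0: "G 0 = K * slice_const \<alpha> m CARD('k)"
    and diff: "twice_differentiable_near G 0"
  shows "leading_term (relative_error g (mvn_pdf \<sigma>) T K) (const_C3 \<alpha> m CARD('k) K G) \<alpha>"
proof (rule leading_termI)
  let ?k = "CARD('k)"
  let ?C0 = "slice_const \<alpha> m ?k"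
  define \<rho> where "\<rho> u = u powr (- (real \<alpha> / 2))" for u :: real
  define G' where "G' t = ?C0 * (1 + real ?k / real m * (norm t)\<^sup>2) powr (- ((real ?k + real m) / 2))" for t :: "real^'k"
  define P where "P r = (LINT t:ball 0 r|lborel. G t)" for r
  define P0 where "P0 r = (LINT t:ball 0 r|lborel. G' t)" for r
  have C0: "?C0 > 0"
    using m \<alpha> by (intro slice_const_pos) auto
  have C3: "const_C3 \<alpha> m ?k K G = (trace (hessian G 0) / (2 * (real ?k + 2)) +
      K * ?C0 * ((real ?k + real m) / 2) * (real ?k / real m) * real ?k / (real ?k + 2)) / (K * ?C0)"
  proof (rule student_constants[where G = G, OF _ m \<alpha> K _ G0])
    have "Gamma (real m / 2) > 0" "Gamma ((real ?k + real m) / 2) > 0"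
      using m by (auto intro!: Gamma_real_pos)
    then show "real \<alpha> * ?C0 * ((pi / (real ?k / real m)) powr (real ?k / 2) * Gamma (real m / 2) / Gamma ((real ?k + real m) / 2)) = 1"
      using m \<alpha> by (simp add: slice_const_def less_imp_neq[THEN not_sym])
  qed simp
  \<comment> \<open>\<open>P\<close> and \<open>P0\<close> are ball integrals by definition for
    every radius, so the bound on the radius is set to 1. Small radii matter only when they are
    identified with tail probabilities below.\<close>
  have lim: "((\<lambda>r. (P r - K * P0 r) / P r / r\<^sup>2) \<longlongrightarrow> const_C3 \<alpha> m ?k K G) (at_right 0)"
    unfolding C3
    by (rule relative_ball_integral_asymp[OF diff _ K C0 G0 zero_less_one])
      (use m in \<open>auto simp: P_def P0_def G'_def\<close>)
  have \<rho>0: "(\<rho> \<longlongrightarrow> 0) at_top"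
    unfolding \<rho>_def by (rule tendsto_neg_powr) (use \<alpha> in \<open>auto intro: filterlim_ident\<close>)
  have "filterlim \<rho> (at_right 0) at_top"
    unfolding filterlim_at
    using \<rho>0 eventually_gt_at_top[of 0] by (auto simp: \<rho>_def elim!: eventually_mono)
  then have lim': "((\<lambda>u. (P (\<rho> u) - K * P0 (\<rho> u)) / P (\<rho> u) / (\<rho> u)\<^sup>2) \<longlongrightarrow> const_C3 \<alpha> m ?k K G) at_top"
    by (rule filterlim_compose[OF lim])
  have ev: "\<forall>\<^sub>F u in at_top. (P (\<rho> u) - K * P0 (\<rho> u)) / P (\<rho> u) / (\<rho> u)\<^sup>2 = relative_error g (mvn_pdf \<sigma>) T K u * u ^ \<alpha>"
    using order_tendstoD(2)[OF \<rho>0 \<delta>] eventually_gt_at_top[of 0]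
  proof eventually_elim
    case (elim u)
    have t1: "tail_prob g T u = P (\<rho> u)"
      unfolding P_def \<rho>_def using elim
      by (intro tail_prob_eq g G) (auto simp: \<rho>_def)
    have t2: "tail_prob (mvn_pdf \<sigma>) T u = P0 (\<rho> u)"
      unfolding P0_def \<rho>_def using elim C0
      by (intro tail_prob_eq) (auto simp: G'_def slice_int_mvn[OF \<sigma>])
    have t3: "x / (\<rho> u)\<^sup>2 = x * u ^ \<alpha>" for x
    proof -
      have "(\<rho> u)\<^sup>2 * u ^ \<alpha> = u powr (- real \<alpha>) * u powr (real \<alpha>)"
        using elim by (simp add: \<rho>_def powr_power powr_realpow)
      then have "(\<rho> u)\<^sup>2 * u ^ \<alpha> = 1" using elim by (simp add: powr_add[symmetric])
      moreover have "(\<rho> u)\<^sup>2 \<noteq> 0" using calculation by auto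
      ultimately have "u ^ \<alpha> = 1 / (\<rho> u)\<^sup>2" by (simp add: eq_divide_eq mult.commute)
      then show ?thesis by simp
    qed
    show ?case unfolding relative_error_def t1 t2 t3 ..
  qed
  show "((\<lambda>u. relative_error g (mvn_pdf \<sigma>) T K u * u ^ \<alpha>) \<longlongrightarrow> const_C3 \<alpha> m ?k K G) at_top"
    using lim' unfolding tendsto_cong[OF ev] .
qed

end

section \<open>One-sample statistic\<close>

text \<open>The relation between \<open>K\<close> and \<open>G 0\<close> with the integral factored
  out: for one sample and, once \<open>two_M\<close> has cancelled, for two. For
  \<open>m = 1\<close> the constant contains \<open>Gamma (1 / 2)\<close>, which is the square root
  of pi.\<close>

lemma slice_const_2_1:
  assumes "k > 0"
  shows "(2 * pi powr ((real k + 1) / 2) / Gamma ((real k + 1) / 2)) * slice_const 2 1 k = real k powr (real k / 2)"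
proof -
  have G: "Gamma ((real k + 1) / 2) > 0" by (intro Gamma_real_pos) simp
  have "pi powr ((real k + 1) / 2) = pi powr (real k / 2) * sqrt pi"
    by (simp add: add_divide_distrib powr_add powr_half_sqrt)
  moreover have "(pi / real k) powr (real k / 2) = pi powr (real k / 2) / real k powr (real k / 2)"
    by (rule powr_divide)
  ultimately show ?thesis
    using assms less_imp_neq[OF G] by (simp add: slice_const_def Gamma_one_half_real)
qed

text \<open>The counterpart for the F-statistic: its prefactor is the reciprocal of
  \<open>slice_const\<close> up to a power of \<open>k\<close>.\<close>

lemma slice_const_1:
  assumes "k > 0" "m > 0"
  shows "(Gamma (real m / 2) * (pi * real m) powr (real k / 2) / Gamma ((real k + real m) / 2)) * slice_const 1 m k
    = real k powr (real k / 2)"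
proof -
  have G: "Gamma ((real k + real m) / 2) > 0" "Gamma (real m / 2) > 0"
    using assms by (auto intro!: Gamma_real_pos)
  have "pi / (real k / real m) = (pi * real m) / real k" by simp
  then have "(pi / (real k / real m)) powr (real k / 2) = (pi * real m) powr (real k / 2) / real k powr (real k / 2)"
    by (simp only: powr_divide)
  moreover have "(pi * real m) powr (real k / 2) \<noteq> 0" using assms by simp
  ultimately show ?thesis
    using assms less_imp_neq[OF G(1)] less_imp_neq[OF G(2)] by (simp add: slice_const_def del: powr_mult)
qed

lemma sqrt_power_powr: "real k powr (real k / 2) = sqrt (real k) ^ k" if "k > 0"
  using that by (simp add: powr_half_sqrt[symmetric] powr_power)

section \<open>Padding, sample mean and sample variance relative to the diagonal direction\<close>

lemma linear_pad: "linear pad"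
  by (rule linearI) (auto simp: pad_def vec_eq_iff split: option.split)

lemma sum_option: "(\<Sum>i\<in>UNIV. f i) = f None + (\<Sum>i\<in>UNIV. f (Some i))" for f :: "'k::finite option \<Rightarrow> real"
  by (simp add: UNIV_option_conv sum.reindex)

lemma norm_pad: "norm (pad t) = norm t"
  by (simp add: norm_vec_def L2_set_def sum_option pad_def)

lemma inner_pad: "pad t \<bullet> axis None 1 = 0"
  by (simp add: inner_axis pad_def)

lemma norm_diag_vec: "norm (diag_vec :: real^'n) = 1"
  by (simp add: diag_vec_def norm_vec_def L2_set_def power_divide)

lemma inner_diag_vec: "x \<bullet> diag_vec = sqrt (real CARD('n)) * sample_mean (x :: real^'n)"
  by (simp add: inner_vec_def diag_vec_def sample_mean_def sum_divide_distrib[symmetric] real_div_sqrt field_simps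
      real_sqrt_mult[symmetric])

text \<open>Pythagoras: the deviations from the mean form the component of \<open>x\<close>
  orthogonal to \<open>diag_vec\<close>.\<close>

lemma sample_var_eq: "sample_var x = ((norm x)\<^sup>2 - (x \<bullet> diag_vec)\<^sup>2) / (real CARD('n) - 1)" for x :: "real^'n"
proof -
  let ?\<mu> = "sample_mean x"
  have s: "(\<Sum>i\<in>UNIV. x $ i) = real CARD('n) * ?\<mu>" by (simp add: sample_mean_def)
  have "(\<Sum>i\<in>UNIV. (x $ i - ?\<mu>)\<^sup>2) = (\<Sum>i\<in>UNIV. (x $ i)\<^sup>2 + ?\<mu>\<^sup>2 - 2 * ?\<mu> * x $ i)"
    by (intro sum.cong refl) (simp add: power2_diff)
  also have "\<dots> = (norm x)\<^sup>2 + real CARD('n) * ?\<mu>\<^sup>2 - 2 * ?\<mu> * (\<Sum>i\<in>UNIV. x $ i)"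
    unfolding power2_norm_eq_inner inner_vec_def
    by (simp add: sum.distrib sum_subtractf sum_distrib_left power2_eq_square)
  also have "\<dots> = (norm x)\<^sup>2 - (x \<bullet> diag_vec)\<^sup>2"
    unfolding s inner_diag_vec by (simp add: power_mult_distrib power2_eq_square)
  finally show ?thesis by (simp add: sample_var_def)
qed

lemma sample_mean_measurable [measurable]: "sample_mean \<in> borel_measurable (borel :: (real^'n) measure)"
  unfolding sample_mean_def by measurable

lemma sample_var_measurable [measurable]: "sample_var \<in> borel_measurable (borel :: (real^'n) measure)"
  unfolding sample_var_def by measurable

lemma sample_sd_measurable [measurable]: "sample_sd \<in> borel_measurable (borel :: (real^'n) measure)"
  unfolding sample_sd_def by measurable

lemma sample_var_nonneg: "0 \<le> sample_var (x :: real^'n)"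
proof -
  have "1 \<le> CARD('n)" by (simp add: Suc_leI)
  then show ?thesis by (auto simp: sample_var_def intro!: divide_nonneg_nonneg sum_nonneg)
qed

lemma norm_sq_orthogonal_sum:
  fixes e x :: "'a::real_inner"
  assumes "norm e = 1" "x \<bullet> e = 0"
  shows "(norm (r *\<^sub>R e + x))\<^sup>2 = r\<^sup>2 + (norm x)\<^sup>2"
  using assms unfolding power2_norm_eq_inner
  by (simp add: inner_add_left inner_add_right inner_commute norm_eq_1 power2_eq_square)

lemma nn_integral_eq_integral':
  assumes "f \<in> borel_measurable M" "\<And>x. 0 \<le> f x" "(\<integral>\<^sup>+x. ennreal (f x) \<partial>M) < \<infinity>"
  shows "(\<integral>\<^sup>+x. ennreal (f x) \<partial>M) = ennreal (integral\<^sup>L M f)"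
  using assms by (intro nn_integral_eq_integral integrableI_nonneg) auto

text \<open>Finiteness gives integrability on the product space. The inner integral may still
  diverge on a null set of \<open>x\<close>, where the Bochner integral takes its default 0; Fubini
  on the product absorbs this.\<close>

lemma nn_integral_eq_iterated_integral:
  fixes f :: "'a::euclidean_space \<Rightarrow> 'b::euclidean_space \<Rightarrow> real"
  assumes [measurable]: "(\<lambda>p. f (fst p) (snd p)) \<in> borel_measurable (lborel \<Otimes>\<^sub>M lborel)"
    and nonneg: "\<And>x y. 0 \<le> f x y" and fin: "(\<integral>\<^sup>+x. (\<integral>\<^sup>+y. ennreal (f x y) \<partial>lborel) \<partial>lborel) < \<infinity>"
  shows "(\<integral>\<^sup>+x. (\<integral>\<^sup>+y. ennreal (f x y) \<partial>lborel) \<partial>lborel) = ennreal (LINT x|lborel. (LINT y|lborel. f x y))"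
proof -
  have eq: "(\<integral>\<^sup>+x. (\<integral>\<^sup>+y. ennreal (f x y) \<partial>lborel) \<partial>lborel)
     = (\<integral>\<^sup>+p. ennreal (f (fst p) (snd p)) \<partial>(lborel \<Otimes>\<^sub>M lborel))"
    by (subst lborel.nn_integral_fst[symmetric]) auto
  have int: "integrable (lborel \<Otimes>\<^sub>M lborel) (\<lambda>p. f (fst p) (snd p))"
    by (rule integrableI_nonneg) (use fin nonneg in \<open>auto simp: eq\<close>)
  have "(LINT x|lborel. (LINT y|lborel. f x y)) = (LINT p|(lborel \<Otimes>\<^sub>M lborel). f (fst p) (snd p))"
    using lborel_pair.integral_fst'[OF int] by simp
  then show ?thesis
    unfolding eq using nn_integral_eq_integral[OF int] nonneg by simp
qed

lemma continuous_pdfD: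
  assumes "continuous_pdf g"
  shows "g \<in> borel_measurable borel" "0 \<le> g x"
  using assms by (auto simp: continuous_pdf_def borel_measurable_continuous_onI)

text \<open>Serves both t-statistics, which have the shape \<open>x * c / norm y\<close>. For
  \<open>x \<le> 0\<close> both sides are false: the quotient is at most 0, and \<open>max\<close>
  makes the radius 0.\<close>

lemma T_iff_aux:
  assumes "u > 0" "c > 0" "v > 0"
  shows "x * c / v > u \<longleftrightarrow> v < c * max 0 x * u powr (- (real 2 / 2))"
proof (cases "x > 0")
  case True
  have "x * c / v > u \<longleftrightarrow> u * v < x * c" using assms by (simp add: pos_less_divide_eq)
  also have "\<dots> \<longleftrightarrow> v < c * max 0 x * u powr (- (real 2 / 2))"
    using assms True by (simp add: powr_minus field_simps)
  finally show ?thesis .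
next
  case False
  then have "x * c / v \<le> 0" using assms by (simp add: divide_le_0_iff mult_le_0_iff)
  then show ?thesis using False assms by (auto simp: max_def)
qed

context
  fixes A :: "real^('k::finite option) \<Rightarrow> real^('k option)"
  assumes A: "orthogonal_transformation A" "A (axis None 1) = diag_vec"
begin

lemma inner_A_pad: "A (pad y) \<bullet> diag_vec = 0"
  using A inner_pad[of y] by (metis orthogonal_transformation_def)

lemma norm_A_pad: "norm (A (pad y)) = norm y"
  using A norm_pad by (metis orthogonal_transformation_norm)

lemma linear_A_pad: "linear (\<lambda>y. A (pad y))"
  using linear_compose[OF linear_pad orthogonal_transformation_linear[OF A(1)]] by (simp add: o_def)

lemma A_pad_scaleR: "A (pad (c *\<^sub>R y)) = c *\<^sub>R A (pad y)"
  by (rule linear_scale[OF linear_A_pad])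

lemma A_pad_orthogonal_comp: "c *\<^sub>R A (pad y) \<in> (span {diag_vec})\<^sup>\<bottom>"
  using inner_A_pad by (auto simp: orthogonal_comp_def orthogonal_def span_singleton inner_commute)

lemma sample_var_diag_sum: "sample_var (r *\<^sub>R diag_vec + A (pad y)) = (norm y)\<^sup>2 / real CARD('k)"
proof -
  have "(r *\<^sub>R diag_vec + A (pad y)) \<bullet> diag_vec = r"
    by (simp add: inner_add_left inner_A_pad power2_norm_eq_inner[symmetric] norm_diag_vec)
  then show ?thesis
    by (simp add: sample_var_eq norm_sq_orthogonal_sum[OF norm_diag_vec inner_A_pad] norm_A_pad)
qed

text \<open>The mean sees only the coordinate \<open>z\<close> along \<open>diag_vec\<close>, the
  sample variance only the orthogonal part \<open>y\<close>, so \<open>one_T\<close> is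
  \<open>sqrt k * z / norm y\<close> with \<open>k = CARD('k)\<close>. Stretching the single
  coordinate \<open>z\<close> gives \<open>m = 1\<close>.\<close>

lemma slice_one:
  "slice (\<lambda>(r, y). r *\<^sub>R diag_vec + A (pad y)) (\<lambda>r::real. sqrt (real CARD('k)) * max 0 r) one_T 1 2 (\<lambda>l z. l * z)"
proof (rule slice.intro)
  show "linear (\<lambda>(r, y). r *\<^sub>R diag_vec + A (pad y))"
    by (rule linearI) (auto simp: linear_add[OF linear_A_pad] linear_scale[OF linear_A_pad] algebra_simps)
  show "norm (case p of (r, y) \<Rightarrow> r *\<^sub>R diag_vec + A (pad y)) = norm p" for p :: "real \<times> (real^'k)"
  proof (cases p)
    case (Pair r y)
    have "(norm (r *\<^sub>R diag_vec + A (pad y)))\<^sup>2 = (norm (r, y))\<^sup>2"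
      by (simp add: norm_sq_orthogonal_sum[OF norm_diag_vec inner_A_pad] norm_A_pad norm_Pair)
    then show ?thesis using Pair by simp
  qed
  show "one_T \<in> borel_measurable (borel :: (real^'k option) measure)"
    unfolding one_T_def by measurable
  show "one_T (case (z, y) of (r, y) \<Rightarrow> r *\<^sub>R diag_vec + A (pad y)) > u \<longleftrightarrow>
      norm y < sqrt (real CARD('k)) * max 0 z * u powr (- (real 2 / 2))"
    if "u > 0" "y \<noteq> 0" for u z and y :: "real^'k"
  proof -
    let ?x = "z *\<^sub>R diag_vec + A (pad y)"
    have "sqrt (real CARD('k option)) * sample_mean ?x = z"
      unfolding inner_diag_vec[symmetric]
      by (simp add: inner_add_left inner_A_pad power2_norm_eq_inner[symmetric] norm_diag_vec)
    moreover have "sample_sd ?x = norm y / sqrt (real CARD('k))"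
      by (simp add: sample_sd_def sample_var_diag_sum real_sqrt_divide)
    ultimately have "one_T ?x = z * sqrt (real CARD('k)) / norm y"
      unfolding one_T_def by simp
    then show ?thesis using T_iff_aux[of u "sqrt (real CARD('k))" "norm y" z] that by simp
  qed
  \<comment> \<open>Exactly one of \<open>z\<close> and \<open>- z\<close> is positive unless
    \<open>z = 0\<close>.\<close>
  show "AE z in lborel. (if sqrt (real CARD('k)) * max 0 z > 0 then 1 else 0) +
      (if sqrt (real CARD('k)) * max 0 (- z) > 0 then 1 else 0 :: real) = 2 / real 2"
    by (rule AE_mp[OF AE_lborel_singleton[of 0]], rule AE_I2) (auto simp: max_def zero_less_mult_iff)
  \<comment> \<open>Positivity of \<open>rad\<close> means \<open>z > 0\<close>, so that
    \<open>max 0 z\<close> is \<open>z\<close>; for negative \<open>z\<close> the left side would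
    change with \<open>l\<close> and the right side would not.\<close>
  show "(norm (l * z))\<^sup>2 = (norm z)\<^sup>2 + real 1 / real CARD('k) * (l\<^sup>2 - 1) * (sqrt (real CARD('k)) * max 0 z)\<^sup>2"
    if "0 < l" "0 < sqrt (real CARD('k)) * max 0 z" for l z :: real
    using that by (simp add: zero_less_mult_iff less_max_iff_disj power_mult_distrib algebra_simps)
  show "(\<integral>\<^sup>+z. f z \<partial>lborel) = ennreal (l ^ 1) * (\<integral>\<^sup>+z. f (l * z) \<partial>lborel)"
    if "0 < l" "f \<in> borel_measurable borel" for f :: "real \<Rightarrow> ennreal" and l
    using nn_integral_real_affine[of f l 0] that by simp
  show "sqrt (real CARD('k)) * max 0 (l * z) = l * (sqrt (real CARD('k)) * max 0 z)" if "0 < l" for l z :: real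
    using that by (simp add: max_mult_distrib_left mult.left_commute)
qed auto

lemma leading_term_one:
  assumes \<sigma>: "\<sigma> > 0" and g: "continuous_pdf g" and int: "one_integrability g" and K: "one_K g > 0"
    and diff: "twice_differentiable_near (one_G A g) 0"
  shows "leading_term (relative_error g (mvn_pdf \<sigma>) one_T (one_K g)) (const_C3 2 1 CARD('k) (one_K g) (one_G A g)) 2"
proof -
  let ?k = "CARD('k)"
  let ?c = "sqrt (real ?k)"
  interpret slice "\<lambda>(r, y). r *\<^sub>R diag_vec + A (pad y)" "\<lambda>r::real. ?c * max 0 r" one_T 1 2 "\<lambda>l z. l * z"
    by (rule slice_one)
  note [measurable] = continuous_pdfD(1)[OF g]
  have [measurable]: "A \<in> borel_measurable borel"
    using orthogonal_transformation_linear[OF A(1)] by (rule borel_measurable_linear)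
  define F where "F t r = indicator {0..} r * (r ^ ?k * g (r *\<^sub>R (diag_vec + A (?c *\<^sub>R pad t))))" for t r
  have F_nonneg: "F t r \<ge> 0" for t r
    using continuous_pdfD(2)[OF g] by (auto simp: F_def indicator_def)
  have F_meas [measurable]: "F t \<in> borel_measurable borel" for t
    unfolding F_def by measurable
  have G_eq: "one_G A g t = ?c ^ ?k * (LINT r|lborel. F t r)" for t
    unfolding one_G_def set_lebesgue_integral_def F_def
    by (simp add: Let_def sqrt_power_powr)
  have slice_eq: "slice_int g t = ennreal (?c ^ ?k) * (\<integral>\<^sup>+r. ennreal (F t r) \<partial>lborel)" for t
  proof -
    have "slice_int g t = (\<integral>\<^sup>+r. ennreal (?c ^ ?k) * ennreal (F t r) \<partial>lborel)"
      unfolding slice_int_def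
    proof (rule nn_integral_cong)
      fix r :: real
      show "ennreal ((?c * max 0 r) ^ ?k * g (case (r, (?c * max 0 r) *\<^sub>R t) of (r, y) \<Rightarrow> r *\<^sub>R diag_vec + A (pad y)))
        = ennreal (?c ^ ?k) * ennreal (F t r)"
      proof (cases "r \<ge> 0")
        case True
        have "r *\<^sub>R diag_vec + A (pad ((?c * r) *\<^sub>R t)) = r *\<^sub>R (diag_vec + A (?c *\<^sub>R pad t))"
          using linear_scale[OF linear_pad, of ?c t, symmetric]
          by (simp add: A_pad_scaleR scaleR_add_right mult.commute)
        then show ?thesis
          using True by (simp add: F_def ennreal_mult'[symmetric] power_mult_distrib mult.assoc)
      next
        case False
        then show ?thesis by (simp add: F_def zero_power)
      qed
    qed
    then show ?thesis by (simp add: nn_integral_cmult)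
  qed
  obtain \<epsilon> where \<epsilon>: "\<epsilon> > 0" and fin: "(\<integral>\<^sup>+ r\<in>{0..}. ennreal (r ^ ?k) *
        (SUP \<xi>\<in>{\<xi>. norm \<xi> < \<epsilon> \<and> \<xi> \<in> (span {diag_vec :: real^'k option})\<^sup>\<bottom>}. ennreal (g (r *\<^sub>R (diag_vec + \<xi>))))
        \<partial>lborel) < \<infinity>"
    using int unfolding one_integrability_def by auto
  \<comment> \<open>The displacement \<open>?c *\<^sub>R A (pad t)\<close> has norm
    \<open>?c * norm t\<close>, whence the radius \<open>\<epsilon> / ?c\<close>; it is then one of
    the \<open>\<xi>\<close> under the supremum.\<close>
  have F_fin: "(\<integral>\<^sup>+r. ennreal (F t r) \<partial>lborel) < \<infinity>" if "norm t < \<epsilon> / ?c" for t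
  proof -
    have "norm (A (?c *\<^sub>R pad t)) < \<epsilon>"
      using that norm_A_pad[of t] linear_scale[OF orthogonal_transformation_linear[OF A(1)], of ?c "pad t"]
      by (simp add: pos_less_divide_eq mult.commute)
    moreover have "A (?c *\<^sub>R pad t) \<in> (span {diag_vec})\<^sup>\<bottom>"
      using A_pad_orthogonal_comp[of ?c t] linear_scale[OF orthogonal_transformation_linear[OF A(1)], of ?c "pad t"] by simp
    ultimately have "(\<integral>\<^sup>+r. ennreal (F t r) \<partial>lborel) \<le> (\<integral>\<^sup>+ r\<in>{0..}. ennreal (r ^ ?k) *
        (SUP \<xi>\<in>{\<xi>. norm \<xi> < \<epsilon> \<and> \<xi> \<in> (span {diag_vec :: real^'k option})\<^sup>\<bottom>}. ennreal (g (r *\<^sub>R (diag_vec + \<xi>))))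
        \<partial>lborel)"
      by (intro nn_integral_mono)
        (auto simp: F_def indicator_def ennreal_mult' intro!: mult_left_mono SUP_upper2[of "A (?c *\<^sub>R pad t)"])
    then show ?thesis using fin by (rule le_less_trans)
  qed
  show ?thesis
  proof (rule leading_term_slice[OF \<sigma> continuous_pdfD(1)[OF g] K _ _ _ diff])
    show "\<epsilon> / ?c > 0" using \<epsilon> by simp
    show "slice_int g t = ennreal (one_G A g t) \<and> 0 \<le> one_G A g t" if "norm t < \<epsilon> / ?c" for t
      using nn_integral_eq_integral'[OF _ F_nonneg F_fin[OF that]] F_nonneg[of t]
      by (simp add: slice_eq G_eq ennreal_mult' integral_nonneg)
    have "one_K g = 2 * pi powr ((real ?k + 1) / 2) / Gamma ((real ?k + 1) / 2) * (LINT r|lborel. F 0 r)"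
      by (simp add: linear_0[OF orthogonal_transformation_linear[OF A(1)]] linear_0[OF linear_pad] one_K_def set_lebesgue_integral_def F_def add.commute)
    then have "one_K g * slice_const 2 1 ?k
      = (2 * pi powr ((real ?k + 1) / 2) / Gamma ((real ?k + 1) / 2) * slice_const 2 1 ?k) * (LINT r|lborel. F 0 r)"
      by simp
    then have "one_K g * slice_const 2 1 ?k = ?c ^ ?k * (LINT r|lborel. F 0 r)"
      unfolding slice_const_2_1[OF zero_less_card_finite] by (simp add: sqrt_power_powr)
    then show "one_G A g 0 = one_K g * slice_const 2 1 ?k" by (simp add: G_eq)
  qed
qed

end

section \<open>Two-sample statistic\<close>

text \<open>The substitution \<open>y = tan \<omega>\<close>, proved by identifying a measure: the
  image under \<open>tan\<close> of the density \<open>1 / (cos \<omega>)\<^sup>2\<close> agrees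
  with Lebesgue measure on intervals by the fundamental theorem of calculus.\<close>

lemma nn_integral_tan:
  assumes [measurable]: "F \<in> borel_measurable borel"
  shows "(\<integral>\<^sup>+\<omega>. indicator {-pi/2<..<pi/2} \<omega> * ennreal (inverse ((cos \<omega>)\<^sup>2)) * F (tan \<omega>) \<partial>lborel) = (\<integral>\<^sup>+y. F y \<partial>lborel)"
proof -
  have [measurable]: "tan \<in> borel_measurable (borel :: real measure)"
    unfolding tan_def[abs_def] by measurable
  define D where "D = density lborel (\<lambda>\<omega>. indicator {-pi/2<..<pi/2} \<omega> * ennreal (inverse ((cos \<omega>)\<^sup>2)))"
  have [measurable_cong]: "sets D = sets borel" by (simp add: D_def)
  have "lborel = distr D borel tan"
  proof (rule lborel_eqI)
    fix l u :: real assume "\<And>b. b \<in> Basis \<Longrightarrow> l \<bullet> b \<le> u \<bullet> b"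
    then have lu: "l \<le> u" by simp
    have "emeasure (distr D borel tan) (box l u) = emeasure D (tan -` box l u)"
      by (subst emeasure_distr) (auto simp: D_def)
    also have "\<dots> = (\<integral>\<^sup>+\<omega>. indicator {-pi/2<..<pi/2} \<omega> * ennreal (inverse ((cos \<omega>)\<^sup>2)) * indicator (tan -` box l u) \<omega> \<partial>lborel)"
      unfolding D_def
      by (subst emeasure_density) (auto intro: measurable_sets_borel[of tan borel])
    also have "\<dots> = (\<integral>\<^sup>+\<omega>. ennreal (inverse ((cos \<omega>)\<^sup>2)) * indicator {arctan l..arctan u} \<omega> \<partial>lborel)"
    \<comment> \<open>\<open>box l u\<close> is open and corresponds to an open interval; its
      endpoints are discarded to reach the closed interval of the fundamental theorem.\<close>
    proof (rule nn_integral_cong_AE, rule AE_mp[OF AE_lborel_singleton[of "arctan l"]],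
        rule AE_mp[OF AE_lborel_singleton[of "arctan u"]], rule AE_I2, intro impI)
      fix \<omega> assume ne: "\<omega> \<noteq> arctan l" "\<omega> \<noteq> arctan u"
      have "\<omega> \<in> {-pi/2<..<pi/2} \<and> tan \<omega> \<in> box l u \<longleftrightarrow> \<omega> \<in> {arctan l..arctan u}"
      proof (cases "\<omega> \<in> {-pi/2<..<pi/2}")
        case True
        then have "arctan (tan \<omega>) = \<omega>" by (intro arctan_tan) auto
        then have "l < tan \<omega> \<longleftrightarrow> arctan l < \<omega>" "tan \<omega> < u \<longleftrightarrow> \<omega> < arctan u"
          using arctan_less_iff by metis+
        then show ?thesis using True ne by auto
      next
        case False
        then show ?thesis
          using arctan_lbound[of l] arctan_ubound[of u] by auto
      qed
      then show "indicator {-pi/2<..<pi/2} \<omega> * ennreal (inverse ((cos \<omega>)\<^sup>2)) * indicator (tan -` box l u) \<omega>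
        = ennreal (inverse ((cos \<omega>)\<^sup>2)) * indicator {arctan l..arctan u} \<omega>"
        by (auto simp: indicator_def)
    qed
    also have "\<dots> = ennreal (tan (arctan u) - tan (arctan l))"
    proof (rule nn_integral_FTC_Icc)
      fix \<omega> assume "\<omega> \<in> {arctan l..arctan u}"
      then have "cos \<omega> \<noteq> 0"
        using arctan_lbound[of l] arctan_ubound[of u] by (intro less_imp_neq[THEN not_sym] cos_gt_zero_pi) auto
      then show "DERIV tan \<omega> :> inverse ((cos \<omega>)\<^sup>2)" by (rule DERIV_tan)
    qed (use lu in \<open>auto simp: arctan_le_iff\<close>)
    finally show "emeasure (distr D borel tan) (box l u) = ennreal (\<Prod>b\<in>Basis. (u - l) \<bullet> b)"
      by (simp add: tan_arctan)
  qed simp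
  then have "(\<integral>\<^sup>+y. F y \<partial>lborel) = (\<integral>\<^sup>+y. F y \<partial>distr D borel tan)" by simp
  also have "\<dots> = (\<integral>\<^sup>+\<omega>. F (tan \<omega>) \<partial>D)"
    by (subst nn_integral_distr) auto
  also have "\<dots> = (\<integral>\<^sup>+\<omega>. indicator {-pi/2<..<pi/2} \<omega> * ennreal (inverse ((cos \<omega>)\<^sup>2)) * F (tan \<omega>) \<partial>lborel)"
    unfolding D_def by (subst nn_integral_density) auto
  finally show ?thesis ..
qed

text \<open>Polar coordinates from one-dimensional substitutions:
  \<open>w = x * tan \<omega>\<close> for fixed \<open>x > 0\<close>, an exchange of integrals, then
  \<open>x = r * cos \<omega>\<close> for fixed \<open>\<omega>\<close>.\<close>

lemma nn_integral_polar_halfplane: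
  fixes F :: "real \<times> real \<Rightarrow> ennreal"
  assumes [measurable]: "F \<in> borel_measurable borel"
  shows "(\<integral>\<^sup>+z. (if fst z > 0 then F z else 0) \<partial>lborel)
    = (\<integral>\<^sup>+\<omega>. indicator {-pi/2..pi/2} \<omega> * (\<integral>\<^sup>+r. indicator {0..} r * (ennreal r * F (r * cos \<omega>, r * sin \<omega>)) \<partial>lborel) \<partial>lborel)"
proof -
  have [measurable]: "F \<in> borel \<Otimes>\<^sub>M borel \<rightarrow>\<^sub>M borel"
    using assms by (simp add: borel_prod)
  have [measurable]: "tan \<in> borel_measurable (borel :: real measure)"
    unfolding tan_def[abs_def] by measurable
  let ?J = "{-pi/2<..<pi/2}"
  have "(\<integral>\<^sup>+z. (if fst z > 0 then F z else 0) \<partial>lborel) = (\<integral>\<^sup>+x. (\<integral>\<^sup>+w. (if x > 0 then F (x, w) else 0) \<partial>lborel) \<partial>lborel)"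
    unfolding lborel_prod[symmetric] by (subst lborel.nn_integral_fst[symmetric]) auto
  also have "\<dots> = (\<integral>\<^sup>+x. (\<integral>\<^sup>+\<omega>. (if x > 0 then ennreal x * (indicator ?J \<omega> * ennreal (inverse ((cos \<omega>)\<^sup>2)) * F (x, x * tan \<omega>)) else 0) \<partial>lborel) \<partial>lborel)"
  proof (rule nn_integral_cong)
    fix x :: real
    show "(\<integral>\<^sup>+w. (if x > 0 then F (x, w) else 0) \<partial>lborel)
      = (\<integral>\<^sup>+\<omega>. (if x > 0 then ennreal x * (indicator ?J \<omega> * ennreal (inverse ((cos \<omega>)\<^sup>2)) * F (x, x * tan \<omega>)) else 0) \<partial>lborel)"
    proof (cases "x > 0")
      case True
      have "(\<integral>\<^sup>+w. F (x, w) \<partial>lborel) = ennreal x * (\<integral>\<^sup>+w. F (x, 0 + x * w) \<partial>lborel)"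
        using True by (subst nn_integral_real_affine[of _ x 0]) auto
      also have "(\<integral>\<^sup>+w. F (x, 0 + x * w) \<partial>lborel)
        = (\<integral>\<^sup>+\<omega>. indicator ?J \<omega> * ennreal (inverse ((cos \<omega>)\<^sup>2)) * F (x, x * tan \<omega>) \<partial>lborel)"
        using nn_integral_tan[of "\<lambda>w. F (x, x * w)"] by simp
      also have "ennreal x * \<dots> = (\<integral>\<^sup>+\<omega>. ennreal x * (indicator ?J \<omega> * ennreal (inverse ((cos \<omega>)\<^sup>2)) * F (x, x * tan \<omega>)) \<partial>lborel)"
        by (rule nn_integral_cmult[symmetric]) measurable
      finally show ?thesis using True by simp
    qed simp
  qed
  also have "\<dots> = (\<integral>\<^sup>+\<omega>. (\<integral>\<^sup>+x. (if x > 0 then ennreal x * (indicator ?J \<omega> * ennreal (inverse ((cos \<omega>)\<^sup>2)) * F (x, x * tan \<omega>)) else 0) \<partial>lborel) \<partial>lborel)"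
    by (rule lborel_pair.Fubini') measurable
  also have "\<dots> = (\<integral>\<^sup>+\<omega>. indicator {-pi/2..pi/2} \<omega> * (\<integral>\<^sup>+r. indicator {0..} r * (ennreal r * F (r * cos \<omega>, r * sin \<omega>)) \<partial>lborel) \<partial>lborel)"
  \<comment> \<open>At the two endpoints \<open>cos \<omega> = 0\<close> and the second substitution
    degenerates.\<close>
  proof (rule nn_integral_cong_AE, rule AE_mp[OF AE_lborel_singleton[of "-pi/2"]],
      rule AE_mp[OF AE_lborel_singleton[of "pi/2"]], rule AE_I2, intro impI)
    fix \<omega> :: real assume ne: "\<omega> \<noteq> - pi/2" "\<omega> \<noteq> pi/2"
    show "(\<integral>\<^sup>+x. (if x > 0 then ennreal x * (indicator ?J \<omega> * ennreal (inverse ((cos \<omega>)\<^sup>2)) * F (x, x * tan \<omega>)) else 0) \<partial>lborel)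
      = indicator {-pi/2..pi/2} \<omega> * (\<integral>\<^sup>+r. indicator {0..} r * (ennreal r * F (r * cos \<omega>, r * sin \<omega>)) \<partial>lborel)"
    proof (cases "\<omega> \<in> ?J")
      case True
      then have c: "cos \<omega> > 0" by (intro cos_gt_zero_pi) auto
      have "(\<integral>\<^sup>+x. (if x > 0 then ennreal x * (indicator ?J \<omega> * ennreal (inverse ((cos \<omega>)\<^sup>2)) * F (x, x * tan \<omega>)) else 0) \<partial>lborel)
        = ennreal (cos \<omega>) * (\<integral>\<^sup>+r. (if 0 + cos \<omega> * r > 0 then ennreal (0 + cos \<omega> * r) * (indicator ?J \<omega> * ennreal (inverse ((cos \<omega>)\<^sup>2)) * F (0 + cos \<omega> * r, (0 + cos \<omega> * r) * tan \<omega>)) else 0) \<partial>lborel)"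
        using c by (subst nn_integral_real_affine[of _ "cos \<omega>" 0]) auto
      also have "\<dots> = (\<integral>\<^sup>+r. ennreal (cos \<omega>) * (if 0 + cos \<omega> * r > 0 then ennreal (0 + cos \<omega> * r) * (indicator ?J \<omega> * ennreal (inverse ((cos \<omega>)\<^sup>2)) * F (0 + cos \<omega> * r, (0 + cos \<omega> * r) * tan \<omega>)) else 0) \<partial>lborel)"
        by (rule nn_integral_cmult[symmetric]) measurable
      also have "\<dots> = (\<integral>\<^sup>+r. indicator {0..} r * (ennreal r * F (r * cos \<omega>, r * sin \<omega>)) \<partial>lborel)"
      proof (rule nn_integral_cong)
        fix r :: real
        show "ennreal (cos \<omega>) * (if 0 + cos \<omega> * r > 0 then ennreal (0 + cos \<omega> * r) * (indicator ?J \<omega> * ennreal (inverse ((cos \<omega>)\<^sup>2)) * F (0 + cos \<omega> * r, (0 + cos \<omega> * r) * tan \<omega>)) else 0)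
          = indicator {0..} r * (ennreal r * F (r * cos \<omega>, r * sin \<omega>))"
        proof (cases "r > 0")
          case r: True
          \<comment> \<open>The Jacobians \<open>cos \<omega>\<close>,
            \<open>x = r * cos \<omega>\<close> and \<open>1 / (cos \<omega>)\<^sup>2\<close>
            multiply to \<open>r\<close>.\<close>
          have "ennreal (cos \<omega>) * (ennreal (cos \<omega> * r) * ennreal (inverse ((cos \<omega>)\<^sup>2))) = ennreal r"
            using c r by (simp add: ennreal_mult'[symmetric] power2_eq_square field_simps)
          moreover have "F (0 + cos \<omega> * r, (0 + cos \<omega> * r) * tan \<omega>) = F (r * cos \<omega>, r * sin \<omega>)"
            using c by (simp add: tan_def mult.commute)
          ultimately show ?thesis
            using True r c by (simp add: mult.assoc[symmetric] del: times_divide_eq_right)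
        next
          case False
          then consider "r < 0" | "r = 0" by linarith
          then show ?thesis using c by cases (auto simp: zero_less_mult_iff)
        qed
      qed
      finally show ?thesis using True by simp
    next
      case False
      then have "\<omega> \<notin> {-pi/2..pi/2}" using ne by auto
      then show ?thesis using False by (simp cong: if_cong)
    qed
  qed
  finally show ?thesis .
qed

section \<open>Geometry of two pooled samples\<close>

lemma sum_Plus_type: "(\<Sum>i\<in>UNIV. f i) = (\<Sum>i\<in>UNIV. f (Inl i)) + (\<Sum>j\<in>UNIV. f (Inr j))"
  for f :: "'a::finite + 'b::finite \<Rightarrow> real"
  by (simp add: UNIV_Plus_UNIV[symmetric] sum.Plus del: UNIV_Plus_UNIV)

text \<open>What is left of \<open>two_v t \<omega>\<close> after dividing by
  \<open>sqrt k * cos \<omega>\<close>, with \<open>k = n1 + n2 - 2\<close>; this is possible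
  because \<open>two_c1\<close> and \<open>two_c2\<close> coincide.\<close>

definition two_pad :: "real^('a::finite + 'b::finite) \<Rightarrow> real^('a option + 'b option)" where
  "two_pad t = (\<chi> i. case i of Inl p \<Rightarrow> pad (first_sample t) $ p | Inr q \<Rightarrow> pad (second_sample t) $ q)"

lemma linear_two_pad: "linear two_pad"
  by (rule linearI)
    (auto simp: two_pad_def pad_def first_sample_def second_sample_def vec_eq_iff split: sum.split option.split)

lemma norm_two_pad: "norm (two_pad t) = norm t"
  by (simp add: norm_vec_def L2_set_def sum_Plus_type sum_option two_pad_def pad_def first_sample_def second_sample_def)

lemma inner_two_pad: "two_pad t \<bullet> axis (Inl None) 1 = 0" "two_pad t \<bullet> axis (Inr None) 1 = 0"
  by (simp_all add: inner_axis two_pad_def pad_def)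

lemma norm_sq_samples: "(norm x)\<^sup>2 = (norm (first_sample x))\<^sup>2 + (norm (second_sample x))\<^sup>2"
  unfolding power2_norm_eq_inner inner_vec_def
  by (simp add: sum_Plus_type first_sample_def second_sample_def)

lemma inner_two_I: "x \<bullet> two_I1 = first_sample x \<bullet> diag_vec" "x \<bullet> two_I2 = second_sample x \<bullet> diag_vec"
  unfolding inner_vec_def
  by (simp_all add: sum_Plus_type first_sample_def second_sample_def two_I1_def two_I2_def diag_vec_def)

lemma inner_two_I_two_I:
  "two_I1 \<bullet> two_I1 = (1::real)" "two_I2 \<bullet> two_I2 = (1::real)" "two_I1 \<bullet> two_I2 = (0::real)" "two_I2 \<bullet> two_I1 = (0::real)"
  by (simp_all add: inner_vec_def sum_Plus_type two_I1_def two_I2_def)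

lemma first_sample_measurable [measurable]: "first_sample \<in> borel_measurable borel"
  by (rule borel_measurable_linear, rule linearI) (auto simp: first_sample_def vec_eq_iff)

lemma second_sample_measurable [measurable]: "second_sample \<in> borel_measurable borel"
  by (rule borel_measurable_linear, rule linearI) (auto simp: second_sample_def vec_eq_iff)

context
  fixes n1 n2 :: nat and k \<kappa> :: real
  assumes n: "n1 \<ge> 2" "n2 \<ge> 2" and k: "k = real n1 + real n2 - 2" and \<kappa>: "\<kappa> = sqrt (1 / real n1 + 1 / real n2)"
begin

lemma two_const_pos: "k > 0" "\<kappa> > 0" "\<kappa>\<^sup>2 = 1 / real n1 + 1 / real n2"
  using n by (auto simp: k \<kappa> add_pos_pos)

text \<open>Shows the role of \<open>a\<close> and \<open>b\<close>: the weighted sum of the two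
  sample variances is \<open>\<kappa>\<^sup>2 / k\<close> times the pooled sum of squared
  deviations.\<close>

lemma two_ab: "two_a n1 n2 = (real n1 - 1) / k * \<kappa>\<^sup>2" "two_b n1 n2 = (real n2 - 1) / k * \<kappa>\<^sup>2"
  unfolding two_const_pos(3) by (simp_all add: two_a_def two_b_def k)

lemma two_ratio: "(real n1 - 1) / two_a n1 n2 = k / \<kappa>\<^sup>2" "(real n2 - 1) / two_b n1 n2 = k / \<kappa>\<^sup>2"
  using n two_const_pos unfolding two_ab by auto

lemma two_c_eq: "two_c1 n1 n2 \<omega> = sqrt k * cos \<omega>" "two_c2 n1 n2 \<omega> = sqrt k * cos \<omega>"
  using two_const_pos
  by (simp_all add: two_c1_def two_c2_def two_ratio \<kappa>[symmetric] real_sqrt_divide)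

lemma two_M_eq: "two_M n1 n2 = k powr (k / 2)"
proof -
  have "two_M n1 n2 = (k / \<kappa>\<^sup>2) powr ((real n1 - 1) / 2 + (real n2 - 1) / 2) * (\<kappa>\<^sup>2) powr (k / 2)"
    by (simp only: two_M_def two_ratio powr_add two_const_pos(3)[symmetric] k[symmetric])
  also have "(real n1 - 1) / 2 + (real n2 - 1) / 2 = k / 2"
    by (simp add: k add_divide_distrib[symmetric])
  also have "(k / \<kappa>\<^sup>2) powr (k / 2) = k powr (k / 2) / (\<kappa>\<^sup>2) powr (k / 2)" by (rule powr_divide)
  finally show ?thesis using two_const_pos(1,2) by simp
qed

end

lemma two_w_inner:
  fixes \<omega> :: real
  defines "\<omega>0 \<equiv> arccos (sqrt (real CARD('n) / real (CARD('m) + CARD('n))))"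
  shows "(two_w \<omega> :: real^('m::finite + 'n::finite)) \<bullet> two_I1 = cos (\<omega> - \<omega>0)"
    "(two_w \<omega> :: real^('m::finite + 'n::finite)) \<bullet> two_I2 = sin (\<omega> - \<omega>0)"
  by (simp_all add: two_w_def \<omega>0_def Let_def inner_add_left inner_two_I_two_I)

text \<open>\<open>two_w\<close> runs through the unit circle of the plane \<open>L\<close>, so
  \<open>two_w 0\<close> and \<open>two_w (pi / 2)\<close> serve as orthonormal axes there and
  \<open>r *\<^sub>R two_w \<omega>\<close> has polar coordinates \<open>r\<close>,
  \<open>\<omega>\<close>.\<close>

lemma two_w_expand: "two_w \<omega> = cos \<omega> *\<^sub>R two_w 0 + sin \<omega> *\<^sub>R two_w (pi / 2)"
  by (simp add: two_w_def Let_def cos_diff sin_diff algebra_simps)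

lemma two_w_inner_two_w: "two_w \<omega> \<bullet> two_w \<theta> = cos (\<omega> - \<theta>)"
proof -
  have "cos a * cos b + sin a * sin b = cos (a - b)" for a b :: real
    by (simp add: cos_diff)
  from this[of "\<omega> - x" "\<theta> - x" for x] show ?thesis
    by (simp add: two_w_def Let_def inner_add_left inner_add_right inner_two_I_two_I mult.commute)
qed

context
  fixes A :: "real^('a::finite option + 'b::finite option) \<Rightarrow> real^('a option + 'b option)"
  assumes A: "orthogonal_transformation A" "A (axis (Inl None) 1) = two_I1" "A (axis (Inr None) 1) = two_I2"
begin

declare card_sum [simp del]

lemma inner_A_two_pad: "A (two_pad y) \<bullet> two_I1 = 0" "A (two_pad y) \<bullet> two_I2 = 0"
  using A inner_two_pad[of y] by (metis orthogonal_transformation_def)+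

lemma inner_A_two_pad_w: "A (two_pad y) \<bullet> two_w \<omega> = 0"
  by (simp add: two_w_def Let_def inner_add_right inner_A_two_pad)

lemma norm_A_two_pad: "norm (A (two_pad y)) = norm y"
  using A(1) norm_two_pad by (metis orthogonal_transformation_norm)

lemma linear_A_two_pad: "linear (\<lambda>y. A (two_pad y))"
  using linear_compose[OF linear_two_pad orthogonal_transformation_linear[OF A(1)]] by (simp add: o_def)

lemma A_two_pad_orthogonal_comp: "c *\<^sub>R A (two_pad y) \<in> (span {two_I1, two_I2})\<^sup>\<bottom>"
  unfolding orthogonal_comp_def
proof (intro CollectI ballI)
  fix z :: "real^('a option + 'b option)" assume "z \<in> span {two_I1, two_I2}"
  then have "orthogonal (c *\<^sub>R A (two_pad y)) z"
    by (rule orthogonal_to_span) (auto simp: orthogonal_def inner_A_two_pad)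
  then show "orthogonal z (c *\<^sub>R A (two_pad y))" by (simp add: orthogonal_commute)
qed

text \<open>Cartesian coordinates in \<open>L\<close>, because the isometry has to be linear;
  \<open>x\<close> is measured along the direction of the numerator of \<open>two_T\<close>.\<close>

definition two_\<Phi> :: "(real \<times> real) \<times> (real^('a + 'b)) \<Rightarrow> real^('a option + 'b option)" where
  "two_\<Phi> = (\<lambda>((x, w), y). x *\<^sub>R two_w 0 + w *\<^sub>R two_w (pi / 2) + A (two_pad y))"

lemma norm_two_\<Phi>: "(norm (two_\<Phi> ((x, w), y)))\<^sup>2 = x\<^sup>2 + w\<^sup>2 + (norm y)\<^sup>2"
proof -
  have "A (two_pad y) \<bullet> A (two_pad y) = (norm y)\<^sup>2"
    by (simp add: power2_norm_eq_inner[symmetric] norm_A_two_pad)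
  then show ?thesis
    unfolding power2_norm_eq_inner[of "two_\<Phi> _"]
    by (simp add: two_\<Phi>_def inner_add_left inner_add_right inner_A_two_pad_w two_w_inner_two_w
        inner_commute[of "two_w _" "A _"] power2_eq_square)
qed

lemma two_T_\<Phi>:
  "two_T (two_\<Phi> ((x, w), y)) = x * sqrt (real CARD('a + 'b)) / norm y"
proof -
  let ?X = "two_\<Phi> ((x, w), y)"
  let ?n1 = "CARD('a option)" let ?n2 = "CARD('b option)"
  let ?p = "sqrt (real ?n1)" let ?q = "sqrt (real ?n2)" let ?R = "sqrt (real (?n1 + ?n2))"
  let ?k = "real CARD('a + 'b)"
  have n: "?n1 \<ge> 2" "?n2 \<ge> 2" by (simp_all add: Suc_le_eq)
  have k: "?k = real ?n1 + real ?n2 - 2" by (simp add: card_sum)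
  define \<kappa> where "\<kappa> = sqrt (1 / real ?n1 + 1 / real ?n2)"
  note \<kappa> = two_const_pos[OF n k \<kappa>_def] two_ab[OF n k \<kappa>_def]
  define \<omega>0 where "\<omega>0 = arccos (sqrt (real ?n2 / real (?n1 + ?n2)))"
  have le: "-1 \<le> sqrt (real ?n2 / real (?n1 + ?n2))" "sqrt (real ?n2 / real (?n1 + ?n2)) \<le> 1"
    by (auto intro: order_trans[of _ 0])
  have pqR: "?p > 0" "?q > 0" "?R > 0" "?p\<^sup>2 + ?q\<^sup>2 = ?R\<^sup>2" by (auto simp: add_pos_pos)
  have c: "cos \<omega>0 = ?q / ?R"
    unfolding \<omega>0_def by (subst cos_arccos[OF le]) (simp add: real_sqrt_divide)
  have s: "sin \<omega>0 = ?p / ?R"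
  proof -
    have "sin \<omega>0 = sqrt (1 - (sqrt (real ?n2 / real (?n1 + ?n2)))\<^sup>2)"
      unfolding \<omega>0_def by (rule sin_arccos[OF le])
    also have "1 - (sqrt (real ?n2 / real (?n1 + ?n2)))\<^sup>2 = real ?n1 / real (?n1 + ?n2)"
      by (simp add: field_simps)
    finally show ?thesis by (simp add: real_sqrt_divide)
  qed
  have wi: "(two_w \<omega> :: real^('a option + 'b option)) \<bullet> two_I1 = cos (\<omega> - \<omega>0)"
    "(two_w \<omega> :: real^('a option + 'b option)) \<bullet> two_I2 = sin (\<omega> - \<omega>0)" for \<omega>
    unfolding \<omega>0_def by (rule two_w_inner)+
  have X1: "?X \<bullet> two_I1 = x * cos \<omega>0 + w * sin \<omega>0" and X2: "?X \<bullet> two_I2 = - x * sin \<omega>0 + w * cos \<omega>0"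
    by (simp_all add: two_\<Phi>_def inner_add_left inner_A_two_pad wi sin_diff cos_diff)
  have m1: "sample_mean (first_sample ?X) = (x * cos \<omega>0 + w * sin \<omega>0) / ?p"
    using X1[unfolded inner_two_I inner_diag_vec] pqR by (simp add: eq_divide_eq mult.commute)
  have m2: "sample_mean (second_sample ?X) = (- x * sin \<omega>0 + w * cos \<omega>0) / ?q"
    using X2[unfolded inner_two_I inner_diag_vec] pqR by (simp add: eq_divide_eq mult.commute)
  have \<kappa>R: "\<kappa> = ?R / (?p * ?q)"
    unfolding \<kappa>_def real_sqrt_mult[symmetric] real_sqrt_divide[symmetric]
    by (rule arg_cong[where f = sqrt]) (simp add: field_simps)
  have num: "sample_mean (first_sample ?X) - sample_mean (second_sample ?X) = x * \<kappa>"
  proof -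
    \<comment> \<open>Both terms in \<open>w\<close> equal \<open>w / R\<close> and cancel. This is
      the purpose of \<open>\<omega>0\<close>: it turns \<open>two_w 0\<close> into the direction of
      the difference of means.\<close>
    have "(x * (q / R) + w * (p / R)) / p - (- x * (p / R) + w * (q / R)) / q = x * (R / (p * q))"
      if "p > 0" "q > 0" "R > 0" "p\<^sup>2 + q\<^sup>2 = R\<^sup>2" for p q R :: real
    proof -
      have "(x * (q / R) + w * (p / R)) / p - (- x * (p / R) + w * (q / R)) / q = x * (p\<^sup>2 + q\<^sup>2) / (p * q * R)"
        using that(1-3) by (simp add: field_simps power2_eq_square)
      then show ?thesis using that by (simp add: power2_eq_square)
    qed
    then show ?thesis unfolding m1 m2 c s \<kappa>R using pqR by blast
  qed
  have sc: "(x * cos \<omega>0 + w * sin \<omega>0)\<^sup>2 + (- x * sin \<omega>0 + w * cos \<omega>0)\<^sup>2 = x\<^sup>2 + w\<^sup>2"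
  proof -
    have "(x * cos \<omega>0 + w * sin \<omega>0)\<^sup>2 + (- x * sin \<omega>0 + w * cos \<omega>0)\<^sup>2 = (x\<^sup>2 + w\<^sup>2) * ((sin \<omega>0)\<^sup>2 + (cos \<omega>0)\<^sup>2)"
      by algebra
    then show ?thesis by simp
  qed
  have nn: "real ?n1 - 1 \<noteq> 0" "real ?n2 - 1 \<noteq> 0" by simp_all
  \<comment> \<open>The pooled sum of squared deviations is the squared norm minus that of the
    projection onto \<open>two_I1\<close> and \<open>two_I2\<close>, which leaves
    \<open>(norm y)\<^sup>2\<close>.\<close>
  have "two_a ?n1 ?n2 * sample_var (first_sample ?X) + two_b ?n1 ?n2 * sample_var (second_sample ?X)
    = \<kappa>\<^sup>2 / ?k * (((norm (first_sample ?X))\<^sup>2 + (norm (second_sample ?X))\<^sup>2) - ((?X \<bullet> two_I1)\<^sup>2 + (?X \<bullet> two_I2)\<^sup>2))"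
    unfolding sample_var_eq \<kappa>(4,5) inner_two_I using nn by (simp add: field_simps)
  also have "\<dots> = \<kappa>\<^sup>2 / ?k * (norm y)\<^sup>2"
    unfolding norm_sq_samples[symmetric] norm_two_\<Phi> X1 X2 sc by simp
  finally have den: "sqrt (two_a ?n1 ?n2 * sample_var (first_sample ?X) + two_b ?n1 ?n2 * sample_var (second_sample ?X))
    = \<kappa> / sqrt ?k * norm y"
    using \<kappa>(2) by (simp add: real_sqrt_mult real_sqrt_divide)
  show ?thesis
    unfolding two_T_def num den using \<kappa>(2) by simp
qed

text \<open>Although \<open>z\<close> is two-dimensional, \<open>rad\<close> depends on its first
  coordinate only; stretching that one gives \<open>m = 1\<close>.\<close>

lemma slice_two:
  "slice two_\<Phi> (\<lambda>z::real \<times> real. sqrt (real CARD('a + 'b)) * max 0 (fst z)) two_T 1 2 (\<lambda>l z. (l * fst z, snd z))"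
proof (rule slice.intro)
  let ?c = "sqrt (real CARD('a + 'b))"
  have c: "?c > 0" by simp
  show "linear two_\<Phi>"
    unfolding two_\<Phi>_def
    by (rule linearI) (auto simp: linear_add[OF linear_A_two_pad] linear_scale[OF linear_A_two_pad] algebra_simps)
  show "norm (two_\<Phi> p) = norm p" for p
  proof -
    obtain x w y where p: "p = ((x, w), y)" by (metis prod.exhaust)
    have "(norm (two_\<Phi> p))\<^sup>2 = (norm p)\<^sup>2"
      unfolding p norm_two_\<Phi> by (simp add: norm_Pair)
    then show ?thesis by simp
  qed
  show "(\<lambda>z::real \<times> real. ?c * max 0 (fst z)) \<in> borel_measurable borel"
    by (intro borel_measurable_continuous_onI continuous_intros)
  show "two_T \<in> borel_measurable (borel :: (real^('a option + 'b option)) measure)"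
    unfolding two_T_def by measurable
  show "two_T (two_\<Phi> (z, y)) > u \<longleftrightarrow> norm y < ?c * max 0 (fst z) * u powr (- (real 2 / 2))"
    if "u > 0" "y \<noteq> 0" for u z y
  proof -
    obtain x w where z: "z = (x, w)" by (cases z)
    show ?thesis
      unfolding z two_T_\<Phi> using T_iff_aux[of u ?c "norm y" x] that c by simp
  qed
  show "AE z::real \<times> real in lborel. (if ?c * max 0 (fst z) > 0 then 1 else 0) +
      (if ?c * max 0 (fst (- z)) > 0 then 1 else 0 :: real) = 2 / real 2"
  proof -
    have "AE z::real \<times> real in lborel \<Otimes>\<^sub>M lborel. fst z \<noteq> 0"
      by (rule lborel_pair.AE_pair_measure, measurable) (use AE_lborel_singleton[of "0::real"] in auto)
    then show ?thesis
      unfolding lborel_prod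
      by (rule AE_mp, intro AE_I2) (use c in \<open>auto simp: max_def zero_less_mult_iff\<close>)
  qed
  show "(norm (l * fst z, snd z))\<^sup>2 = (norm z)\<^sup>2 + real 1 / real CARD('a + 'b) * (l\<^sup>2 - 1) * (?c * max 0 (fst z))\<^sup>2"
    if "0 < l" "0 < ?c * max 0 (fst z)" for l :: real and z :: "real \<times> real"
    using that
    by (cases z) (simp add: norm_Pair zero_less_mult_iff less_max_iff_disj power_mult_distrib algebra_simps)
  show "(\<integral>\<^sup>+z. f z \<partial>lborel) = ennreal (l ^ 1) * (\<integral>\<^sup>+z. f (l * fst z, snd z) \<partial>lborel)"
    if l: "0 < l" and f: "f \<in> borel_measurable borel" for f :: "real \<times> real \<Rightarrow> ennreal" and l :: real
  proof -
    have [measurable]: "f \<in> borel \<Otimes>\<^sub>M borel \<rightarrow>\<^sub>M borel" using f by (simp add: borel_prod)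
    have "(\<integral>\<^sup>+z. f z \<partial>lborel) = (\<integral>\<^sup>+x. (\<integral>\<^sup>+w. f (x, w) \<partial>lborel) \<partial>lborel)"
      unfolding lborel_prod[symmetric] by (subst lborel.nn_integral_fst[symmetric]) auto
    also have "\<dots> = ennreal l * (\<integral>\<^sup>+x. (\<integral>\<^sup>+w. f (l * x, w) \<partial>lborel) \<partial>lborel)"
      using l by (subst nn_integral_real_affine[of _ l 0]) auto
    also have "(\<integral>\<^sup>+x. (\<integral>\<^sup>+w. f (l * x, w) \<partial>lborel) \<partial>lborel) = (\<integral>\<^sup>+z. f (l * fst z, snd z) \<partial>lborel)"
      unfolding lborel_prod[symmetric] by (subst lborel.nn_integral_fst[symmetric]) auto
    finally show ?thesis by simp
  qed
  show "?c * max 0 (fst (l * fst z, snd z)) = l * (?c * max 0 (fst z))" if "0 < l" for l and z :: "real \<times> real"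
    using that by (simp add: max_mult_distrib_left mult.left_commute)
  show "(\<lambda>z::real \<times> real. (l * fst z, snd z)) \<in> borel_measurable borel" for l
    by (intro borel_measurable_continuous_onI continuous_intros)
qed (auto simp: card_sum)

lemma leading_term_two:
  assumes \<sigma>: "\<sigma> > 0" and g: "continuous_pdf g" and int: "two_integrability g" and K: "two_K g > 0"
    and diff: "twice_differentiable_near (two_G A g) 0"
  shows "leading_term (relative_error g (mvn_pdf \<sigma>) two_T (two_K g)) (const_C3 2 1 CARD('a + 'b) (two_K g) (two_G A g)) 2"
proof -
  let ?k = "CARD('a + 'b)"
  let ?c = "sqrt (real ?k)"
  let ?n1 = "CARD('a option)" let ?n2 = "CARD('b option)"
  interpret slice two_\<Phi> "\<lambda>z::real \<times> real. ?c * max 0 (fst z)" two_T 1 2 "\<lambda>l z. (l * fst z, snd z)"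
    by (rule slice_two)
  have n: "?n1 \<ge> 2" "?n2 \<ge> 2" by (simp_all add: Suc_le_eq)
  have k: "real ?k = real ?n1 + real ?n2 - 2" by (simp add: card_sum)
  have k': "?n1 + ?n2 - 2 = ?k" "?n1 + ?n2 - 1 = ?k + 1" by (simp_all add: card_sum)
  note cst = two_c_eq[OF n k refl] two_M_eq[OF n k refl]
  note g_meas [measurable] = continuous_pdfD(1)[OF g]
  note linA = orthogonal_transformation_linear[OF A(1)]
  have v: "A (two_v t \<omega>) = (?c * cos \<omega>) *\<^sub>R A (two_pad t)" for t \<omega>
  proof -
    have "two_v t \<omega> = (?c * cos \<omega>) *\<^sub>R two_pad t"
      unfolding two_v_def Let_def cst by (simp add: two_pad_def vec_eq_iff split: sum.split)
    then show ?thesis by (simp add: linear_scale[OF linA])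
  qed
  \<comment> \<open>Of the \<open>?k + 1 = n - 1\<close> factors \<open>r\<close>, \<open>?k\<close>
    come from the Jacobian \<open>rad z ^ ?k\<close> and one from polar coordinates. The indicators
    encode the ranges of integration.\<close>
  define F where "F t \<omega> r = indicator {-pi/2..pi/2} \<omega> * (cos \<omega> ^ ?k * (indicator {0..} r *
      (r ^ (?k + 1) * g (r *\<^sub>R (two_w \<omega> + A (two_v t \<omega>))))))" for t and \<omega> r :: real
  have F_nonneg: "F t \<omega> r \<ge> 0" for t \<omega> r
    using continuous_pdfD(2)[OF g] cos_ge_zero[of \<omega>] by (auto simp: F_def indicator_def)
  have F_meas: "(\<lambda>p. F t (fst p) (snd p)) \<in> borel_measurable (lborel \<Otimes>\<^sub>M lborel)" for t
  proof -
    have "(\<lambda>p::real \<times> real. snd p *\<^sub>R (two_w (fst p) + A (two_v t (fst p)))) \<in> borel_measurable borel"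
      unfolding v two_w_def Let_def by (intro borel_measurable_continuous_onI continuous_intros)
    then have [measurable]: "(\<lambda>p::real \<times> real. snd p *\<^sub>R (two_w (fst p) + A (two_v t (fst p)))) \<in> lborel \<Otimes>\<^sub>M lborel \<rightarrow>\<^sub>M borel"
      by (simp add: lborel_prod)
    show ?thesis unfolding F_def by measurable
  qed
  have G_eq: "two_G A g t = ?c ^ ?k * (LINT \<omega>|lborel. (LINT r|lborel. F t \<omega> r))" for t
    unfolding two_G_def set_lebesgue_integral_def F_def Let_def k' cst
    by (simp add: sqrt_power_powr)
  have slice_eq: "slice_int g t = ennreal (?c ^ ?k) * (\<integral>\<^sup>+\<omega>. (\<integral>\<^sup>+r. ennreal (F t \<omega> r) \<partial>lborel) \<partial>lborel)" for t
  proof -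
    define H where "H z = ennreal ((?c * fst z) ^ ?k * g (two_\<Phi> (z, (?c * fst z) *\<^sub>R t)))" for z :: "real \<times> real"
    have H_meas [measurable]: "H \<in> borel_measurable borel"
    proof -
      have [measurable]: "fst \<in> borel_measurable (borel :: (real \<times> real) measure)"
        by (intro borel_measurable_continuous_onI continuous_intros)
      show ?thesis unfolding H_def by measurable
    qed
    have "slice_int g t = (\<integral>\<^sup>+z. (if fst z > 0 then H z else 0) \<partial>lborel)"
      unfolding slice_int_def
    proof (rule nn_integral_cong)
      fix z :: "real \<times> real"
      show "ennreal ((?c * max 0 (fst z)) ^ ?k * g (two_\<Phi> (z, (?c * max 0 (fst z)) *\<^sub>R t))) = (if fst z > 0 then H z else 0)"
        by (simp add: H_def max_def zero_power)
    qed
    also have "\<dots> = (\<integral>\<^sup>+\<omega>. indicator {-pi/2..pi/2} \<omega> * (\<integral>\<^sup>+r. indicator {0..} r * (ennreal r * H (r * cos \<omega>, r * sin \<omega>)) \<partial>lborel) \<partial>lborel)"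
      by (rule nn_integral_polar_halfplane) measurable
    also have "\<dots> = (\<integral>\<^sup>+\<omega>. (\<integral>\<^sup>+r. ennreal (?c ^ ?k) * ennreal (F t \<omega> r) \<partial>lborel) \<partial>lborel)"
    proof (rule nn_integral_cong)
      fix \<omega> :: real
      show "indicator {-pi/2..pi/2} \<omega> * (\<integral>\<^sup>+r. indicator {0..} r * (ennreal r * H (r * cos \<omega>, r * sin \<omega>)) \<partial>lborel)
        = (\<integral>\<^sup>+r. ennreal (?c ^ ?k) * ennreal (F t \<omega> r) \<partial>lborel)"
      proof (cases "\<omega> \<in> {-pi/2..pi/2}")
        case True
        then have c0: "cos \<omega> \<ge> 0" by (intro cos_ge_zero) auto
        have "indicator {0..} r * (ennreal r * H (r * cos \<omega>, r * sin \<omega>)) = ennreal (?c ^ ?k) * ennreal (F t \<omega> r)" for r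
        proof (cases "r \<ge> 0")
          case r: True
          have "two_\<Phi> ((r * cos \<omega>, r * sin \<omega>), (?c * (r * cos \<omega>)) *\<^sub>R t) = r *\<^sub>R (two_w \<omega> + A (two_v t \<omega>))"
            unfolding two_w_expand[of \<omega>] v
            by (simp add: two_\<Phi>_def linear_scale[OF linear_A_two_pad] algebra_simps)
          then show ?thesis
            using True r c0 by (simp add: F_def H_def ennreal_mult'[symmetric] power_mult_distrib mult_ac)
        qed (simp add: F_def)
        then show ?thesis using True by simp
      qed (simp add: F_def)
    qed
    also have "\<dots> = ennreal (?c ^ ?k) * (\<integral>\<^sup>+\<omega>. (\<integral>\<^sup>+r. ennreal (F t \<omega> r) \<partial>lborel) \<partial>lborel)"
    proof -
      have [measurable]: "(\<lambda>r. F t \<omega> r) \<in> borel_measurable borel" for \<omega>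
        using measurable_compose[OF measurable_Pair1' F_meas[of t], of \<omega>] by (simp add: comp_def)
      have "(\<lambda>p. ennreal (F t (fst p) (snd p))) \<in> borel_measurable (lborel \<Otimes>\<^sub>M lborel)"
        using F_meas by measurable
      from lborel.borel_measurable_nn_integral_fst[OF this]
      have "(\<lambda>\<omega>. \<integral>\<^sup>+r. ennreal (F t \<omega> r) \<partial>lborel) \<in> borel_measurable borel" by simp
      then show ?thesis by (simp add: nn_integral_cmult)
    qed
    finally show ?thesis .
  qed
  obtain \<epsilon> where \<epsilon>: "\<epsilon> > 0" and fin: "(\<integral>\<^sup>+ \<omega>\<in>{-pi/2..pi/2}. ennreal (cos \<omega> ^ ?k) *
        (\<integral>\<^sup>+ r\<in>{0..}. ennreal (r ^ (?k + 1)) *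
          (SUP \<xi>\<in>{\<xi>. norm \<xi> < \<epsilon> \<and> \<xi> \<in> (span {two_I1, two_I2 :: real^('a option + 'b option)})\<^sup>\<bottom>}.
             ennreal (g (r *\<^sub>R (two_w \<omega> + \<xi>)))) \<partial>lborel) \<partial>lborel) < \<infinity>"
    using int unfolding two_integrability_def Let_def k' by auto
  have F_fin: "(\<integral>\<^sup>+\<omega>. (\<integral>\<^sup>+r. ennreal (F t \<omega> r) \<partial>lborel) \<partial>lborel) < \<infinity>" if t: "norm t < \<epsilon> / ?c" for t
  proof -
    have ct: "?c * norm t < \<epsilon>" using t by (simp add: pos_less_divide_eq mult.commute)
    \<comment> \<open>Since \<open>\<bar>cos \<omega>\<bar> \<le> 1\<close>, one bound on
      \<open>norm t\<close> serves all angles.\<close>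
    have v1: "norm (A (two_v t \<omega>)) < \<epsilon>" for \<omega>
    proof -
      have "norm (A (two_v t \<omega>)) = \<bar>cos \<omega>\<bar> * (?c * norm t)"
        by (simp add: v norm_A_two_pad abs_mult)
      also have "\<dots> \<le> 1 * (?c * norm t)" by (intro mult_right_mono) auto
      finally show ?thesis using ct by simp
    qed
    have v2: "A (two_v t \<omega>) \<in> (span {two_I1, two_I2})\<^sup>\<bottom>" for \<omega>
      unfolding v by (rule A_two_pad_orthogonal_comp)
    define S where "S \<omega> r = (SUP \<xi>\<in>{\<xi>. norm \<xi> < \<epsilon> \<and> \<xi> \<in> (span {two_I1, two_I2 :: real^('a option + 'b option)})\<^sup>\<bottom>}.
             ennreal (g (r *\<^sub>R (two_w \<omega> + \<xi>))))" for \<omega> r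
    have S: "ennreal (g (r *\<^sub>R (two_w \<omega> + A (two_v t \<omega>)))) \<le> S \<omega> r" for \<omega> r
      unfolding S_def using v1 v2 by (intro SUP_upper) auto
    have "(\<integral>\<^sup>+\<omega>. (\<integral>\<^sup>+r. ennreal (F t \<omega> r) \<partial>lborel) \<partial>lborel)
      \<le> (\<integral>\<^sup>+ \<omega>\<in>{-pi/2..pi/2}. ennreal (cos \<omega> ^ ?k) * (\<integral>\<^sup>+ r\<in>{0..}. ennreal (r ^ (?k + 1)) * S \<omega> r \<partial>lborel) \<partial>lborel)"
    proof (rule nn_integral_mono)
      fix \<omega> :: real
      show "(\<integral>\<^sup>+r. ennreal (F t \<omega> r) \<partial>lborel)
        \<le> ennreal (cos \<omega> ^ ?k) * (\<integral>\<^sup>+ r\<in>{0..}. ennreal (r ^ (?k + 1)) * S \<omega> r \<partial>lborel) * indicator {-pi/2..pi/2} \<omega>"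
      proof (cases "\<omega> \<in> {-pi/2..pi/2}")
        case True
        then have c0: "cos \<omega> \<ge> 0" by (intro cos_ge_zero) auto
        let ?f = "\<lambda>r. indicator {0..} r * (r ^ (?k + 1) * g (r *\<^sub>R (two_w \<omega> + A (two_v t \<omega>))))"
        have "(\<integral>\<^sup>+r. ennreal (F t \<omega> r) \<partial>lborel) = (\<integral>\<^sup>+r. ennreal (cos \<omega> ^ ?k) * ennreal (?f r) \<partial>lborel)"
          using True c0 by (intro nn_integral_cong) (simp add: F_def ennreal_mult')
        also have "\<dots> = ennreal (cos \<omega> ^ ?k) * (\<integral>\<^sup>+r. ennreal (?f r) \<partial>lborel)"
          by (rule nn_integral_cmult) measurable
        also have "\<dots> \<le> ennreal (cos \<omega> ^ ?k) * (\<integral>\<^sup>+ r\<in>{0..}. ennreal (r ^ (?k + 1)) * S \<omega> r \<partial>lborel)"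
          using S[of _ \<omega>] by (intro mult_left_mono nn_integral_mono)
            (auto simp: indicator_def ennreal_mult' intro!: mult_left_mono)
        finally show ?thesis using True by simp
      qed (simp add: F_def)
    qed
    then show ?thesis using fin unfolding S_def by (rule le_less_trans)
  qed
  show ?thesis
  proof (rule leading_term_slice[OF \<sigma> g_meas K _ _ _ diff])
    show "\<epsilon> / ?c > 0" using \<epsilon> by simp
    show "slice_int g t = ennreal (two_G A g t) \<and> 0 \<le> two_G A g t" if "norm t < \<epsilon> / ?c" for t
      unfolding slice_eq G_eq
      using nn_integral_eq_iterated_integral[OF F_meas F_nonneg F_fin[OF that]] F_nonneg[of t]
      by (simp add: ennreal_mult' integral_nonneg)
    have n': "(real (?n1 + ?n2) - 1) / 2 = (real ?k + 1) / 2" "real (?n1 + ?n2) - 2 = real ?k"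
      by (simp_all add: card_sum)
    have F0: "F 0 \<omega> r = indicator {-pi/2..pi/2} \<omega> * (cos \<omega> ^ ?k * (indicator {0..} r * (r ^ (?k + 1) * g (r *\<^sub>R two_w \<omega>))))" for \<omega> r
      unfolding F_def v by (simp add: linear_0[OF linear_A_two_pad])
    \<comment> \<open>\<open>two_M\<close> is \<open>real ?k powr (real ?k / 2)\<close> and meets
      its reciprocal, which leaves the prefactor of \<open>slice_const_2_1\<close>.\<close>
    have "two_K g = 2 * pi powr ((real ?k + 1) / 2) * real ?k powr (real ?k / 2) /
        (Gamma ((real ?k + 1) / 2) * real ?k powr (real ?k / 2)) * (LINT \<omega>|lborel. (LINT r|lborel. F 0 \<omega> r))"
      unfolding two_K_def Let_def k' cst n' set_lebesgue_integral_def F0 by simp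
    then have "two_K g * slice_const 2 1 ?k
      = (2 * pi powr ((real ?k + 1) / 2) / Gamma ((real ?k + 1) / 2) * slice_const 2 1 ?k) * (LINT \<omega>|lborel. (LINT r|lborel. F 0 \<omega> r))"
      by simp
    then have "two_K g * slice_const 2 1 ?k = ?c ^ ?k * (LINT \<omega>|lborel. (LINT r|lborel. F 0 \<omega> r))"
      unfolding slice_const_2_1[OF zero_less_card_finite] by (simp add: sqrt_power_powr)
    then show "two_G A g 0 = two_K g * slice_const 2 1 ?k" by (simp add: G_eq)
  qed
qed

end

section \<open>F-statistic\<close>

text \<open>There is no type with \<open>CARD('p) - 1\<close> elements, so the hyperplane orthogonal to \<open>diag_vec\<close> is not
  split off as a factor of its own; it is stretched in place instead.\<close>

definition diag_stretch :: "real \<Rightarrow> real^'p \<Rightarrow> real^'p" where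
  "diag_stretch l x = l *\<^sub>R x + ((1 - l) * (x \<bullet> diag_vec)) *\<^sub>R diag_vec"

lemma diag_vec_diag_vec: "diag_vec \<bullet> diag_vec = (1::real)"
  using norm_diag_vec by (simp add: norm_eq_1)

lemma inner_diag_stretch: "diag_stretch l x \<bullet> diag_vec = x \<bullet> diag_vec"
  by (simp add: diag_stretch_def inner_add_left diag_vec_diag_vec algebra_simps)

lemma norm_diag_stretch: "(norm (diag_stretch l x))\<^sup>2 = l\<^sup>2 * ((norm x)\<^sup>2 - (x \<bullet> diag_vec)\<^sup>2) + (x \<bullet> diag_vec)\<^sup>2"
proof -
  define a where "a = x \<bullet> diag_vec"
  have "(norm (l *\<^sub>R x + b *\<^sub>R diag_vec))\<^sup>2 = l\<^sup>2 * (x \<bullet> x) + 2 * (l * b * a) + b\<^sup>2" for b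
    unfolding power2_norm_eq_inner a_def
    by (simp add: inner_add_left inner_add_right diag_vec_diag_vec inner_commute[of diag_vec x] power2_eq_square algebra_simps)
  then have "(norm (diag_stretch l x))\<^sup>2 = l\<^sup>2 * (x \<bullet> x) + 2 * (l * ((1 - l) * a) * a) + ((1 - l) * a)\<^sup>2"
    by (simp add: diag_stretch_def a_def)
  also have "\<dots> = l\<^sup>2 * (x \<bullet> x - a\<^sup>2) + a\<^sup>2" by algebra
  finally show ?thesis by (simp add: power2_norm_eq_inner a_def)
qed

lemma sample_var_diag_stretch: "sample_var (diag_stretch l x) = l\<^sup>2 * sample_var x"
  by (simp add: sample_var_eq inner_diag_stretch norm_diag_stretch)

lemma diag_stretch_measurable [measurable]: "diag_stretch l \<in> borel_measurable borel"
  unfolding diag_stretch_def by measurable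

text \<open>After a rotation that carries a basis vector \<open>e\<close> to
  \<open>diag_vec\<close>, the stretch is diagonal with entry 1 at \<open>e\<close> and
  \<open>l\<close> elsewhere, so its determinant is \<open>l ^ (CARD('p) - 1)\<close>.\<close>

lemma nn_integral_diag_stretch:
  fixes f :: "real^'p \<Rightarrow> ennreal"
  assumes [measurable]: "f \<in> borel_measurable borel" and l: "l > 0"
  shows "(\<integral>\<^sup>+x. f x \<partial>lborel) = ennreal (l ^ (CARD('p) - 1)) * (\<integral>\<^sup>+x. f (diag_stretch l x) \<partial>lborel)"
proof -
  fix i0 :: 'p
  define e where "e = (axis i0 1 :: real^'p)"
  have e: "e \<in> Basis" "norm e = 1" by (auto simp: e_def axis_in_Basis_iff norm_axis_1)
  obtain A :: "real^'p \<Rightarrow> real^'p" where A: "orthogonal_transformation A" "A e = diag_vec"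
    using orthogonal_transformation_exists_1[OF e(2) norm_diag_vec] by blast
  note linA = orthogonal_transformation_linear[OF A(1)]
  note normA = orthogonal_transformation_norm[OF A(1)]
  have [measurable]: "A \<in> borel_measurable borel" using linA by (rule borel_measurable_linear)
  define c where "c j = (if j = e then 1 else l)" for j
  define T where "T x = (\<Sum>j\<in>Basis. (c j * (x \<bullet> j)) *\<^sub>R j)" for x :: "real^'p"
  have T_eq: "T x = l *\<^sub>R x + ((1 - l) * (x \<bullet> e)) *\<^sub>R e" for x
  proof -
    have "T x = (\<Sum>j\<in>Basis. l *\<^sub>R ((x \<bullet> j) *\<^sub>R j)) + (\<Sum>j\<in>Basis. (if j = e then ((1 - l) * (x \<bullet> j)) *\<^sub>R j else 0))"
      unfolding T_def c_def sum.distrib[symmetric]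
      by (intro sum.cong refl) (auto simp: algebra_simps)
    also have "(\<Sum>j\<in>Basis. l *\<^sub>R ((x \<bullet> j) *\<^sub>R j)) = l *\<^sub>R x"
      by (simp add: scaleR_sum_right[symmetric] euclidean_representation del: scaleR_scaleR)
    also have "(\<Sum>j\<in>Basis. (if j = e then ((1 - l) * (x \<bullet> j)) *\<^sub>R j else 0)) = ((1 - l) * (x \<bullet> e)) *\<^sub>R e"
      using e(1) by (simp add: sum.delta)
    finally show ?thesis .
  qed
  have AT: "A (T x) = diag_stretch l (A x)" for x
  proof -
    have "A x \<bullet> diag_vec = x \<bullet> e" using A by (metis orthogonal_transformation_def)
    then show ?thesis
      by (simp add: T_eq diag_stretch_def linear_add[OF linA] linear_scale[OF linA] A(2))
  qed
  have [measurable]: "T \<in> borel_measurable borel"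
    unfolding T_def by measurable
  have prod: "(\<Prod>j\<in>(Basis :: (real^'p) set). \<bar>c j\<bar>) = l ^ (CARD('p) - 1)"
  proof -
    have "(\<Prod>j\<in>(Basis :: (real^'p) set). \<bar>c j\<bar>) = \<bar>c e\<bar> * (\<Prod>j\<in>Basis - {e}. \<bar>c j\<bar>)"
      by (rule prod.remove) (use e in auto)
    also have "(\<Prod>j\<in>(Basis :: (real^'p) set) - {e}. \<bar>c j\<bar>) = (\<Prod>j\<in>(Basis :: (real^'p) set) - {e}. l)"
      using l by (intro prod.cong) (auto simp: c_def)
    finally show ?thesis using e(1) by (simp add: c_def card_Diff_singleton)
  qed
  have lb: "(lborel :: (real^'p) measure) = density (distr lborel borel T) (\<lambda>_. ennreal (l ^ (CARD('p) - 1)))"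
  proof -
    have cn: "c j \<noteq> 0" for j using l by (simp add: c_def)
    show ?thesis
      using lborel_affine_euclidean[of c 0, OF cn] unfolding prod add_0 T_def[symmetric] .
  qed
  have "(\<integral>\<^sup>+x. f x \<partial>lborel) = (\<integral>\<^sup>+x. f (A x) \<partial>lborel)"
    by (rule nn_integral_isometry[OF linA normA, symmetric]) auto
  also have "\<dots> = (\<integral>\<^sup>+x. ennreal (l ^ (CARD('p) - 1)) * f (A (T x)) \<partial>lborel)"
    by (subst lb) (simp add: nn_integral_density nn_integral_distr)
  also have "\<dots> = ennreal (l ^ (CARD('p) - 1)) * (\<integral>\<^sup>+x. f (diag_stretch l (A x)) \<partial>lborel)"
    unfolding AT by (rule nn_integral_cmult) measurable
  also have "(\<integral>\<^sup>+x. f (diag_stretch l (A x)) \<partial>lborel) = (\<integral>\<^sup>+x. f (diag_stretch l x) \<partial>lborel)"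
    by (rule nn_integral_isometry[OF linA normA]) auto
  finally show ?thesis .
qed

lemma sample_var_eq_0_imp:
  fixes x :: "real^'p"
  assumes "sample_var x = 0" "CARD('p) \<ge> 2"
  shows "x = (x \<bullet> diag_vec) *\<^sub>R diag_vec"
proof -
  have "(\<Sum>i\<in>UNIV. (x $ i - sample_mean x)\<^sup>2) = 0"
    using assms by (simp add: sample_var_def)
  then have "x $ i = sample_mean x" for i
    by (simp add: sum_nonneg_eq_0_iff)
  then show ?thesis
    unfolding inner_diag_vec by (simp add: vec_eq_iff diag_vec_def)
qed

text \<open>The exceptional set lies in a subspace of dimension at most 2, spanned by the diagonal
  of the sample and the extra real axis, inside a space of dimension
  \<open>CARD('p) + 1\<close>.\<close>

lemma AE_sample_sd_pos:
  assumes "CARD('p) \<ge> 2"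
  shows "AE z::(real^'p) \<times> real in lborel. sample_sd (fst z) > 0"
proof -
  let ?B = "{(diag_vec, 0), (0, 1)} :: ((real^'p) \<times> real) set"
  let ?S = "{z :: (real^'p) \<times> real. sample_sd (fst z) \<le> 0}"
  have "?S \<subseteq> span ?B"
  proof clarify
    fix x :: "real^'p" and r :: real assume "sample_sd (fst (x, r)) \<le> 0"
    then have "sample_var x = 0"
      using sample_var_nonneg[of x] by (auto simp: sample_sd_def)
    then have x: "x = (x \<bullet> diag_vec) *\<^sub>R diag_vec"
      using assms by (rule sample_var_eq_0_imp)
    have "(x, r) = (x \<bullet> diag_vec) *\<^sub>R (diag_vec, 0) + r *\<^sub>R (0, 1)"
      using x by simp
    moreover have "\<dots> \<in> span ?B"
      by (intro span_add span_scale span_base) auto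
    ultimately show "(x, r) \<in> span ?B" by metis
  qed
  then have "dim ?S \<le> card ?B" by (rule dim_le_card) simp
  also have "\<dots> \<le> 2" by (simp add: card_insert_le_m1)
  also have "2 < DIM((real^'p) \<times> real)" using assms by simp
  finally have "negligible ?S" by (rule negligible_lowdim)
  then have "?S \<in> null_sets lebesgue" by (simp add: negligible_iff_null_sets)
  then have "AE z in lebesgue. z \<notin> ?S" by (rule AE_not_in)
  then have "AE z in lborel. z \<notin> ?S"
    by (simp add: AE_completion_iff)
  then show ?thesis by (rule AE_mp) (auto intro!: AE_I2)
qed

context
  fixes A :: "real^('k::finite option) \<Rightarrow> real^('k option)"
  assumes A: "orthogonal_transformation A" "A (axis None 1) = diag_vec"
begin

definition F_\<Phi> :: "((real^'p) \<times> real) \<times> (real^'k) \<Rightarrow> (real^'p) \<times> (real^('k option))" where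
  "F_\<Phi> = (\<lambda>((x, r), y). (x, r *\<^sub>R diag_vec + A (pad y)))"

lemma norm_F_\<Phi>: "norm (F_\<Phi> p) = norm p"
proof -
  obtain x r y where p: "p = ((x, r), y)" by (metis prod.exhaust)
  have "(norm (F_\<Phi> p))\<^sup>2 = (norm p)\<^sup>2"
    unfolding p by (simp add: F_\<Phi>_def norm_Pair norm_sq_orthogonal_sum[OF norm_diag_vec inner_A_pad[OF A]] norm_A_pad[OF A])
  then show ?thesis by simp
qed

text \<open>Up to a constant, \<open>F_T\<close> is \<open>sample_var x\<close> over
  \<open>(norm y)\<^sup>2\<close>; taking the square root in \<open>F_T > u\<close> gives the
  exponent 1/2, that is \<alpha> = 1. \<open>sample_sd\<close> sees the \<open>CARD('p) - 1\<close>
  directions orthogonal to \<open>diag_vec\<close>; these are stretched, whence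
  \<open>m\<close>.\<close>

lemma slice_F:
  assumes p: "2 \<le> CARD('p)"
  shows "slice F_\<Phi> (\<lambda>z::(real^'p) \<times> real. sqrt (real CARD('k)) * sample_sd (fst z)) F_T (CARD('p) - 1) 1
    (\<lambda>l z. (diag_stretch l (fst z), snd z))"
proof (rule slice.intro)
  let ?c = "sqrt (real CARD('k))"
  have c: "?c > 0" by simp
  have m: "real (CARD('p) - 1) = real CARD('p) - 1" using p by simp
  have [measurable]: "fst \<in> borel_measurable (borel :: ((real^'p) \<times> real) measure)"
    "snd \<in> borel_measurable (borel :: ((real^'p) \<times> real) measure)"
    "fst \<in> borel_measurable (borel :: ((real^'p) \<times> (real^'k option)) measure)"
    "snd \<in> borel_measurable (borel :: ((real^'p) \<times> (real^'k option)) measure)"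
    by (auto intro!: borel_measurable_continuous_onI continuous_intros)
  show "linear (F_\<Phi> :: ((real^'p) \<times> real) \<times> (real^'k) \<Rightarrow> _)"
    unfolding F_\<Phi>_def
    by (rule linearI) (auto simp: linear_add[OF linear_A_pad[OF A]] linear_scale[OF linear_A_pad[OF A]] algebra_simps)
  show "norm (F_\<Phi> p) = norm p" for p :: "((real^'p) \<times> real) \<times> (real^'k)"
    by (rule norm_F_\<Phi>)
  show "(\<lambda>z::(real^'p) \<times> real. ?c * sample_sd (fst z)) \<in> borel_measurable borel"
    by measurable
  show "0 \<le> ?c * sample_sd (fst z)" for z :: "(real^'p) \<times> real"
    by (simp add: sample_sd_def sample_var_nonneg)
  show "F_T \<in> borel_measurable (borel :: ((real^'p) \<times> (real^'k option)) measure)"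
    unfolding F_T_def by measurable
  show "F_T (F_\<Phi> (z, y)) > u \<longleftrightarrow> norm y < ?c * sample_sd (fst z) * u powr (- (real 1 / 2))"
    if u: "u > 0" and y: "y \<noteq> 0" for u and z :: "(real^'p) \<times> real" and y :: "real^'k"
  proof -
    obtain x r where z: "z = (x, r)" by (cases z)
    have "F_T (F_\<Phi> (z, y)) = sample_var x / ((norm y)\<^sup>2 / real CARD('k))"
      by (simp add: z F_T_def F_\<Phi>_def sample_var_diag_sum[OF A])
    moreover have "v / (N / K) > u \<longleftrightarrow> N < K * v * (1 / u)" if "N > 0" "K > 0" for v N K :: real
      using u that by (simp add: field_simps)
    ultimately have "F_T (F_\<Phi> (z, y)) > u \<longleftrightarrow> (norm y)\<^sup>2 < real CARD('k) * sample_var x * (1 / u)"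
      using y by simp
    also have "\<dots> \<longleftrightarrow> norm y < sqrt (real CARD('k) * sample_var x * (1 / u))"
      using real_sqrt_less_iff[of "(norm y)\<^sup>2", symmetric] by simp
    also have "sqrt (real CARD('k) * sample_var x * (1 / u)) = ?c * sample_sd (fst z) * u powr (- (real 1 / 2))"
    proof -
      have "u powr (- (real 1 / 2)) = 1 / sqrt u"
        using u powr_minus_divide[of u "1 / 2"] by (simp add: powr_half_sqrt)
      then show ?thesis by (simp add: z sample_sd_def real_sqrt_mult real_sqrt_divide)
    qed
    finally show ?thesis .
  qed
  show "AE z::(real^'p) \<times> real in lborel. (if ?c * sample_sd (fst z) > 0 then 1 else 0) +
      (if ?c * sample_sd (fst (- z)) > 0 then 1 else 0 :: real) = 2 / real 1"
  \<comment> \<open>\<open>sample_sd\<close> is even and almost everywhere positive, so both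
    summands are 1.\<close>
  proof (rule AE_mp[OF AE_sample_sd_pos[OF p]], rule AE_I2, intro impI)
    fix z :: "(real^'p) \<times> real" assume "sample_sd (fst z) > 0"
    moreover have "sample_sd (fst (- z)) = sample_sd (fst z)"
      by (simp add: sample_sd_def sample_var_eq)
    ultimately show "(if ?c * sample_sd (fst z) > 0 then 1 else 0) +
      (if ?c * sample_sd (fst (- z)) > 0 then 1 else 0 :: real) = 2 / real 1"
      using c by simp
  qed
  show "(\<lambda>z::(real^'p) \<times> real. (diag_stretch l (fst z), snd z)) \<in> borel_measurable borel" for l
    by (intro borel_measurable_Pair) measurable
  show "?c * sample_sd (fst (diag_stretch l (fst z), snd z)) = l * (?c * sample_sd (fst z))"
    if "0 < l" for l and z :: "(real^'p) \<times> real"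
    using that by (simp add: sample_sd_def sample_var_diag_stretch real_sqrt_mult)
  \<comment> \<open>Only the part of \<open>x\<close> orthogonal to \<open>diag_vec\<close> is
    scaled, and its squared norm is \<open>m * sample_var x\<close>; in terms of \<open>rad\<close>
    this is \<open>m / k * (rad z)\<^sup>2\<close>.\<close>
  show "(norm (diag_stretch l (fst z), snd z))\<^sup>2
      = (norm z)\<^sup>2 + real (CARD('p) - 1) / real CARD('k) * (l\<^sup>2 - 1) * (?c * sample_sd (fst z))\<^sup>2"
    if "0 < l" for l and z :: "(real^'p) \<times> real"
  proof -
    obtain x r where z: "z = (x, r)" by (cases z)
    have v: "real (CARD('p) - 1) * sample_var x = (norm x)\<^sup>2 - (x \<bullet> diag_vec)\<^sup>2"
      unfolding m sample_var_eq using p by simp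
    have r: "real (CARD('p) - 1) / real CARD('k) * (l\<^sup>2 - 1) * (?c * sample_sd x)\<^sup>2
      = (l\<^sup>2 - 1) * (real (CARD('p) - 1) * sample_var x)"
      by (simp add: power_mult_distrib sample_sd_def sample_var_nonneg)
    have pyth: "(norm (a, b))\<^sup>2 = (norm a)\<^sup>2 + (norm b)\<^sup>2" for a :: "real^'p" and b :: real
      by (simp add: norm_Pair)
    show ?thesis
      unfolding z fst_conv snd_conv r v pyth norm_diag_stretch by (simp add: algebra_simps)
  qed
  show "(\<integral>\<^sup>+z. f z \<partial>lborel) = ennreal (l ^ (CARD('p) - 1)) * (\<integral>\<^sup>+z. f (diag_stretch l (fst z), snd z) \<partial>lborel)"
    if l: "0 < l" and f: "f \<in> borel_measurable borel" for f :: "(real^'p) \<times> real \<Rightarrow> ennreal" and l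
  proof -
    have [measurable]: "f \<in> borel \<Otimes>\<^sub>M borel \<rightarrow>\<^sub>M borel" using f by (simp add: borel_prod)
    have "(\<integral>\<^sup>+z. f z \<partial>lborel) = (\<integral>\<^sup>+x. (\<integral>\<^sup>+r. f (x, r) \<partial>lborel) \<partial>lborel)"
      unfolding lborel_prod[symmetric] by (subst lborel.nn_integral_fst[symmetric]) auto
    also have "\<dots> = ennreal (l ^ (CARD('p) - 1)) * (\<integral>\<^sup>+x. (\<integral>\<^sup>+r. f (diag_stretch l x, r) \<partial>lborel) \<partial>lborel)"
      using l by (subst nn_integral_diag_stretch[of _ l]) auto
    also have "(\<integral>\<^sup>+x. (\<integral>\<^sup>+r. f (diag_stretch l x, r) \<partial>lborel) \<partial>lborel) = (\<integral>\<^sup>+z. f (diag_stretch l (fst z), snd z) \<partial>lborel)"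
      unfolding lborel_prod[symmetric] by (subst lborel.nn_integral_fst[symmetric]) auto
    finally show ?thesis .
  qed
qed (use p in auto)

lemma leading_term_F:
  fixes g :: "(real^'p) \<times> (real^('k option)) \<Rightarrow> real"
  assumes p: "2 \<le> CARD('p)" and \<sigma>: "\<sigma> > 0" and g: "continuous_pdf g" and int: "F_integrability g" and K: "F_K g > 0"
    and diff: "twice_differentiable_near (F_G A g) 0"
  shows "leading_term (relative_error g (mvn_pdf \<sigma>) F_T (F_K g))
    (const_C3 1 (CARD('p) - 1) CARD('k) (F_K g) (F_G A g)) 1"
proof -
  let ?k = "CARD('k)"
  let ?m = "CARD('p) - 1"
  let ?c = "sqrt (real ?k)"
  interpret slice F_\<Phi> "\<lambda>z::(real^'p) \<times> real. ?c * sample_sd (fst z)" F_T ?m 1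
    "\<lambda>l z. (diag_stretch l (fst z), snd z)"
    by (rule slice_F[OF p])
  note g_meas [measurable] = continuous_pdfD(1)[OF g]
  have sd: "sample_sd x \<ge> 0" for x :: "real^'p" by (simp add: sample_sd_def sample_var_nonneg)
  define F where "F t x r = sample_sd x ^ ?k * g (x, r *\<^sub>R diag_vec + (?c * sample_sd x) *\<^sub>R A (pad t))"
    for t and x :: "real^'p" and r :: real
  have F_nonneg: "F t x r \<ge> 0" for t x r
    using continuous_pdfD(2)[OF g] sd by (simp add: F_def)
  have F_meas [measurable]: "(\<lambda>p. F t (fst p) (snd p)) \<in> borel_measurable (lborel \<Otimes>\<^sub>M lborel)" for t
  proof -
    have [measurable]: "(\<lambda>p. g (fst p, snd p *\<^sub>R diag_vec + (?c * sample_sd (fst p)) *\<^sub>R A (pad t))) \<in> borel_measurable (lborel \<Otimes>\<^sub>M lborel)"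
      by (rule measurable_compose[OF _ g_meas]) (intro borel_measurable_Pair; measurable)
    show ?thesis unfolding F_def by measurable
  qed
  have G_eq: "F_G A g t = ?c ^ ?k * (LINT x|lborel. (LINT r|lborel. F t x r))" for t
    unfolding F_G_def F_def Let_def by (simp add: sqrt_power_powr)
  have slice_eq: "slice_int g t = ennreal (?c ^ ?k) * (\<integral>\<^sup>+x. (\<integral>\<^sup>+r. ennreal (F t x r) \<partial>lborel) \<partial>lborel)" for t
  proof -
    have "slice_int g t = (\<integral>\<^sup>+z. ennreal (?c ^ ?k) * ennreal (F t (fst z) (snd z)) \<partial>(lborel \<Otimes>\<^sub>M lborel))"
      unfolding slice_int_def lborel_prod
    proof (rule nn_integral_cong)
      fix z :: "(real^'p) \<times> real"
      obtain x r where z: "z = (x, r)" by (cases z)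
      show "ennreal ((?c * sample_sd (fst z)) ^ ?k * g (F_\<Phi> (z, (?c * sample_sd (fst z)) *\<^sub>R t)))
        = ennreal (?c ^ ?k) * ennreal (F t (fst z) (snd z))"
        by (simp add: z F_\<Phi>_def F_def A_pad_scaleR[OF A] ennreal_mult'[symmetric] power_mult_distrib mult_ac)
    qed
    also have "\<dots> = ennreal (?c ^ ?k) * (\<integral>\<^sup>+z. ennreal (F t (fst z) (snd z)) \<partial>(lborel \<Otimes>\<^sub>M lborel))"
      by (rule nn_integral_cmult) measurable
    also have "(\<integral>\<^sup>+z. ennreal (F t (fst z) (snd z)) \<partial>(lborel \<Otimes>\<^sub>M lborel)) = (\<integral>\<^sup>+x. (\<integral>\<^sup>+r. ennreal (F t x r) \<partial>lborel) \<partial>lborel)"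
      by (subst lborel.nn_integral_fst[symmetric]) auto
    finally show ?thesis .
  qed
  obtain \<epsilon> where \<epsilon>: "\<epsilon> > 0" and fin: "(\<integral>\<^sup>+ x. ennreal (sample_sd x ^ ?k) *
        (\<integral>\<^sup>+ r. (SUP \<xi>\<in>{\<xi>. norm \<xi> < \<epsilon> \<and> \<xi> \<in> (span {diag_vec :: real^'k option})\<^sup>\<bottom>}.
             ennreal (g (x, r *\<^sub>R diag_vec + sample_sd x *\<^sub>R \<xi>)))
          \<partial>lborel) \<partial>lborel) < \<infinity>"
    using int unfolding F_integrability_def by auto
  have F_fin: "(\<integral>\<^sup>+x. (\<integral>\<^sup>+r. ennreal (F t x r) \<partial>lborel) \<partial>lborel) < \<infinity>" if t: "norm t < \<epsilon> / ?c" for t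
  proof -
    \<comment> \<open>The factor \<open>sample_sd x\<close> is already part of the integrability
      condition, so the admissible radius does not depend on \<open>x\<close>.\<close>
    have v1: "norm (?c *\<^sub>R A (pad t)) < \<epsilon>"
      using t by (simp add: norm_A_pad[OF A] pos_less_divide_eq mult.commute)
    have v2: "?c *\<^sub>R A (pad t) \<in> (span {diag_vec})\<^sup>\<bottom>" by (rule A_pad_orthogonal_comp[OF A])
    have S: "ennreal (g (x, r *\<^sub>R diag_vec + (?c * sample_sd x) *\<^sub>R A (pad t)))
      \<le> (SUP \<xi>\<in>{\<xi>. norm \<xi> < \<epsilon> \<and> \<xi> \<in> (span {diag_vec :: real^'k option})\<^sup>\<bottom>}.
             ennreal (g (x, r *\<^sub>R diag_vec + sample_sd x *\<^sub>R \<xi>)))" for x r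
      by (rule SUP_upper2[of "?c *\<^sub>R A (pad t)"]) (use v1 v2 in \<open>auto simp: mult.commute\<close>)
    have "(\<integral>\<^sup>+x. (\<integral>\<^sup>+r. ennreal (F t x r) \<partial>lborel) \<partial>lborel) \<le> (\<integral>\<^sup>+ x. ennreal (sample_sd x ^ ?k) *
        (\<integral>\<^sup>+ r. (SUP \<xi>\<in>{\<xi>. norm \<xi> < \<epsilon> \<and> \<xi> \<in> (span {diag_vec :: real^'k option})\<^sup>\<bottom>}.
             ennreal (g (x, r *\<^sub>R diag_vec + sample_sd x *\<^sub>R \<xi>)))
          \<partial>lborel) \<partial>lborel)"
    proof (rule nn_integral_mono)
      fix x :: "real^'p"
      have "(\<integral>\<^sup>+r. ennreal (F t x r) \<partial>lborel) = (\<integral>\<^sup>+r. ennreal (sample_sd x ^ ?k) *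
          ennreal (g (x, r *\<^sub>R diag_vec + (?c * sample_sd x) *\<^sub>R A (pad t))) \<partial>lborel)"
        using sd[of x] by (simp add: F_def ennreal_mult')
      also have "\<dots> = ennreal (sample_sd x ^ ?k) *
          (\<integral>\<^sup>+r. ennreal (g (x, r *\<^sub>R diag_vec + (?c * sample_sd x) *\<^sub>R A (pad t))) \<partial>lborel)"
      proof (rule nn_integral_cmult)
        have "(\<lambda>r. g (x, r *\<^sub>R diag_vec + (?c * sample_sd x) *\<^sub>R A (pad t))) \<in> borel_measurable borel"
          by (rule measurable_compose[OF _ g_meas]) (intro borel_measurable_Pair; measurable)
        then show "(\<lambda>r. ennreal (g (x, r *\<^sub>R diag_vec + (?c * sample_sd x) *\<^sub>R A (pad t)))) \<in> borel_measurable lborel"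
          by simp
      qed
      also have "\<dots> \<le> ennreal (sample_sd x ^ ?k) *
        (\<integral>\<^sup>+ r. (SUP \<xi>\<in>{\<xi>. norm \<xi> < \<epsilon> \<and> \<xi> \<in> (span {diag_vec :: real^'k option})\<^sup>\<bottom>}.
             ennreal (g (x, r *\<^sub>R diag_vec + sample_sd x *\<^sub>R \<xi>))) \<partial>lborel)"
        using S by (intro mult_left_mono nn_integral_mono) auto
      finally show "(\<integral>\<^sup>+r. ennreal (F t x r) \<partial>lborel) \<le> ennreal (sample_sd x ^ ?k) *
        (\<integral>\<^sup>+ r. (SUP \<xi>\<in>{\<xi>. norm \<xi> < \<epsilon> \<and> \<xi> \<in> (span {diag_vec :: real^'k option})\<^sup>\<bottom>}.
             ennreal (g (x, r *\<^sub>R diag_vec + sample_sd x *\<^sub>R \<xi>))) \<partial>lborel)" .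
    qed
    then show ?thesis using fin by (rule le_less_trans)
  qed
  show ?thesis
  proof (rule leading_term_slice[OF \<sigma> g_meas K _ _ _ diff])
    show "\<epsilon> / ?c > 0" using \<epsilon> by simp
    show "slice_int g t = ennreal (F_G A g t) \<and> 0 \<le> F_G A g t" if "norm t < \<epsilon> / ?c" for t
      unfolding slice_eq G_eq
      using nn_integral_eq_iterated_integral[OF F_meas F_nonneg F_fin[OF that]] F_nonneg[of t]
      by (simp add: ennreal_mult' integral_nonneg)
    have n: "real CARD('p) - 1 = real ?m" "real CARD('k option) - 1 = real ?k"
      "real (CARD('p) + CARD('k option)) - 2 = real ?k + real ?m" "CARD('k option) - 1 = ?k"
      using p by simp_all
    have F0: "F 0 x r = sample_sd x ^ ?k * g (x, r *\<^sub>R diag_vec)" for x r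
      unfolding F_def by (simp add: linear_0[OF linear_A_pad[OF A]])
    have "F_K g = (Gamma (real ?m / 2) * (pi * real ?m) powr (real ?k / 2) / Gamma ((real ?k + real ?m) / 2)) *
        (LINT x|lborel. (LINT r|lborel. F 0 x r))"
      unfolding F_K_def Let_def n F0 by simp
    then have "F_K g * slice_const 1 ?m ?k
      = (Gamma (real ?m / 2) * (pi * real ?m) powr (real ?k / 2) / Gamma ((real ?k + real ?m) / 2) * slice_const 1 ?m ?k) *
        (LINT x|lborel. (LINT r|lborel. F 0 x r))"
      by (simp only: mult_ac)
    then have "F_K g * slice_const 1 ?m ?k = ?c ^ ?k * (LINT x|lborel. (LINT r|lborel. F 0 x r))"
      using slice_const_1[of ?k ?m] p by (simp only: sqrt_power_powr) (simp add: sqrt_power_powr)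
    then show "F_G A g 0 = F_K g * slice_const 1 ?m ?k" by (simp add: G_eq)
  qed
qed

end

theorem lemma6p2:
  fixes \<sigma> :: real
  assumes "0 < \<sigma>"
  shows
    "(\<forall>(g :: real^('k::finite option) \<Rightarrow> real) A.
        continuous_pdf g \<and> one_integrability g \<and> 0 < one_K g \<and>
        orthogonal_transformation A \<and> A (axis None 1) = diag_vec \<and>
        twice_differentiable_near (one_G A g) 0 \<longrightarrow>
        (let n = CARD('k option); \<alpha> = 2; m = 1; k = n - 1 in
         leading_term (relative_error g (mvn_pdf \<sigma>) one_T (one_K g))
           (const_C3 \<alpha> m k (one_K g) (one_G A g)) \<alpha>))
     \<and>
     (\<forall>(g :: real^('a::finite option + 'b::finite option) \<Rightarrow> real) A.
        continuous_pdf g \<and> two_integrability g \<and> 0 < two_K g \<and>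
        orthogonal_transformation A \<and>
        A (axis (Inl None) 1) = two_I1 \<and> A (axis (Inr None) 1) = two_I2 \<and>
        twice_differentiable_near (two_G A g) 0 \<longrightarrow>
        (let n1 = CARD('a option); n2 = CARD('b option); n = n1 + n2; \<alpha> = 2; m = 1; k = n - 2 in
         leading_term (relative_error g (mvn_pdf \<sigma>) two_T (two_K g))
           (const_C3 \<alpha> m k (two_K g) (two_G A g)) \<alpha>))
     \<and>
     (\<forall>(g :: (real^'p) \<times> (real^('q::finite option)) \<Rightarrow> real) A.
        2 \<le> CARD('p) \<and>
        continuous_pdf g \<and> F_integrability g \<and> 0 < F_K g \<and>
        orthogonal_transformation A \<and> A (axis None 1) = diag_vec \<and>
        twice_differentiable_near (F_G A g) 0 \<longrightarrow>
        (let n1 = CARD('p); n2 = CARD('q option); \<alpha> = 1; m = n1 - 1; k = n2 - 1 in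
         leading_term (relative_error g (mvn_pdf \<sigma>) F_T (F_K g))
           (const_C3 \<alpha> m k (F_K g) (F_G A g)) \<alpha>))"
proof (intro conjI allI impI; elim conjE)
  fix g :: "real^('k option) \<Rightarrow> real" and A
  assume "continuous_pdf g" "one_integrability g" "0 < one_K g"
    "orthogonal_transformation A" "A (axis None 1) = diag_vec" "twice_differentiable_near (one_G A g) 0"
  then show "let n = CARD('k option); \<alpha> = 2; m = 1; k = n - 1 in
      leading_term (relative_error g (mvn_pdf \<sigma>) one_T (one_K g)) (const_C3 \<alpha> m k (one_K g) (one_G A g)) \<alpha>"
    using leading_term_one[of A \<sigma> g] assms by (simp add: Let_def)
next
  fix g :: "real^('a option + 'b option) \<Rightarrow> real" and A
  assume "continuous_pdf g" "two_integrability g" "0 < two_K g" "orthogonal_transformation A"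
    "A (axis (Inl None) 1) = two_I1" "A (axis (Inr None) 1) = two_I2" "twice_differentiable_near (two_G A g) 0"
  then show "let n1 = CARD('a option); n2 = CARD('b option); n = n1 + n2; \<alpha> = 2; m = 1; k = n - 2 in
      leading_term (relative_error g (mvn_pdf \<sigma>) two_T (two_K g)) (const_C3 \<alpha> m k (two_K g) (two_G A g)) \<alpha>"
    using leading_term_two[of A \<sigma> g] assms by (simp add: Let_def)
next
  fix g :: "(real^'p) \<times> (real^('q option)) \<Rightarrow> real" and A
  assume "2 \<le> CARD('p)" "continuous_pdf g" "F_integrability g" "0 < F_K g"
    "orthogonal_transformation A" "A (axis None 1) = diag_vec" "twice_differentiable_near (F_G A g) 0"
  then show "let n1 = CARD('p); n2 = CARD('q option); \<alpha> = 1; m = n1 - 1; k = n2 - 1 in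
      leading_term (relative_error g (mvn_pdf \<sigma>) F_T (F_K g)) (const_C3 \<alpha> m k (F_K g) (F_G A g)) \<alpha>"
    using leading_term_F[of A \<sigma> g] assms by (simp add: Let_def)
qed

end
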